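(* Let $p$ be an odd prime and $R$ a $p$-torsion-free commutative $\mathbb{Z}_{(p)}$-algebra. Then $\mathrm{HC}^-_i(R/\!/p)=0$ for $i$ odd, and for any non-positive even $i$ the $R$-module $\mathrm{HC}^-_i(R/\!/p)$ is isomorphic to $$R^{\wedge}\times R/1\times R/3\times R/5\times\cdots.$$ There furthermore exists an infinite set $\overline{Z}\subset Z$ such that for any $i\in\overline{Z}$ the $R$-module $\mathrm{HC}^-_i(R/\!/p)$ is isomorphic to $$R^{\wedge}\times R/(i-1)\times R/(i+1)\times R/(i+3)\times\cdots.$$ The set $\overline{Z}$ contains all even numbers of the form $\frac{p^a\pm1}{2}+1$ for $a>0$ an integer. Here $R^{\wedge}$ denotes the $p$-adic completion of $R$, and the set $Z$ of positive even integers is the one defined in the context.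
   Context: $R/\!/p$ denotes the differential graded $R$-algebra whose underlying graded algebra is $R[x]$ with $x$ in degree $1$ (the tensor algebra on $x$; it is not graded commutative), with differential $\delta$ of degree $-1$ determined by $\delta x=p$ and the graded Leibniz rule, so $\delta x^n=p\,x^{n-1}$ for $n$ odd and $\delta x^n=0$ for $n$ even. $\mathrm{HC}^-_i(R/\!/p)$ denotes the negative cyclic homology of $R/\!/p$ over $R$ (all tensor products over $R$, usual Koszul signs for dg algebras, computed by the product totalization of the negative cyclic bicomplex). "$p$-torsion-free" means multiplication by $p$ is injective on $R$. $R/n$ means $R/nR$. The set $Z$: Define $B_0:=1$ and, for even $j\ge2$, $B_j:=\frac{p^2B_{j-2}}{j}\in\mathbb{Q}$; put $b_j:=\nu_p(B_j)$ with $\nu_p$ the $p$-adic valuation. For an integer $n\ge1$ divisible by $p$ let $g(n)$ be the maximum even integer $j\geq 0$ with $b_j<\nu_p(n)$. Let $X$ be the set of odd positive integers, $X_1\subset X$ those divisible by $p$, and $Z_1:=X\setminus\bigcup_{n\in X_1}[n,n+g(n)]$. Then $Z:=\{m+1: m\in Z_1\}$. *)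

theory Defs
  imports
    "HOL-Computational_Algebra.Computational_Algebra"
    "HOL-Library.Poly_Mapping"
    "HOL-Library.Function_Algebras"
    "HOL-Algebra.Module"
begin

text \<open>
  The base ring is the universe of a type of sort \<open>{comm_ring, comm_monoid_mult}\<close>, i.e. a
  commutative ring with unit. In contrast to \<open>comm_ring_1\<close> this sort does not demand
  \<open>0 \<noteq> 1\<close>, so the zero ring is included. As \<open>of_nat\<close> needs \<open>semiring_1\<close>, the multiple
  \<open>n \<cdot> r\<close> is written as an iterated sum.
\<close>

definition nat_mult :: "nat \<Rightarrow> 'a::comm_monoid_add \<Rightarrow> 'a" where
  "nat_mult n r = (\<Sum>_<n. r)"

definition Z_localized :: "nat \<Rightarrow> rat set" where
  "Z_localized p = {of_int a / of_int b |a b. \<not> int p dvd b}"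

text \<open>Values of \<open>h\<close> outside of \<open>Z_localized p\<close> are irrelevant.\<close>

definition Z_localized_algebra :: "nat \<Rightarrow> 'a::{comm_ring,comm_monoid_mult} itself \<Rightarrow> bool" where
  "Z_localized_algebra p _ \<longleftrightarrow>
     (\<exists>h :: rat \<Rightarrow> 'a. h 1 = 1 \<and>
        (\<forall>x \<in> Z_localized p. \<forall>y \<in> Z_localized p.
           h (x + y) = h x + h y \<and> h (x * y) = h x * h y))"


section \<open>Modules over a ring type\<close>

text \<open>
  Modules are records from \<open>HOL-Algebra\<close> whose scalars are all elements of a type; the fields
  \<open>mult\<close> and \<open>one\<close>, inherited from the ring record, carry no meaning.
\<close>

definition module_iso :: "('r, 'm) module \<Rightarrow> ('r, 'n) module \<Rightarrow> bool" (infix \<open>\<cong>\<^sub>m\<close> 50) where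
  "M \<cong>\<^sub>m N \<longleftrightarrow>
     (\<exists>f. bij_betw f (carrier M) (carrier N) \<and>
          (\<forall>x \<in> carrier M. \<forall>y \<in> carrier M. f (x \<oplus>\<^bsub>M\<^esub> y) = f x \<oplus>\<^bsub>N\<^esub> f y) \<and>
          (\<forall>r. \<forall>x \<in> carrier M. f (r \<odot>\<^bsub>M\<^esub> x) = r \<odot>\<^bsub>N\<^esub> f x))"

text \<open>\<open>U / V\<close> for submodules \<open>V \<subseteq> U\<close> of an ambient module with scalar multiplication \<open>sc\<close>.\<close>

definition quotient_module ::
    "('r \<Rightarrow> 'm \<Rightarrow> 'm) \<Rightarrow> 'm::ab_group_add set \<Rightarrow> 'm set \<Rightarrow> ('r, 'm set) module" where
  "quotient_module sc U V =
     \<lparr> carrier = (\<lambda>u. (+) u ` V) ` U,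
       monoid.mult = undefined, one = undefined,
       zero = V,
       add = (\<lambda>X Y. {x + y |x y. x \<in> X \<and> y \<in> Y}),
       smult = (\<lambda>r X. {sc r x + v |x v. x \<in> X \<and> v \<in> V}) \<rparr>"

definition prod_module :: "('r, 'm) module \<Rightarrow> ('r, 'n) module \<Rightarrow> ('r, 'm \<times> 'n) module"
    (infixr \<open>\<times>\<^sub>m\<close> 80) where
  "M \<times>\<^sub>m N =
     \<lparr> carrier = carrier M \<times> carrier N,
       monoid.mult = undefined, one = undefined,
       zero = (\<zero>\<^bsub>M\<^esub>, \<zero>\<^bsub>N\<^esub>),
       add = (\<lambda>x y. (fst x \<oplus>\<^bsub>M\<^esub> fst y, snd x \<oplus>\<^bsub>N\<^esub> snd y)),
       smult = (\<lambda>r x. (r \<odot>\<^bsub>M\<^esub> fst x, r \<odot>\<^bsub>N\<^esub> snd x)) \<rparr>"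

definition Prod_module :: "(nat \<Rightarrow> ('r, 'm) module) \<Rightarrow> ('r, nat \<Rightarrow> 'm) module" where
  "Prod_module M =
     \<lparr> carrier = {x. \<forall>k. x k \<in> carrier (M k)},
       monoid.mult = undefined, one = undefined,
       zero = (\<lambda>k. \<zero>\<^bsub>M k\<^esub>),
       add = (\<lambda>x y k. x k \<oplus>\<^bsub>M k\<^esub> y k),
       smult = (\<lambda>r x k. r \<odot>\<^bsub>M k\<^esub> x k) \<rparr>"

definition ring_mod :: "nat \<Rightarrow> ('a::{comm_ring,comm_monoid_mult}, 'a set) module" where
  "ring_mod n = quotient_module (*) UNIV (range (nat_mult n))"

text \<open>
  The inverse limit of the modules \<open>R / p\<^sup>k\<close>. The transition map sends a coset of
  \<open>p\<^sup>k\<^sup>+\<^sup>1 R\<close> to the coset of \<open>p\<^sup>k R\<close> containing it, hence compatibility is inclusion.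
\<close>

definition completion :: "nat \<Rightarrow> ('a::{comm_ring,comm_monoid_mult}, nat \<Rightarrow> 'a set) module" where
  "completion p =
     (Prod_module (\<lambda>k. ring_mod (p ^ k)))
       \<lparr> carrier := {x \<in> carrier (Prod_module (\<lambda>k. ring_mod (p ^ k))). \<forall>k. x (Suc k) \<subseteq> x k} \<rparr>"


section \<open>Differential graded algebras on a homogeneous basis\<close>

text \<open>
  A non-negatively graded dg algebra that is free as a module, given by structure constants on a
  homogeneous basis indexed by \<open>'b\<close>.
\<close>

record (overloaded) ('b, 'a) based_dga =
  dg_deg :: "'b \<Rightarrow> nat"
  dg_mult :: "'b \<Rightarrow> 'b \<Rightarrow> 'b \<Rightarrow>\<^sub>0 'a"
  dg_one :: "'b \<Rightarrow>\<^sub>0 'a"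
  dg_diff :: "'b \<Rightarrow> 'b \<Rightarrow>\<^sub>0 'a"

text \<open>The dg algebra \<open>R // p\<close>; the basis element \<open>k\<close> stands for \<open>x\<^sup>k\<close>.\<close>

definition ring_dquot :: "nat \<Rightarrow> (nat, 'a::{comm_ring,comm_monoid_mult}) based_dga" where
  "ring_dquot p =
     \<lparr> dg_deg = (\<lambda>k. k),
       dg_mult = (\<lambda>j k. Poly_Mapping.single (j + k) 1),
       dg_one = Poly_Mapping.single 0 1,
       dg_diff = (\<lambda>k. if odd k then Poly_Mapping.single (k - 1) (nat_mult p 1) else 0) \<rparr>"


section \<open>The Hochschild complex\<close>

text \<open>
  If \<open>A\<close> is free on \<open>'b\<close>, then the tensor power \<open>A\<^sup>\<otimes>\<^sup>m\<close> over the base ring is free on the words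
  \<open>[a\<^sub>1, \<dots>, a\<^sub>m]\<close> of length \<open>m\<close>, standing for \<open>a\<^sub>1 \<otimes> \<dots> \<otimes> a\<^sub>m\<close>. A finitely supported function
  on words is thus a sum of elements of the various tensor powers. A word of length \<open>n + 1\<close> has
  Hochschild degree \<open>n\<close>.
\<close>

definition pm_scale :: "'a::{comm_ring,comm_monoid_mult} \<Rightarrow> ('w \<Rightarrow>\<^sub>0 'a) \<Rightarrow> ('w \<Rightarrow>\<^sub>0 'a)" where
  "pm_scale r = Poly_Mapping.map ((*) r)"

definition pm_extend :: "('v \<Rightarrow> ('w \<Rightarrow>\<^sub>0 'a)) \<Rightarrow> ('v \<Rightarrow>\<^sub>0 'a) \<Rightarrow> ('w \<Rightarrow>\<^sub>0 'a::{comm_ring,comm_monoid_mult})" where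
  "pm_extend f c = (\<Sum>w \<in> Poly_Mapping.keys c. pm_scale (Poly_Mapping.lookup c w) (f w))"

definition signed :: "nat \<Rightarrow> 'm::ab_group_add \<Rightarrow> 'm" where
  "signed n c = (if even n then c else - c)"

definition word_deg :: "('b, 'a) based_dga \<Rightarrow> 'b list \<Rightarrow> nat" where
  "word_deg A w = sum_list (map (dg_deg A) w)"

text \<open>\<open>u \<otimes> a \<otimes> v\<close>\<close>

definition plug ::
    "'b list \<Rightarrow> ('b \<Rightarrow>\<^sub>0 'a::{comm_ring,comm_monoid_mult}) \<Rightarrow> 'b list \<Rightarrow> ('b list \<Rightarrow>\<^sub>0 'a)" where
  "plug u a v = pm_extend (\<lambda>b. Poly_Mapping.single (u @ b # v) 1) a"

text \<open>
  With \<open>n\<close> the Hochschild degree of \<open>w = [a\<^sub>0, \<dots>, a\<^sub>n]\<close>, the last summand is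
  \<open>(-1)\<^sup>n\<close> times the Koszul sign of moving \<open>a\<^sub>n\<close> to the front times
  \<open>a\<^sub>n a\<^sub>0 \<otimes> a\<^sub>1 \<otimes> \<dots> \<otimes> a\<^sub>n\<^sub>-\<^sub>1\<close>.
\<close>

definition hoch_b ::
    "('b, 'a) based_dga \<Rightarrow> 'b list \<Rightarrow> ('b list \<Rightarrow>\<^sub>0 'a::{comm_ring,comm_monoid_mult})" where
  "hoch_b A w =
     (let n = length w - 1 in
      if n = 0 then 0
      else (\<Sum>i<n. signed i
              (plug (take i w) (dg_mult A (w ! i) (w ! Suc i)) (drop (i + 2) w)))
         + signed (n + dg_deg A (last w) * word_deg A (butlast w))
              (plug [] (dg_mult A (last w) (hd w)) (butlast (tl w))))"

definition tensor_diff ::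
    "('b, 'a) based_dga \<Rightarrow> 'b list \<Rightarrow> ('b list \<Rightarrow>\<^sub>0 'a::{comm_ring,comm_monoid_mult})" where
  "tensor_diff A w =
     (\<Sum>i<length w. signed (word_deg A (take i w))
        (plug (take i w) (dg_diff A (w ! i)) (drop (Suc i) w)))"

text \<open>
  The differential of the total Hochschild complex: the sign \<open>(-1)\<^sup>n\<close> turns the commuting
  differentials into anticommuting ones.
\<close>

definition hoch_d ::
    "('b, 'a) based_dga \<Rightarrow> 'b list \<Rightarrow> ('b list \<Rightarrow>\<^sub>0 'a::{comm_ring,comm_monoid_mult})" where
  "hoch_d A w = hoch_b A w + signed (length w - 1) (tensor_diff A w)"

text \<open>
  The signed cyclic operator \<open>t\<close>, the norm \<open>N = 1 + t + \<dots> + t\<^sup>n\<close>, the extra degeneracy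
  \<open>s\<close>, and Connes' operator \<open>(1 - t) s N\<close>.
\<close>

definition cyc_t ::
    "('b, 'a) based_dga \<Rightarrow> 'b list \<Rightarrow> ('b list \<Rightarrow>\<^sub>0 'a::{comm_ring,comm_monoid_mult})" where
  "cyc_t A w =
     signed (length w - 1 + dg_deg A (last w) * word_deg A (butlast w))
       (Poly_Mapping.single (last w # butlast w) 1)"

definition cyc_N ::
    "('b, 'a) based_dga \<Rightarrow> 'b list \<Rightarrow> ('b list \<Rightarrow>\<^sub>0 'a::{comm_ring,comm_monoid_mult})" where
  "cyc_N A w = (\<Sum>i<length w. (pm_extend (cyc_t A) ^^ i) (Poly_Mapping.single w 1))"

definition cyc_s ::
    "('b, 'a) based_dga \<Rightarrow> 'b list \<Rightarrow> ('b list \<Rightarrow>\<^sub>0 'a::{comm_ring,comm_monoid_mult})" where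
  "cyc_s A w = plug [] (dg_one A) w"

definition connes_B ::
    "('b, 'a) based_dga \<Rightarrow> 'b list \<Rightarrow> ('b list \<Rightarrow>\<^sub>0 'a::{comm_ring,comm_monoid_mult})" where
  "connes_B A w =
     (let c = pm_extend (cyc_s A) (cyc_N A w) in c - pm_extend (cyc_t A) c)"


section \<open>Negative cyclic homology\<close>

text \<open>
  Chains of degree \<open>m\<close> in the total Hochschild complex: total degree is Hochschild degree plus
  internal degree.
\<close>

definition hoch_chains :: "('b, 'a::{comm_ring,comm_monoid_mult}) based_dga \<Rightarrow> int \<Rightarrow> ('b list \<Rightarrow>\<^sub>0 'a) set" where
  "hoch_chains A m =
     {c. \<forall>w \<in> Poly_Mapping.keys c. w \<noteq> [] \<and> int (length w - 1 + word_deg A w) = m}"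

text \<open>
  The product totalization of the negative \<open>(b, B)\<close>-bicomplex: degree \<open>i\<close> is the product of the
  groups of Hochschild chains of degree \<open>i + 2 k\<close>, \<open>k \<ge> 0\<close>, with differential \<open>b + B\<close>
  (where \<open>b\<close> contains the internal differential). For fixed \<open>i\<close> and \<open>k\<close> only finitely many
  tensor powers contribute, since the grading is non-negative.
\<close>

definition neg_cyclic_chains ::
    "('b, 'a::{comm_ring,comm_monoid_mult}) based_dga \<Rightarrow> int \<Rightarrow> (nat \<Rightarrow> 'b list \<Rightarrow>\<^sub>0 'a) set" where
  "neg_cyclic_chains A i = {c. \<forall>k. c k \<in> hoch_chains A (i + 2 * int k)}"

definition neg_cyclic_d ::
    "('b, 'a::{comm_ring,comm_monoid_mult}) based_dga \<Rightarrow>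
     (nat \<Rightarrow> 'b list \<Rightarrow>\<^sub>0 'a) \<Rightarrow> (nat \<Rightarrow> 'b list \<Rightarrow>\<^sub>0 'a)" where
  "neg_cyclic_d A c =
     (\<lambda>k. pm_extend (hoch_d A) (c k) + (if k = 0 then 0 else pm_extend (connes_B A) (c (k - 1))))"

definition HC_minus ::
    "('b, 'a::{comm_ring,comm_monoid_mult}) based_dga \<Rightarrow> int \<Rightarrow>
     ('a, (nat \<Rightarrow> 'b list \<Rightarrow>\<^sub>0 'a) set) module" where
  "HC_minus A i =
     quotient_module (\<lambda>r c k. pm_scale r (c k))
       {c \<in> neg_cyclic_chains A i. neg_cyclic_d A c = 0}
       (neg_cyclic_d A ` neg_cyclic_chains A (i + 1))"


section \<open>The index set\<close>

definition rat_val :: "nat \<Rightarrow> rat \<Rightarrow> int" where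
  "rat_val p q = int (multiplicity (int p) (fst (quotient_of q)))
               - int (multiplicity (int p) (snd (quotient_of q)))"

text \<open>Only the values at even arguments are used.\<close>

fun seq_B :: "nat \<Rightarrow> nat \<Rightarrow> rat" where
  "seq_B p 0 = 1"
| "seq_B p (Suc 0) = 0"
| "seq_B p (Suc (Suc j)) = of_nat p ^ 2 * seq_B p j / of_nat (Suc (Suc j))"

definition gap :: "nat \<Rightarrow> nat \<Rightarrow> nat" where
  "gap p n = Max {j. even j \<and> rat_val p (seq_B p j) < rat_val p (of_nat n)}"

definition Z1_set :: "nat \<Rightarrow> nat set" where
  "Z1_set p = {m. odd m} - (\<Union>n \<in> {n. odd n \<and> p dvd n}. {n..n + gap p n})"

definition Z_set :: "nat \<Rightarrow> nat set" where
  "Z_set p = (\<lambda>m. m + 1) ` Z1_set p"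

end

theory Submission
  imports Defs
begin

text \<open>
  The algebra \<open>R // p\<close> is a tensor algebra on one generator \<open>x\<close>, so up to chain homotopy its
  Hochschild complex is spanned by the words \<open>[a]\<close> and \<open>[a, 1]\<close>, standing for \<open>x\<^sup>a\<close> and
  \<open>x\<^sup>a dx\<close>. As \<open>b (x\<^sup>a dx) = 2 x\<^sup>a\<^sup>+\<^sup>1\<close> for odd \<open>a\<close> and \<open>2\<close> is invertible, the even positive powers
  of \<open>x\<close> cancel as well. What remains is a mixed complex \<open>M\<close> that is free of rank one in every
  degree \<open>m \<ge> 0\<close>: Connes' operator is multiplication by \<open>m\<close> from odd degree \<open>m\<close> to degree
  \<open>m + 1\<close>, the differential from odd degree \<open>m\<close> to degree \<open>m - 1\<close> is multiplication by \<open>p\<close> for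
  \<open>m = 1\<close> and by \<open>p\<^sup>2 / 2\<close> for \<open>m \<ge> 3\<close>, and everything else vanishes.

  The passage to \<open>M\<close> is a strict morphism of mixed complexes, given on words by an explicit
  functional (\<open>proj_d\<close>, \<open>proj_B\<close>), whose kernel is acyclic for the Hochschild differential
  (\<open>cycle_is_boundary\<close>). Solving one degree after the other, the kernel is then also acyclic for
  the total differential of the negative cyclic complex (\<open>neg_cycle_is_boundary\<close>). This needs
  \<open>d\<^sup>2 = 0\<close>, \<open>d B + B d = 0\<close> and \<open>B\<^sup>2 = 0\<close> on unnormalized chains, which come from the cyclic
  structure: all faces are conjugates of the first one under the signed rotation.

  Hence negative cyclic homology is that of a two-term complex of products of copies of \<open>R\<close>,
  whose map is bidiagonal. It is injective as \<open>R\<close> has no \<open>p\<close>-torsion, so the odd groups vanish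
  (\<open>odd_HC_minus\<close>). In even degrees there is a cokernel with generators \<open>y\<^sub>0, y\<^sub>1, \<dots>\<close> and relations
  \<open>q\<^sub>k y\<^sub>k + a\<^sub>k\<^sub>+\<^sub>1 y\<^sub>k\<^sub>+\<^sub>1 = 0\<close>, where the \<open>a\<^sub>k\<close> are consecutive odd integers and \<open>q\<^sub>k = p\<^sup>2 / 2\<close>, except
  that \<open>q\<^sub>0 = p\<close> in nonpositive degrees.

  To compute it, let \<open>\<alpha>\<^sub>l\<close> be the product of the \<open>- q\<^sub>j / a\<^sub>j\<^sub>+\<^sub>1\<close> for \<open>j < l\<close>. Formally \<open>y\<^sub>l = \<alpha>\<^sub>l y\<^sub>0\<close>,
  and if the \<open>\<alpha>\<^sub>l\<close> are \<open>p\<close>-integral and tend to \<open>0\<close>, then \<open>y\<^sub>l \<mapsto> \<alpha>\<^sub>l\<close> maps the cokernel to the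
  completion of \<open>R\<close>. For every \<open>K \<ge> 1\<close> the rule \<open>y\<^sub>l \<mapsto> \<alpha>\<^sub>l / \<alpha>\<^sub>K\<close>, restricted to the window
  \<open>K \<le> l \<le> K + v\<^sub>K\<close> with \<open>v\<^sub>K\<close> the valuation of \<open>a\<^sub>K\<close>, gives a map to \<open>R / a\<^sub>K\<close>: at the end of the
  window the next relation is already divisible by \<open>a\<^sub>K\<close>. Together these maps are an isomorphism
  (\<open>cokernel_iso\<close>). The integrality of the \<open>\<alpha>\<^sub>l\<close> is the only restriction on the degree: among
  the first \<open>k\<close> terms of an arithmetic progression of odd numbers all but one have valuations
  bounded by those of \<open>1, 2, \<dots>\<close>, and the exceptional one must not have valuation above its
  position. This holds for \<open>1, 3, 5, \<dots>\<close>, and it holds after \<open>m = (p\<^sup>a \<plusminus> 1) / 2\<close> because a multiple of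
  \<open>p\<^sup>e\<close> is at distance at least about \<open>p\<^sup>e / 2\<close> from \<open>p\<^sup>a / 2\<close>. The same distance estimate shows that
  such \<open>m\<close> avoid the excluded intervals (\<open>half_power_in_Z1\<close>); as \<open>m\<close> is prime to \<open>p\<close>, the
  factor \<open>R / m\<close> is zero. The set of these degrees serves as \<open>Zbar\<close>.
\<close>

section \<open>Linear maps between free modules\<close>

abbreviation "single \<equiv> Poly_Mapping.single"
abbreviation "keys \<equiv> Poly_Mapping.keys"
abbreviation "lookup \<equiv> Poly_Mapping.lookup"

lemma lookup_pm_scale [simp]:
  "lookup (pm_scale r c) w = r * lookup c w"
  by (simp add: pm_scale_def Poly_Mapping.map.rep_eq when_def)

lemma pm_scale_add: "pm_scale r (c + d) = pm_scale r c + pm_scale r d"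
  by (rule poly_mapping_eqI) (simp add: lookup_add algebra_simps)

lemma pm_scale_diff: "pm_scale r (c - d) = pm_scale r c - pm_scale r d"
  by (rule poly_mapping_eqI) (simp add: lookup_minus algebra_simps)

lemma pm_scale_minus: "pm_scale r (- c) = - pm_scale r c"
  by (rule poly_mapping_eqI) simp

lemma pm_scale_zero [simp]: "pm_scale r 0 = 0" "pm_scale 0 c = 0"
  by (rule poly_mapping_eqI, simp)+

lemma pm_scale_one [simp]: "pm_scale 1 c = c"
  by (rule poly_mapping_eqI) simp

lemma pm_scale_add_left: "pm_scale (r + s) c = pm_scale r c + pm_scale s c"
  by (rule poly_mapping_eqI) (simp add: lookup_add algebra_simps)

lemma pm_scale_minus_left: "pm_scale (- r) c = - pm_scale r c"
  by (rule poly_mapping_eqI) simp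

lemma pm_scale_scale [simp]: "pm_scale r (pm_scale s c) = pm_scale (r * s) c"
  by (rule poly_mapping_eqI) (simp add: mult.assoc)

lemma pm_scale_single [simp]: "pm_scale r (single w s) = single w (r * s)"
  by (rule poly_mapping_eqI) (simp add: lookup_single when_def)

lemma pm_scale_sum: "pm_scale r (sum f I) = (\<Sum>i\<in>I. pm_scale r (f i))"
  by (induction I rule: infinite_finite_induct) (simp_all add: pm_scale_add)

lemma pm_scale_left_sum: "pm_scale (sum f I) c = (\<Sum>i\<in>I. pm_scale (f i) c)"
  by (induction I rule: infinite_finite_induct) (simp_all add: pm_scale_add_left)

lemma pm_extend_superset:
  assumes "finite S" "keys c \<subseteq> S"
  shows "pm_extend f c = (\<Sum>w\<in>S. pm_scale (lookup c w) (f w))"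
  unfolding pm_extend_def using assms
  by (intro sum.mono_neutral_left) (auto simp: in_keys_iff)

lemma pm_extend_add [simp]: "pm_extend f (c + d) = pm_extend f c + pm_extend f d"
proof -
  let ?S = "keys c \<union> keys d"
  have "pm_extend f (c + d) = (\<Sum>w\<in>?S. pm_scale (lookup (c + d) w) (f w))"
    using keys_add[of c d] by (intro pm_extend_superset) auto
  also have "\<dots> = (\<Sum>w\<in>?S. pm_scale (lookup c w) (f w))
      + (\<Sum>w\<in>?S. pm_scale (lookup d w) (f w))"
    by (simp add: lookup_add pm_scale_add_left sum.distrib)
  also have "\<dots> = pm_extend f c + pm_extend f d"
    by (subst (1 2) pm_extend_superset[where S = ?S]) auto
  finally show ?thesis .
qed

lemma pm_extend_zero [simp]: "pm_extend f 0 = 0"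
  by (simp add: pm_extend_def)

lemma pm_extend_minus [simp]: "pm_extend f (- c) = - pm_extend f c"
  using pm_extend_add[of f c "- c"] by (simp add: eq_neg_iff_add_eq_0 add.commute)

lemma pm_extend_diff [simp]: "pm_extend f (c - d) = pm_extend f c - pm_extend f d"
  using pm_extend_add[of f c "- d"] by simp

lemma pm_extend_sum [simp]: "pm_extend f (sum g I) = (\<Sum>i\<in>I. pm_extend f (g i))"
  by (induction I rule: infinite_finite_induct) simp_all

lemma pm_extend_single [simp]: "pm_extend f (single w r) = pm_scale r (f w)"
  by (subst pm_extend_superset[where S = "{w}"]) auto

lemma pm_extend_scale [simp]: "pm_extend f (pm_scale r c) = pm_scale r (pm_extend f c)"
proof -
  have "pm_extend f (pm_scale r c) =
      (\<Sum>w\<in>keys c. pm_scale (lookup (pm_scale r c) w) (f w))"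
    by (rule pm_extend_superset) (auto simp: in_keys_iff)
  then show ?thesis by (simp add: pm_extend_def pm_scale_sum)
qed

lemma signed_simps [simp]:
  "signed n (c + d) = signed n c + signed n d"
  "signed n (c - d) = signed n c - signed n d"
  "signed n (- c) = - signed n c"
  "signed n 0 = 0"
  "signed 0 c = c"
  "signed (Suc n) c = - signed n c"
  "signed n (signed m c) = signed (n + m) c"
  by (auto simp: signed_def)

lemma signed_cong: "even m \<longleftrightarrow> even n \<Longrightarrow> signed m c = signed n c"
  by (simp add: signed_def)

lemma signed_sum: "signed n (sum f I) = (\<Sum>i\<in>I. signed n (f i))"
  by (simp add: signed_def sum_negf)

lemma pm_scale_signed: "pm_scale r (signed n c) = signed n (pm_scale r c)"
  by (simp add: signed_def pm_scale_minus)

lemma single_signed: "single w (signed n r) = signed n (single w r)"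
  by (simp add: signed_def single_uminus)

lemma pm_extend_signed [simp]: "pm_extend f (signed n c) = signed n (pm_extend f c)"
  by (simp add: signed_def)

text \<open>  The target may be another free module or the base ring itself; \<open>sc\<close> is its scalar
  multiplication.\<close>

definition linear_on_pm :: "('a::{comm_ring,comm_monoid_mult} \<Rightarrow> 'm \<Rightarrow> 'm) \<Rightarrow> (('w \<Rightarrow>\<^sub>0 'a) \<Rightarrow> 'm::ab_group_add) \<Rightarrow> bool"
  where "linear_on_pm sc F \<longleftrightarrow> (\<forall>c d. F (c + d) = F c + F d) \<and> (\<forall>r c. F (pm_scale r c) = sc r (F c))"

abbreviation "pm_linear \<equiv> linear_on_pm pm_scale"

lemma linear_on_pm_simps:
  assumes "linear_on_pm sc F"
  shows "F (c + d) = F c + F d" "F 0 = 0" "F (- c) = - F c" "F (c - d) = F c - F d"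
    "F (pm_scale r c) = sc r (F c)" "F (signed n c) = signed n (F c)" "F (sum f I) = (\<Sum>i\<in>I. F (f i))"
proof -
  show add: "F (c + d) = F c + F d" for c d using assms by (simp add: linear_on_pm_def)
  show "F (pm_scale r c) = sc r (F c)" using assms by (simp add: linear_on_pm_def)
  show z: "F 0 = 0" using add[of 0 0] by simp
  show m: "F (- c) = - F c" for c using add[of c "- c"] z by (simp add: eq_neg_iff_add_eq_0 add.commute)
  show "F (c - d) = F c - F d" using add[of c "- d"] m by simp
  show "F (signed n c) = signed n (F c)" by (simp add: signed_def m)
  show "F (sum f I) = (\<Sum>i\<in>I. F (f i))"
    by (induction I rule: infinite_finite_induct) (simp_all add: add z)
qed

lemma pm_eq_sum_single: "c = (\<Sum>w\<in>keys c. single w (lookup c w))"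
  by (rule poly_mapping_eqI) (auto simp: lookup_sum lookup_single when_def in_keys_iff sum.delta)

text \<open>Identities between operators on chains are checked on single words with this rule.\<close>

lemma linear_eqI:
  assumes F: "linear_on_pm sc F" and G: "linear_on_pm sc G"
    and eq: "\<And>w. w \<in> keys c \<Longrightarrow> F (single w 1) = G (single w 1)"
  shows "F c = G c"
proof -
  let ?s = "\<lambda>w. pm_scale (lookup c w) (single w 1)"
  have c: "c = (\<Sum>w\<in>keys c. ?s w)"
    using pm_eq_sum_single[of c] by simp
  have "F c = (\<Sum>w\<in>keys c. F (?s w))"
    using linear_on_pm_simps(7)[OF F, of ?s "keys c"] c by simp
  also have "\<dots> = (\<Sum>w\<in>keys c. G (?s w))"
    by (intro sum.cong refl) (simp only: linear_on_pm_simps(5)[OF F] linear_on_pm_simps(5)[OF G] eq)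
  also have "\<dots> = G c"
    using linear_on_pm_simps(7)[OF G, of ?s "keys c"] c by simp
  finally show ?thesis .
qed

lemma pm_linearI:
  "pm_linear (\<lambda>c. c)" "pm_linear (\<lambda>c. 0)" "pm_linear (pm_extend f)"
  "pm_linear F \<Longrightarrow> pm_linear (\<lambda>c. pm_extend f (F c))"
  "pm_linear F \<Longrightarrow> pm_linear G \<Longrightarrow> pm_linear (\<lambda>c. F c + G c)"
  "pm_linear F \<Longrightarrow> pm_linear G \<Longrightarrow> pm_linear (\<lambda>c. F c - G c)"
  "pm_linear F \<Longrightarrow> pm_linear (\<lambda>c. - F c)"
  "pm_linear F \<Longrightarrow> pm_linear (\<lambda>c. signed n (F c))"
  "pm_linear F \<Longrightarrow> pm_linear (\<lambda>c. pm_scale r (F c))"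
  by (auto simp: linear_on_pm_def pm_scale_add pm_scale_diff pm_scale_minus pm_scale_signed
      mult.commute algebra_simps)

lemma pm_linear_sum:
  "(\<And>i. i \<in> I \<Longrightarrow> pm_linear (F i)) \<Longrightarrow> pm_linear (\<lambda>c. \<Sum>i\<in>I. F i c)"
  by (induction I rule: infinite_finite_induct) (auto intro: pm_linearI)

lemma pm_linear_funpow:
  fixes f :: "'w \<Rightarrow> 'w \<Rightarrow>\<^sub>0 'a::{comm_ring,comm_monoid_mult}"
  shows "pm_linear F \<Longrightarrow> pm_linear (\<lambda>c. (pm_extend f ^^ k) (F c))"
  by (induction k) (simp_all add: linear_on_pm_def)

lemma pm_linear_comp:
  "linear_on_pm sc G \<Longrightarrow> pm_linear F \<Longrightarrow> linear_on_pm sc (\<lambda>c. G (F c))"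
  by (auto simp: linear_on_pm_def)

lemma keys_pm_extend:
  "keys (pm_extend f c) \<subseteq> (\<Union>w\<in>keys c. keys (f w))"
proof
  fix v assume "v \<in> keys (pm_extend f c)"
  then have "(\<Sum>w\<in>keys c. lookup c w * lookup (f w) v) \<noteq> 0"
    by (simp add: pm_extend_def in_keys_iff lookup_sum)
  then obtain w where "w \<in> keys c" "lookup c w * lookup (f w) v \<noteq> 0"
    by (meson sum.neutral)
  then show "v \<in> (\<Union>w\<in>keys c. keys (f w))"
    by (auto simp: in_keys_iff intro!: bexI[of _ w])
qed

section \<open>The operators on words\<close>

type_synonym 'a chain = "nat list \<Rightarrow>\<^sub>0 'a"

abbreviation "rot p \<equiv> pm_extend (cyc_t (ring_dquot p))"
abbreviation "delta p \<equiv> tensor_diff (ring_dquot p)"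
abbreviation "hochb p \<equiv> hoch_b (ring_dquot p)"
abbreviation "total_d p \<equiv> pm_extend (hoch_d (ring_dquot p))"
abbreviation "total_B p \<equiv> pm_extend (connes_B (ring_dquot p))"
abbreviation "hchains p \<equiv> hoch_chains (ring_dquot p)"

abbreviation word :: "'w \<Rightarrow> ('w \<Rightarrow>\<^sub>0 'a::{comm_ring,comm_monoid_mult})" where
  "word w \<equiv> single w 1"

abbreviation pcons :: "nat \<Rightarrow> 'a chain \<Rightarrow> 'a::{comm_ring,comm_monoid_mult} chain" where
  "pcons a \<equiv> pm_extend (\<lambda>w. word (a # w))"

abbreviation psnoc :: "nat \<Rightarrow> 'a chain \<Rightarrow> 'a::{comm_ring,comm_monoid_mult} chain" where
  "psnoc z \<equiv> pm_extend (\<lambda>w. word (w @ [z]))"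

abbreviation pmult :: "nat \<Rightarrow> 'a chain \<Rightarrow> 'a::{comm_ring,comm_monoid_mult} chain" where
  "pmult a \<equiv> pm_extend (\<lambda>w. word ((a + hd w) # tl w))"

text \<open>  The operator \<open>b'\<close>, that is \<open>b\<close> without its last face.\<close>

definition bar :: "nat list \<Rightarrow> 'a::{comm_ring,comm_monoid_mult} chain" where
  "bar w = (\<Sum>i<length w - 1. signed i (word (take i w @ (w ! i + w ! Suc i) # drop (i + 2) w)))"

definition last_face :: "nat list \<Rightarrow> 'a::{comm_ring,comm_monoid_mult} chain" where
  "last_face w = (if length w \<le> 1 then 0 else
     signed (length w - 1 + last w * sum_list (butlast w)) (word ((last w + hd w) # butlast (tl w))))"

definition first_face :: "nat list \<Rightarrow> 'a::{comm_ring,comm_monoid_mult} chain" where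
  "first_face w = word ((hd w + hd (tl w)) # tl (tl w))"

lemma pm_extend_comp: "pm_extend f (pm_extend g c) = pm_extend (\<lambda>w. pm_extend f (g w)) c"
  by (rule linear_eqI[of pm_scale]) (auto intro!: pm_linearI)

lemma pm_extend_eq_zero:
  "(\<And>w. w \<in> keys c \<Longrightarrow> f w = 0) \<Longrightarrow> pm_extend f c = 0"
  by (simp add: pm_extend_def)

lemma keys_signed [simp]: "keys (signed n c) = keys c"
  by (simp add: signed_def)

lemma keys_add_subset: "keys c \<subseteq> S \<Longrightarrow> keys d \<subseteq> S \<Longrightarrow> keys (c + d) \<subseteq> S"
  using keys_add[of c d] by auto

lemma keys_diff_subset: "keys c \<subseteq> S \<Longrightarrow> keys d \<subseteq> S \<Longrightarrow> keys (c - d) \<subseteq> S"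
  using keys_diff[of c d] by auto

lemma keys_sum_subset:
  "(\<And>i. i \<in> I \<Longrightarrow> keys (f i) \<subseteq> S) \<Longrightarrow> keys (sum f I) \<subseteq> S"
  by (induction I rule: infinite_finite_induct) (simp_all add: keys_add_subset)

lemma keys_single_subset: "w \<in> S \<Longrightarrow> keys (single w r) \<subseteq> S"
  by auto

lemma keys_extend_subset:
  "(\<And>w. w \<in> keys c \<Longrightarrow> keys (f w) \<subseteq> S) \<Longrightarrow> keys (pm_extend f c) \<subseteq> S"
  using keys_pm_extend[of f c] by blast

lemma bar_simps [simp]:
  "bar [] = 0" "bar [a] = 0"
  "bar (a # b # v) = word ((a + b) # v) - pcons a (bar (b # v))"
proof -
  show "bar (a # b # v) = word ((a + b) # v) - pcons a (bar (b # v))"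
    by (simp add: bar_def sum.lessThan_Suc_shift sum_negf[symmetric] del: sum.lessThan_Suc)
qed (simp_all add: bar_def)

text \<open>  The definition of \<open>bar\<close> unfolds at the head of a word, whereas the last face involves its end.
  This is the unfolding at the end.\<close>

lemma bar_snoc: "(bar (v @ [y, z]) :: 'a::{comm_ring,comm_monoid_mult} chain) = psnoc z (bar (v @ [y])) + signed (length v) (word (v @ [y + z]))"
proof (induction v)
  case (Cons a v)
  obtain b u where bu: "v @ [y] = b # u" by (cases v) auto
  have "v @ [y, z] = b # u @ [z]" using bu by (cases v) auto
  note eq = this
  have "(bar ((a # v) @ [y, z]) :: 'a chain) = word ((a + b) # u @ [z]) - pcons a (bar (v @ [y, z]))"
    by (simp only: eq append_Cons bar_simps)
  also have "\<dots> = word ((a + b) # u @ [z]) - pcons a (psnoc z (bar (v @ [y])))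
      - signed (length v) (word (a # v @ [y + z]))"
    using Cons.IH by (simp add: algebra_simps)
  also have "pcons a (psnoc z (bar (v @ [y]))) = (psnoc z (pcons a (bar (v @ [y]))) :: 'a chain)"
    by (simp add: pm_extend_comp)
  also have "word ((a + b) # u @ [z]) - psnoc z (pcons a (bar (v @ [y])))
      = psnoc z (bar ((a # v) @ [y]))"
    by (simp add: bu)
  finally show ?case by simp
qed simp

lemma bar_pmult: "(bar ((a + b) # v) :: 'a::{comm_ring,comm_monoid_mult} chain) = pmult a (bar (b # v))"
proof (cases v)
  case (Cons c u)
  have "pmult a (pcons b (bar (c # u))) = (pcons (a + b) (bar (c # u)) :: 'a chain)"
    by (simp add: pm_extend_comp)
  then show ?thesis using Cons by (simp add: add.assoc)
qed simp

lemma keys_bar: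
  "keys (bar w) \<subseteq> {u. Suc (length u) = length w \<and> sum_list u = sum_list w}"
proof (induction w rule: induct_list012)
  case (3 a b v)
  show ?case unfolding bar_simps
    by (intro keys_diff_subset keys_single_subset keys_extend_subset) (use 3 in auto)
qed auto

lemma bar_bar: "pm_extend bar (bar w) = (0 :: 'a::{comm_ring,comm_monoid_mult} chain)"
proof (induction w rule: induct_list012)
  case (3 a b v)
  have "pm_extend bar (pcons a c) = pmult a c - pcons a (pm_extend bar c)"
    if "keys c \<subseteq> {u. u \<noteq> []}" for c :: "'a chain"
  proof (rule linear_eqI[of pm_scale "\<lambda>c. pm_extend bar (pcons a c)" "\<lambda>c. pmult a c - pcons a (pm_extend bar c)"])
    fix w assume "w \<in> keys c"
    then have "w \<noteq> []" using that by auto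
    then obtain x u where "w = x # u" by (cases w) auto
    then show "pm_extend bar (pcons a (word w)) = ( pmult a (word w) - pcons a (pm_extend bar (word w)) :: 'a chain)"
      by simp
  qed (intro pm_linearI)+
  moreover have "keys (bar (b # v) :: 'a chain) \<subseteq> {u. u \<noteq> []}"
    using keys_bar[of "b # v"] by (cases v) auto
  ultimately show ?case
    using 3 by (simp add: bar_pmult)
qed simp_all

context
  fixes p :: nat
begin


lemma dga_simps [simp]:
  "dg_deg (ring_dquot p) = (\<lambda>k. k)" "dg_mult (ring_dquot p) j k = word (j + k)" "dg_one (ring_dquot p) = word 0"
  "dg_diff (ring_dquot p) k = (if odd k then single (k - 1) (nat_mult p 1) else 0)"
  by (simp_all add: ring_dquot_def)

lemma word_deg_dquot [simp]: "word_deg (ring_dquot p) w = sum_list w"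
  by (simp add: word_deg_def)

lemma plug_simps [simp]: "plug u (single k r) v = single (u @ k # v) r" "plug u 0 v = 0"
  by (simp_all add: plug_def)

lemma hoch_b_eq: "hochb p w = bar w + last_face w"
  by (auto simp: hoch_b_def bar_def last_face_def Let_def)

lemma cyc_s_eq: "cyc_s (ring_dquot p) w = word (0 # w)"
  by (simp add: cyc_s_def)

lemma tensor_diff_simps [simp]:
  "delta p [] = 0"
  "(delta p (a # w) :: 'a::{comm_ring,comm_monoid_mult} chain) = (if odd a then single ((a - 1) # w) (nat_mult p 1) else 0)
     + signed a (pcons a (delta p w))"
proof -
  have plug: "pcons a (plug u c v) = plug (a # u) c v" for u v and c :: "nat \<Rightarrow>\<^sub>0 'a"
    by (simp add: plug_def pm_extend_comp)
  define f :: "nat list \<Rightarrow> nat \<Rightarrow> 'a chain" where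
    "f w i = plug (take i w) (dg_diff (ring_dquot p) (w ! i)) (drop (Suc i) w)" for w i
  have f0: "f (a # w) 0 = (if odd a then single ((a - 1) # w) (nat_mult p 1) else 0)"
    by (simp add: f_def)
  have fSuc: "f (a # w) (Suc i) = pcons a (f w i)" for i
    by (simp only: f_def plug take_Suc_Cons drop_Suc_Cons nth_Cons_Suc)
  have td: "delta p w = (\<Sum>i<length w. signed (sum_list (take i w)) (f w i))" for w
    by (simp only: tensor_diff_def f_def word_deg_dquot)
  show "(delta p (a # w) :: 'a chain) = (if odd a
       then single ((a - 1) # w) (nat_mult p 1) else 0)
     + signed a (pcons a (delta p w))"
    by (simp only: td list.size(4) add_Suc_right add_0_right sum.lessThan_Suc_shift take_Suc_Cons
        sum_list.Cons take_0 sum_list.Nil fSuc f0 pm_extend_sum pm_extend_signed signed_sum signed_simps)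
qed (simp add: tensor_diff_def)

end

lemma last_face_simps [simp]: "last_face [] = 0" "last_face [a] = 0"
  by (simp_all add: last_face_def)

lemma last_face_snoc: "last_face (a # v @ [z]) =
    signed (Suc (length v) + z * (a + sum_list v)) (word ((z + a) # v))"
  by (simp add: last_face_def butlast_append)

text \<open>  With \<open>b = b' + l\<close> and \<open>b' b' = 0\<close>, the terms of \<open>b' l + l b'\<close> cancel except for the face
  that first adds the last two letters and then moves their sum to the front. It cancels
  against \<open>l l\<close>, which moves the two letters one after the other.\<close>

lemma hoch_b_hoch_b:
  fixes w :: "nat list"
  defines "b \<equiv> (\<lambda>w. bar w + last_face w :: 'a::{comm_ring,comm_monoid_mult} chain)"
  shows "pm_extend b (b w) = 0"
proof -
  have ext: "pm_extend b c = pm_extend bar c + pm_extend last_face c" for c :: "'a chain"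
    unfolding b_def
    by (rule linear_eqI[of pm_scale _ _ c]) (auto intro!: pm_linearI)
  consider "w = []" | a where "w = [a]" | a z where "w = [a, z]"
    | a v y z where "w = a # v @ [y, z]"
    by (metis append_butlast_last_id list.exhaust append.assoc append_Cons append_Nil)
  then show ?thesis
  proof cases
    case (3 a z)
    have "last_face [a, z] = (signed (Suc (z * a)) (word [z + a]) :: 'a chain)"
      using last_face_snoc[of a "[]" z] by simp
    then show ?thesis by (simp add: b_def 3)
  next
    case (4 a v y z)
    have lf: "last_face (a # v @ [y, z]) =
        (signed (length v + z * (a + sum_list v + y)) (word ((z + a) # v @ [y])) :: 'a chain)"
      using last_face_snoc[of a "v @ [y]" z] by (simp add: add.assoc)
    have "pm_extend last_face (psnoc z c) =
        signed (Suc (length v) + z * (a + sum_list v + y)) (pmult z c)"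
      if c: "keys c \<subseteq> {u. Suc (length u) = Suc (Suc (length v)) \<and> sum_list u = a + sum_list v + y}"
      for c :: "'a chain"
    proof (rule linear_eqI[of pm_scale "\<lambda>c. pm_extend last_face (psnoc z c)"])
      fix w assume "w \<in> keys c"
      then have w: "length w = Suc (length v)" "sum_list w = a + sum_list v + y" using c by auto
      then obtain x u where u: "w = x # u" by (cases w) auto
      show "pm_extend last_face (psnoc z (word w)) =
        signed (Suc (length v) + z * (a + sum_list v + y)) (pmult z (word w :: 'a chain))"
        using w by (simp add: u last_face_snoc)
    qed (intro pm_linearI)+
    moreover have "keys (bar (a # v @ [y]) :: 'a chain) \<subseteq>
        {u. Suc (length u) = Suc (Suc (length v)) \<and> sum_list u = a + sum_list v + y}"
      using keys_bar[of "a # v @ [y]"] by (simp add: add.assoc)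
    ultimately have 1: "pm_extend last_face (psnoc z (bar (a # v @ [y]) :: 'a chain)) =
        signed (Suc (length v) + z * (a + sum_list v + y)) (pmult z (bar (a # v @ [y])))"
      by blast
    have 2: "bar (a # v @ [y, z]) = (psnoc z (bar (a # v @ [y])) + signed (Suc (length v)) (word (a # v @ [y + z])) :: 'a chain)"
      using bar_snoc[of "a # v" y z] by simp
    have 3: "bar ((z + a) # v @ [y]) = (pmult z (bar (a # v @ [y])) :: 'a chain)"
      by (rule bar_pmult)
    have 4: "last_face (a # v @ [y + z]) = (signed (Suc (length v) + (y + z) * (a + sum_list v)) (word ((y + z + a) # v)) :: 'a chain)"
      by (rule last_face_snoc)
    have 5: "last_face ((z + a) # v @ [y]) = (signed (Suc (length v) + y * (z + a + sum_list v)) (word ((y + (z + a)) # v)) :: 'a chain)"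
      by (rule last_face_snoc)
    have bb: "pm_extend bar (bar w) = (0 :: 'a chain)" by (rule bar_bar)
    have bl: "pm_extend bar (last_face w) = (signed (length v + z * (a + sum_list v + y)) (pmult z (bar (a # v @ [y]))) :: 'a chain)"
      by (simp add: \<open>w = _\<close> lf 3)
    have lb: "pm_extend last_face (bar w) = (- signed (length v + z * (a + sum_list v + y)) (pmult z (bar (a # v @ [y])))
        + signed (length v + (length v + (y + z) * (a + sum_list v))) (word ((y + z + a) # v)) :: 'a chain)"
      by (simp add: \<open>w = _\<close> 2 1 4)
    have ll: "pm_extend last_face (last_face w) = (- signed (length v + (length v + (y + z) * (a + sum_list v))) (word ((y + z + a) # v)) :: 'a chain)"
      by (simp add: \<open>w = _\<close> lf 5 add.assoc) (rule signed_cong, auto simp: algebra_simps)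
    show ?thesis
      unfolding ext unfolding b_def by (simp add: bb bl lb ll)
  qed (simp_all add: b_def)
qed

section \<open>Rotations\<close>

context
  fixes p :: nat
begin


lemma cyc_t_snoc: "cyc_t (ring_dquot p) (v @ [x]) = signed (length v + x * sum_list v) (word (x # v))"
  by (simp add: cyc_t_def)

text \<open>  The Koszul signs of single rotations add up to the sign of exchanging the two blocks. This
  closed form yields both the order of the rotation and the conjugation of faces.\<close>

lemma cyc_t_power:
  "(rot p ^^ length u) (word (v @ u)) =
     signed (length u * Suc (length u + length v) + sum_list u * sum_list v) 
       (word (u @ v) :: 'a::{comm_ring,comm_monoid_mult} chain)"
proof (induction u arbitrary: v)
  case (Cons x u)
  have IH: "(rot p ^^ length u) (word ((v @ [x]) @ u)) =
      (signed (length u * Suc (length u + Suc (length v)) + sum_list u * (sum_list v + x)) 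
        (word ((u @ v) @ [x])) :: 'a chain)"
    using Cons.IH[of "v @ [x]"] by simp
  have "(rot p ^^ length (x # u)) (word (v @ x # u)) =
      (signed (length u * Suc (length u + Suc (length v)) + sum_list u * (sum_list v + x) +
        (length (u @ v) + x * sum_list (u @ v))) (word (x # u @ v)) :: 'a chain)"
    using IH by (simp only: funpow.simps length_Cons o_apply append.assoc append_Cons append_Nil
        pm_extend_signed pm_extend_single pm_scale_one cyc_t_snoc[of "u @ v", simplified append.assoc] signed_simps)
  also have "\<dots> = signed (length (x # u) * Suc (length (x # u) + length v) + sum_list (x # u) * sum_list v)
      (word ((x # u) @ v))"
    by (simp only: append_Cons) (rule signed_cong, auto)
  finally show ?case .
qed simp

lemma cyc_t_order: "(rot p ^^ length w) (word w) = (word w :: 'a::{comm_ring,comm_monoid_mult} chain)"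
proof -
  have "(rot p ^^ length w) (word w) = (signed (length w * Suc (length w)) (word w) :: 'a chain)"
    using cyc_t_power[of w "[]"] by simp
  also have "\<dots> = signed 0 (word w)" by (rule signed_cong) simp
  finally show ?thesis by simp
qed

lemma first_face_Cons [simp]: "first_face (a # b # v) = word ((a + b) # v)"
  by (simp add: first_face_def)

text \<open>  The \<open>j\<close>-th face with its sign is \<open>t\<^sup>j d\<^sub>0 t\<^sup>-\<^sup>j\<close>. Since \<open>t\<close> has order \<open>L\<close> on words of length
  \<open>L\<close>, the inverse power can be written as \<open>t\<^sup>L\<^sup>-\<^sup>j\<close>.\<close>

lemma face_conjugate:
  "(rot p ^^ length v) (pm_extend first_face
      ((rot p ^^ length (a # b # u)) (word (v @ a # b # u)))) =
    signed (length v) (word (v @ (a + b) # u) :: 'a::{comm_ring,comm_monoid_mult} chain)"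
proof -
  let ?T = "rot p :: 'a chain \<Rightarrow> 'a chain"
  have signed_pow: "(?T ^^ k) (signed n c) = signed n ((?T ^^ k) c)" for k n c
    by (induction k) simp_all
  have "(?T ^^ length v) (pm_extend first_face ((?T ^^ length (a # b # u)) (word (v @ a # b # u)))) =
     signed (length (a # b # u) * Suc (length (a # b # u) + length v) + sum_list (a # b # u) * sum_list v)
       ((?T ^^ length v) (word (((a + b) # u) @ v)))"
    unfolding cyc_t_power[of "a # b # u"]
    by (simp only: pm_extend_signed pm_extend_single pm_scale_one signed_pow append_Cons first_face_Cons)
  also have "(?T ^^ length v) (word (((a + b) # u) @ v)) =
      signed (length v * Suc (length v + length ((a + b) # u)) + sum_list v * sum_list ((a + b) # u))
        (word (v @ (a + b) # u))"
    by (rule cyc_t_power)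
  also have "signed (length (a # b # u) * Suc (length (a # b # u) + length v) + sum_list (a # b # u) * sum_list v)
      \<dots> = signed (length v) (word (v @ (a + b) # u))"
    unfolding signed_simps by (rule signed_cong) auto
  finally show ?thesis .
qed

lemma funpow_Suc_0: "((f :: 'b \<Rightarrow> 'b) ^^ Suc 0) c = f c" by simp

definition face :: "nat \<Rightarrow> nat \<Rightarrow> 'a::{comm_ring,comm_monoid_mult} chain \<Rightarrow> 'a chain" where
  "face L j c = (rot p ^^ j) (pm_extend first_face ((rot p ^^ (L - j)) c))"

lemma pm_linear_face: "pm_linear (face L j)"
  unfolding face_def by (intro pm_linearI pm_linear_funpow)

lemma bar_eq_faces:
  "bar w = (\<Sum>j<length w - 1. face (length w) j (word w :: 'a::{comm_ring,comm_monoid_mult} chain))"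
  unfolding bar_def
proof (intro sum.cong refl)
  fix j assume "j \<in> {..<length w - 1}"
  then have j: "Suc j < length w" by auto
  define v u where "v = take j w" and "u = drop (j + 2) w"
  have w: "w = v @ w ! j # w ! Suc j # u"
    using j by (simp add: v_def u_def Cons_nth_drop_Suc)
  have lv: "length v = j" and lu: "length w - j = length (w ! j # w ! Suc j # u)"
    using j by (auto simp: v_def u_def)
  have "face (length w) j (word w :: 'a chain) = 
     (rot p ^^ length v) (pm_extend first_face
      ((rot p ^^ length (w ! j # w ! Suc j # u)) (word (v @ w ! j # w ! Suc j # u))))"
    unfolding face_def lu lv using w by simp
  also have "\<dots> = signed (length v) (word (v @ (w ! j + w ! Suc j) # u))"
    by (rule face_conjugate)
  finally show "signed j (word (take j w @ (w ! j + w ! Suc j) # drop (j + 2) w)) =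
      face (length w) j (word w :: 'a chain)"
    unfolding lv by (simp only: v_def u_def)
qed

lemma last_face_eq_face:
  assumes "2 \<le> length w"
  shows "last_face w = (face (length w) (length w - 1) (word w) :: 'a::{comm_ring,comm_monoid_mult} chain)"
proof -
  obtain a v z where w: "w = a # v @ [z]"
    using assms by (metis Suc_le_length_iff append_butlast_last_id list.distinct(1) numeral_2_eq_2)
  have "(rot p (word w) :: 'a chain) = signed (Suc (length v) + z * (a + sum_list v)) (word (z # a # v))"
    using cyc_t_snoc[of "a # v" z] by (simp add: w)
  moreover have "(rot p ^^ Suc (length v)) (signed k c) =
     signed k ((rot p ^^ Suc (length v)) c)" for k and c :: "'a chain"
    by (intro linear_on_pm_simps[of pm_scale] pm_linear_funpow) (rule pm_linearI)
  moreover have "length w - (length w - 1) = Suc 0" "length w - 1 = Suc (length v)"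
    by (simp_all add: w)
  moreover have "length ((z + a) # v) = Suc (length v)" by simp
  ultimately have "face (length w) (length w - 1) (word w :: 'a chain) =
     signed (Suc (length v) + z * (a + sum_list v)) ((rot p ^^ length ((z + a) # v)) (word ((z + a) # v)))"
    by (simp only: face_def funpow_Suc_0 pm_extend_signed pm_extend_single pm_scale_one first_face_Cons)
  then show ?thesis by (simp only: cyc_t_order w last_face_snoc)
qed

lemma hoch_b_eq_faces:
  assumes "2 \<le> length w"
  shows "hochb p w = (\<Sum>j<length w. face (length w) j (word w :: 'a::{comm_ring,comm_monoid_mult} chain))"
proof -
  obtain n where "length w = Suc n" using assms by (cases "length w") auto
  then show ?thesis using last_face_eq_face[OF assms, where 'a = 'a]
    by (simp add: hoch_b_eq bar_eq_faces)
qed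

end

section \<open>The mixed complex identities\<close>

text \<open>  The rotation has order \<open>L\<close> only on words of length \<open>L\<close>, so the cyclic identities are stated
  for chains that are homogeneous in this sense.\<close>

definition of_length :: "nat \<Rightarrow> 'a::{comm_ring,comm_monoid_mult} chain \<Rightarrow> bool" where
  "of_length L c \<longleftrightarrow> keys c \<subseteq> {w. length w = L}"

lemma of_length_single [simp]: "length w = L \<Longrightarrow> of_length L (single w r)"
  by (auto simp: of_length_def)

lemma of_length_closed:
  "of_length L 0"
  "of_length L c \<Longrightarrow> of_length L d \<Longrightarrow> of_length L (c + d)"
  "of_length L c \<Longrightarrow> of_length L d \<Longrightarrow> of_length L (c - d)"
  "of_length L c \<Longrightarrow> of_length L (- c)"
  "of_length L c \<Longrightarrow> of_length L (signed n c)"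
  "(\<And>i. i \<in> I \<Longrightarrow> of_length L (f i)) \<Longrightarrow> of_length L (sum f I)"
  "(\<And>w. length w = M \<Longrightarrow> of_length L (g w)) \<Longrightarrow> of_length M c \<Longrightarrow> of_length L (pm_extend g c)"
  unfolding of_length_def
  by (simp_all add: keys_add_subset keys_diff_subset keys_sum_subset keys_extend_subset subset_eq[of _ "{w. length w = M}"])

lemma bar_pcons_zero:
  assumes "\<And>w. w \<in> keys c \<Longrightarrow> w \<noteq> []"
  shows "pm_extend bar (pcons 0 c) = (c - pcons 0 (pm_extend bar c) :: 'a::{comm_ring,comm_monoid_mult} chain)"
proof (rule linear_eqI[of pm_scale "\<lambda>c. pm_extend bar (pcons 0 c)" "\<lambda>c. c - pcons 0 (pm_extend bar c)"])
  fix w assume "w \<in> keys c"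
  then obtain x u where "w = x # u" using assms by (metis list.exhaust)
  then show "pm_extend bar (pcons 0 (word w)) = (word w - pcons 0 (pm_extend bar (word w)) :: 'a chain)"
    by simp
qed (intro pm_linearI)+

context
  fixes p :: nat
begin



definition norm_sum :: "nat \<Rightarrow> 'a::{comm_ring,comm_monoid_mult} chain \<Rightarrow> 'a chain" where
  "norm_sum L c = (\<Sum>i<L. (rot p ^^ i) c)"

lemma pm_linear_norm_sum: "pm_linear (norm_sum L)"
  unfolding norm_sum_def by (intro pm_linear_sum pm_linear_funpow pm_linearI)

lemma of_length_T: "of_length L c \<Longrightarrow> 0 < L \<Longrightarrow> of_length L (rot p c)"
proof (rule of_length_closed(7)[of L])
  fix w :: "nat list" assume "0 < L" "length w = L"
  then show "of_length L (cyc_t (ring_dquot p) w :: 'a chain)"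
    unfolding cyc_t_def by (intro of_length_closed of_length_single) auto
qed

lemma of_length_T_power: "of_length L c \<Longrightarrow> 0 < L \<Longrightarrow> of_length L ((rot p ^^ k) c)"
  by (induction k) (simp_all add: of_length_T)

lemma T_order: "of_length L c \<Longrightarrow> (rot p ^^ L) c = c"
  unfolding of_length_def
  by (rule linear_eqI[of pm_scale "rot p ^^ L" "\<lambda>c. c"])
    (use cyc_t_order in \<open>auto intro!: pm_linearI pm_linear_funpow[where F = "\<lambda>c. c"]\<close>)

lemma T_norm_sum: "of_length L c \<Longrightarrow> rot p (norm_sum L c) = norm_sum L c"
proof -
  assume c: "of_length L c"
  have "rot p (norm_sum L c) + c = (\<Sum>i<Suc L. (rot p ^^ i) c)"
    by (simp add: norm_sum_def sum.lessThan_Suc_shift del: sum.lessThan_Suc)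
  also have "\<dots> = norm_sum L c + c"
    using T_order[OF c] by (simp add: norm_sum_def)
  finally show ?thesis by simp
qed

lemma norm_sum_T: "of_length L c \<Longrightarrow> norm_sum L (rot p c) = norm_sum L c"
  using T_norm_sum[of L c] by (simp add: norm_sum_def funpow_swap1)

lemma norm_sum_T_power: "of_length L c \<Longrightarrow> norm_sum L ((rot p ^^ k) c) = norm_sum L c"
  by (cases "L = 0", simp add: norm_sum_def, induction k) (simp_all add: norm_sum_T of_length_T_power)

lemma T_power_norm_sum: "of_length L c \<Longrightarrow> (rot p ^^ k) (norm_sum L c) = norm_sum L c"
  by (induction k) (simp_all add: T_norm_sum)

lemma cyc_N_eq: "cyc_N (ring_dquot p) w = norm_sum (length w) (word w)"
  by (simp add: cyc_N_def norm_sum_def)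

lemma of_length_norm_sum: "of_length L c \<Longrightarrow> of_length L (norm_sum L c)"
  unfolding norm_sum_def by (intro of_length_closed of_length_T_power) auto

lemma of_length_first_face: "of_length (Suc n) c \<Longrightarrow> 1 \<le> n \<Longrightarrow> of_length n (pm_extend first_face c)"
  by (rule of_length_closed(7)[of "Suc n"]) (auto simp: first_face_def intro!: of_length_single)

lemma extend_hoch_b_faces:
  assumes "of_length L c" "2 \<le> L"
  shows "pm_extend (hochb p) c = (\<Sum>j<L. face p L j c)"
proof (rule linear_eqI[of pm_scale "pm_extend (hochb p)" "\<lambda>c. \<Sum>j<L. face p L j c"])
  fix w assume "w \<in> keys c"
  then have "length w = L" using assms(1) by (auto simp: of_length_def)
  then show "pm_extend (hochb p) (word w) = (\<Sum>j<L. face p L j (word w :: 'a chain))"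
    using hoch_b_eq_faces[of w p] assms(2) by simp
qed (intro pm_linearI pm_linear_sum pm_linear_face)+

lemma extend_bar_faces:
  assumes "of_length L c"
  shows "pm_extend bar c = (\<Sum>j<L - 1. face p L j c)"
proof (rule linear_eqI[of pm_scale "pm_extend bar" "\<lambda>c. \<Sum>j<L - 1. face p L j c"])
  fix w assume "w \<in> keys c"
  then have "length w = L" using assms(1) by (auto simp: of_length_def)
  then show "pm_extend bar (word w) = (\<Sum>j<L - 1. face p L j (word w :: 'a chain))"
    using bar_eq_faces[of w p] by simp
qed (intro pm_linearI pm_linear_sum pm_linear_face)+

text \<open>  Writing \<open>b\<close> as the sum of all \<open>t\<^sup>j d\<^sub>0 t\<^sup>-\<^sup>j\<close>, composition with \<open>t\<close> shifts the index by one, and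
  only the two end terms differ.\<close>

lemma hoch_b_one_minus_T:
  assumes c: "of_length L c" and L: "2 \<le> L"
  shows "pm_extend (hochb p) (c - rot p c) = pm_extend bar c - rot p (pm_extend bar c)"
proof -
  obtain n where n: "L = Suc n" "1 \<le> n" using L by (cases L) auto
  have face_Suc: "face p L (Suc j) (rot p c) = rot p (face p L j c)" if "j < n" for j
  proof -
    have "L - j = Suc (L - Suc j)" using that n by simp
    then show ?thesis by (simp add: face_def funpow_swap1)
  qed
  have "face p L 0 (rot p c) = pm_extend first_face (rot p c)"
    using T_order[OF of_length_T[OF c]] L by (simp add: face_def)
  also have "\<dots> = (rot p ^^ n) (pm_extend first_face (rot p c))"
    using T_order[OF of_length_first_face[of n "rot p c"]] of_length_T[OF c] n by simp
  also have "\<dots> = face p L n c" using n by (simp add: face_def)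
  finally have "face p L 0 (rot p c) = face p L n c" .
  then have "pm_extend (hochb p) (rot p c) = face p L n c + rot p (\<Sum>j<n. face p L j c)"
    using extend_hoch_b_faces[OF of_length_T[OF c] L] face_Suc n
    by (simp add: sum.lessThan_Suc_shift del: sum.lessThan_Suc)
  moreover have "pm_extend (hochb p) c = (\<Sum>j<n. face p L j c) + face p L n c"
    using extend_hoch_b_faces[OF c L] n by simp
  ultimately show ?thesis
    using extend_bar_faces[OF c] n by simp
qed

text \<open>  Both sides equal \<open>N d\<^sub>0 N\<close>, because \<open>N\<close> absorbs powers of \<open>t\<close> on either side.\<close>

lemma bar_norm_sum:
  assumes c: "of_length (Suc n) c" and n: "1 \<le> n"
  shows "pm_extend bar (norm_sum (Suc n) c) = norm_sum n (pm_extend (hochb p) c)"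
proof -
  let ?L = "Suc n"
  have "pm_extend bar (norm_sum ?L c) = norm_sum n (pm_extend first_face (norm_sum ?L c))"
    (is "?lhs = _") using extend_bar_faces[OF of_length_norm_sum[OF c]]
    by (simp add: face_def T_power_norm_sum[OF c] norm_sum_def[of n])
  also have "norm_sum n (pm_extend first_face (norm_sum ?L c)) = norm_sum n (pm_extend first_face (\<Sum>j<?L. (rot p ^^ (?L - j)) c))"
  proof -
    have "norm_sum ?L c = rot p (norm_sum ?L c)" using T_norm_sum[OF c] by simp
    also have "\<dots> = (\<Sum>j<?L. (rot p ^^ Suc j) c)" by (simp add: norm_sum_def)
    also have "\<dots> = (\<Sum>j<?L. (rot p ^^ (?L - j)) c)"
      by (rule sum.reindex_bij_witness[where i = "\<lambda>j. n - j" and j = "\<lambda>j. n - j"]) (auto simp: Suc_diff_le)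
    finally show ?thesis by (rule arg_cong)
  qed
  also have "norm_sum n (pm_extend first_face (\<Sum>j<?L. (rot p ^^ (?L - j)) c)) =
      (\<Sum>j<?L. norm_sum n (pm_extend first_face ((rot p ^^ (?L - j)) c)))"
    unfolding pm_extend_sum by (rule linear_on_pm_simps(7)[OF pm_linear_norm_sum])
  also have "\<dots> = (\<Sum>j<?L. norm_sum n (face p ?L j c))"
    unfolding face_def
    by (intro sum.cong refl norm_sum_T_power[symmetric] of_length_first_face of_length_T_power c n) auto
  also have "\<dots> = norm_sum n (pm_extend (hochb p) c)"
    using extend_hoch_b_faces[OF c] n linear_on_pm_simps(7)[OF pm_linear_norm_sum, symmetric]
    by (simp del: sum.lessThan_Suc)
  finally show ?thesis .
qed

lemma extend_connes_B:
  assumes "of_length L c"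
  shows "total_B p c = pcons 0 (norm_sum L c) - rot p (pcons 0 (norm_sum L c))"
proof (rule linear_eqI[of pm_scale "total_B p" "\<lambda>c. pcons 0 (norm_sum L c) - rot p (pcons 0 (norm_sum L c))"])
  fix w assume "w \<in> keys c"
  then have "length w = L" using assms(1) by (auto simp: of_length_def)
  then show "total_B p (word w) =
      (pcons 0 (norm_sum L (word w)) - rot p (pcons 0 (norm_sum L (word w))) :: 'a chain)"
    by (simp add: connes_B_def Let_def cyc_N_eq cyc_s_eq[abs_def])
qed (intro pm_linearI pm_linear_norm_sum)+

lemma of_length_pcons: "of_length L c \<Longrightarrow> of_length (Suc L) (pcons a c)"
  by (rule of_length_closed(7)[of L]) (auto intro!: of_length_single)

lemma of_length_connes_B: "of_length L c \<Longrightarrow> of_length (Suc L) (total_B p c)"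
  by (simp add: extend_connes_B of_length_closed of_length_pcons of_length_norm_sum of_length_T)

lemma connes_B_connes_B: "total_B p (total_B p (word w)) = (0 :: 'a::{comm_ring,comm_monoid_mult} chain)"
proof -
  let ?x = "pcons 0 (norm_sum (length w) (word w)) :: 'a chain"
  have x: "of_length (Suc (length w)) ?x"
    by (intro of_length_pcons of_length_norm_sum) simp
  have B: "total_B p (word w) = ?x - rot p ?x"
    by (rule extend_connes_B) simp
  have "norm_sum (Suc (length w)) (?x - rot p ?x) = 0"
    using norm_sum_T[OF x] by (simp add: linear_on_pm_simps(4)[OF pm_linear_norm_sum])
  then show ?thesis
    unfolding B by (subst extend_connes_B[of "Suc (length w)"]) (auto intro: of_length_closed of_length_T x)
qed

lemma of_length_hoch_b:
  assumes "of_length (Suc n) c" "1 \<le> n"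
  shows "of_length n (pm_extend (hochb p) c)"
proof -
  have "pm_extend (hochb p) c = (\<Sum>j<Suc n. face p (Suc n) j c)"
    using assms by (intro extend_hoch_b_faces) auto
  then show ?thesis using assms
    by (simp only: face_def) (intro of_length_closed of_length_T_power of_length_first_face, auto)
qed

lemma hoch_b_short: "length w \<le> 1 \<Longrightarrow> hochb p w = 0"
  by (simp add: hoch_b_def)

text \<open>  With \<open>B = (1 - t) s N\<close> the relations \<open>b (1 - t) = (1 - t) b'\<close>, \<open>b' s = 1 - s b'\<close> and
  \<open>b' N = N b\<close> give \<open>b B = (1 - t) (1 - s b') N = - (1 - t) s N b = - B b\<close>.\<close>

lemma hoch_b_connes_B:
  "pm_extend (hochb p) (connes_B (ring_dquot p) w) + total_B p (hochb p w) = (0 :: 'a::{comm_ring,comm_monoid_mult} chain)"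
proof (cases "w = []")
  case False
  let ?L = "length w"
  let ?y = "norm_sum ?L (word w) :: 'a chain"
  have L: "1 \<le> ?L" using False by (cases w) auto
  have y: "of_length ?L ?y" by (intro of_length_norm_sum) simp
  have "pm_extend (hochb p) (connes_B (ring_dquot p) w) = pm_extend (hochb p) (pcons 0 ?y - rot p (pcons 0 ?y))"
    using extend_connes_B[of ?L "word w :: 'a chain"] by simp
  also have "\<dots> = pm_extend bar (pcons 0 ?y) - rot p (pm_extend bar (pcons 0 ?y))"
    using L by (intro hoch_b_one_minus_T[of "Suc ?L"] of_length_pcons y) simp
  also have "pm_extend bar (pcons 0 ?y) = ?y - pcons 0 (pm_extend bar ?y)"
    using y L by (intro bar_pcons_zero) (auto simp: of_length_def)
  finally have 1: "pm_extend (hochb p) (connes_B (ring_dquot p) w) =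
      rot p (pcons 0 (pm_extend bar ?y)) - pcons 0 (pm_extend bar ?y)"
    using T_norm_sum[of ?L "word w :: 'a chain"] by simp
  show ?thesis
  proof (cases "?L = 1")
    case True
    have "bar u = (0 :: 'a chain)" if "u \<in> keys ?y" for u
    proof -
      have "length u = 1" using that y True by (auto simp: of_length_def)
      then show ?thesis by (auto simp: length_Suc_conv)
    qed
    then have "pm_extend bar ?y = 0" by (rule pm_extend_eq_zero)
    then show ?thesis using 1 True by (simp add: hoch_b_short)
  next
    case False
    then obtain n where n: "?L = Suc n" "1 \<le> n" using L by (cases ?L) auto
    have "pm_extend bar ?y = norm_sum n (hochb p w)"
      using bar_norm_sum[of n "word w"] n by simp
    moreover have "of_length n (hochb p w :: 'a chain)"
      using of_length_hoch_b[of n "word w :: 'a chain"] n by simp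
    ultimately show ?thesis
      using 1 by (simp add: extend_connes_B[of n])
  qed
qed (simp add: hoch_b_def connes_B_def Let_def cyc_N_def)

end

context
  fixes p :: nat
begin


lemma keys_delta:
  "keys (delta p w) \<subseteq> {u. length u = length w \<and> Suc (sum_list u) = sum_list w}"
proof (induction w)
  case (Cons a w)
  show ?case unfolding tensor_diff_simps
    by (intro keys_add_subset) (use Cons in \<open>auto dest!: subsetD[OF keys_pm_extend] split: if_splits\<close>)
qed simp

lemma of_length_delta: "of_length L c \<Longrightarrow> of_length L (pm_extend (delta p) c)"
  by (rule of_length_closed(7)[of L]) (use keys_delta in \<open>auto simp: of_length_def\<close>)

lemma delta_snoc:
  "delta p (v @ [z]) = psnoc z (delta p v) + signed (sum_list v)
     (if odd z then single (v @ [z - 1]) (nat_mult p 1 :: 'a::{comm_ring,comm_monoid_mult}) else 0)"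
proof (induction v)
  case (Cons a v)
  have "pcons a (psnoc z c) = psnoc z (pcons a c)" for c :: "'a chain"
    by (simp add: pm_extend_comp)
  then show ?case using Cons by (simp add: add.assoc)
qed simp

text \<open>  Rotating by a letter of degree \<open>z\<close> past a word whose degree was lowered by one changes the
  Koszul sign by \<open>(-1)\<^sup>z\<close>, which is the sign of \<open>delta\<close> passing that letter.\<close>

lemma T_delta: "w \<noteq> [] \<Longrightarrow> rot p (delta p w) = (pm_extend (delta p) (cyc_t (ring_dquot p) w) :: 'a::{comm_ring,comm_monoid_mult} chain)"
proof (cases w rule: rev_cases)
  case (snoc v z)
  have "rot p (psnoc z c) = signed (length v + z * (sum_list v + 1)) (pcons z c)"
    if c: "keys c \<subseteq> {u. length u = length v \<and> Suc (sum_list u) = sum_list v}"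
    for c :: "'a chain"
  proof (rule linear_eqI[of pm_scale "\<lambda>c. rot p (psnoc z c)"])
    fix u assume "u \<in> keys c"
    then have u: "length u = length v" "sum_list v = Suc (sum_list u)" using c by auto
    show "rot p (psnoc z (word u)) = signed (length v + z * (sum_list v + 1)) (pcons z (word u) :: 'a chain)"
      using u by (simp add: cyc_t_snoc) (rule signed_cong, auto)
  qed (intro pm_linearI)+
  then have 1: "rot p (psnoc z (delta p v)) = (signed (length v + z * (sum_list v + 1)) (pcons z (delta p v)) :: 'a chain)"
    using keys_delta[of v] by blast
  show ?thesis
  proof (cases "odd z")
    case True
    then obtain y where y: "z = Suc y" "even y" by (cases z) auto
    have "signed (sum_list v + (length v + y * sum_list v)) c = signed (length v + z * sum_list v) (c :: 'a chain)" for c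
      using y by (intro signed_cong) auto
    then show ?thesis
      unfolding snoc delta_snoc using 1 True y
      by (simp add: cyc_t_snoc pm_scale_signed)
        (simp add: signed_def)
  next
    case False
    then show ?thesis
      unfolding snoc delta_snoc using 1 by (simp add: cyc_t_snoc) (simp add: signed_def)
  qed
qed simp

lemma T_delta_chain:
  assumes "of_length L c" "0 < L"
  shows "rot p (pm_extend (delta p) c) = (pm_extend (delta p) (rot p c) :: 'a::{comm_ring,comm_monoid_mult} chain)"
proof (rule linear_eqI[of pm_scale "\<lambda>c. rot p (pm_extend (delta p) c)" "\<lambda>c. pm_extend (delta p) (rot p c)"])
  fix w assume "w \<in> keys c"
  then have "w \<noteq> []" using assms by (auto simp: of_length_def)
  then show "rot p (pm_extend (delta p) (word w)) = (pm_extend (delta p) (rot p (word w)) :: 'a chain)"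
    by (simp add: T_delta)
qed (intro pm_linearI)+

lemma T_power_delta:
  assumes "of_length L c" "0 < L"
  shows "(rot p ^^ k) (pm_extend (delta p) c) = (pm_extend (delta p) ((rot p ^^ k) c) :: 'a::{comm_ring,comm_monoid_mult} chain)"
  by (induction k) (simp_all add: T_delta_chain[OF of_length_T_power[OF assms] assms(2)])

lemma first_face_delta:
  assumes "of_length L c" "2 \<le> L"
  shows "pm_extend first_face (pm_extend (delta p) c) = (pm_extend (delta p) (pm_extend first_face c) :: 'a::{comm_ring,comm_monoid_mult} chain)"
proof (rule linear_eqI[of pm_scale "\<lambda>c. pm_extend first_face (pm_extend (delta p) c)" "\<lambda>c. pm_extend (delta p) (pm_extend first_face c)"])
  fix w assume "w \<in> keys c"
  then have "2 \<le> length w" using assms by (auto simp: of_length_def)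
  then obtain a b v where w: "w = a # b # v" by (metis Suc_le_length_iff numeral_2_eq_2)
  have ff: "pm_extend first_face (pcons a (pcons b c)) = (pcons (a + b) c :: 'a chain)" for c
    by (simp add: pm_extend_comp)
  have "even a \<or> (\<exists>a'. a = Suc a' \<and> even a')" by (cases a) auto
  moreover have "even b \<or> (\<exists>b'. b = Suc b' \<and> even b')" by (cases b) auto
  ultimately show "pm_extend first_face (pm_extend (delta p) (word w)) = (pm_extend (delta p) (pm_extend first_face (word w)) :: 'a chain)"
    by (auto simp: w ff) (auto simp: signed_def)
qed (intro pm_linearI)+

lemma hoch_b_delta: "pm_extend (hochb p) (delta p w) = (pm_extend (delta p) (hochb p w) :: 'a::{comm_ring,comm_monoid_mult} chain)"
proof (cases "2 \<le> length w")
  case True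
  have w: "of_length (length w) (word w :: 'a chain)" by simp
  have face: "face p (length w) j (pm_extend (delta p) c) = (pm_extend (delta p) (face p (length w) j c) :: 'a chain)"
    if "of_length (length w) c" for c j
  proof -
    obtain n where n: "length w = Suc n" "1 \<le> n" using True by (cases "length w") auto
    have len: "of_length (length w) ((rot p ^^ k) c)" for k
      using that n by (intro of_length_T_power) auto
    have ff: "of_length n (pm_extend first_face ((rot p ^^ k) c))" for k
      using len[of k] n by (intro of_length_first_face) auto
    show ?thesis
      using n by (simp add: face_def T_power_delta[OF that] first_face_delta[OF len True] T_power_delta[OF ff])
  qed
  have "pm_extend (hochb p) (delta p w) = (\<Sum>j<length w. face p (length w) j (pm_extend (delta p) (word w :: 'a chain)))"
    using extend_hoch_b_faces[OF of_length_delta[OF w] True] by simp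
  then show ?thesis
    unfolding hoch_b_eq_faces[OF True] by (simp add: face w del: pm_extend_single)
next
  case False
  then have "length w \<le> 1" by simp
  moreover have "length u = length w" if "u \<in> keys (delta p w :: 'a chain)" for u
    using that keys_delta[of w, where 'a = 'a] by auto
  ultimately show ?thesis by (simp add: hoch_b_short pm_extend_eq_zero)
qed

lemma delta_delta: "pm_extend (delta p) (delta p w) = (0 :: 'a::{comm_ring,comm_monoid_mult} chain)"
proof (induction w)
  case (Cons a w)
  have d: "pm_extend (delta p) (pcons a c) =
      (if odd a then pm_scale (nat_mult p 1) (pcons (a - 1) c) else 0) + signed a (pcons a (pm_extend (delta p) c))"
    for a and c :: "'a chain"
  proof (rule linear_eqI[of pm_scale "\<lambda>c. pm_extend (delta p) (pcons a c)" "\<lambda>c. (if odd a then pm_scale (nat_mult p 1) (pcons (a - 1) c) else 0) + signed a (pcons a (pm_extend (delta p) c))"])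
    show "pm_linear (\<lambda>c. (if odd a then pm_scale (nat_mult p 1) (pcons (a - 1) c) else 0) + signed a (pcons a (pm_extend (delta p) c)) :: 'a chain)"
      by (cases "odd a") (simp_all, (intro pm_linearI)+)
  qed (intro pm_linearI | simp)+
  have "even a \<or> (\<exists>a'. a = Suc a' \<and> even a')" by (cases a) auto
  then show ?case using Cons by (auto simp: d signed_def)
qed simp

lemma norm_sum_delta: "of_length L c \<Longrightarrow> norm_sum p L (pm_extend (delta p) c) = (pm_extend (delta p) (norm_sum p L c) :: 'a::{comm_ring,comm_monoid_mult} chain)"
  by (cases "L = 0") (simp_all add: norm_sum_def T_power_delta)

lemma connes_B_delta: "total_B p (delta p w) = (pm_extend (delta p) (connes_B (ring_dquot p) w) :: 'a::{comm_ring,comm_monoid_mult} chain)"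
proof -
  have w: "of_length (length w) (word w :: 'a chain)" by simp
  have d0: "pm_extend (delta p) (pcons 0 c) = (pcons 0 (pm_extend (delta p) c) :: 'a chain)" for c
    by (simp add: pm_extend_comp)
  let ?x = "norm_sum p (length w) (word w) :: 'a chain"
  have x: "of_length (Suc (length w)) (pcons 0 ?x)"
    by (intro of_length_pcons of_length_norm_sum w)
  have "total_B p (delta p w) = total_B p (pm_extend (delta p) (word w) :: 'a chain)"
    by simp
  also have "\<dots> = pm_extend (delta p) (pcons 0 ?x) - rot p (pm_extend (delta p) (pcons 0 ?x))"
    unfolding extend_connes_B[OF of_length_delta[OF w]] norm_sum_delta[OF w] d0 ..
  also have "\<dots> = pm_extend (delta p) (total_B p (word w))"
    unfolding extend_connes_B[OF w] T_delta_chain[OF x zero_less_Suc] by simp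
  finally show ?thesis by simp
qed

subsection \<open>The total differential\<close>

lemma extend_hoch_d:
  assumes "of_length L c"
  shows "total_d p c = (pm_extend (hochb p) c + signed (L - 1) (pm_extend (delta p) c) :: 'a::{comm_ring,comm_monoid_mult} chain)"
proof (rule linear_eqI[of pm_scale "total_d p" "\<lambda>c. pm_extend (hochb p) c + signed (L - 1) (pm_extend (delta p) c)"])
  fix w assume "w \<in> keys c"
  then have "length w = L" using assms(1) by (auto simp: of_length_def)
  then show "total_d p (word w) = (pm_extend (hochb p) (word w) + signed (L - 1) (pm_extend (delta p) (word w)) :: 'a chain)"
    by (simp add: hoch_d_def)
qed (intro pm_linearI)+

lemma hoch_b_squared: "pm_extend (hochb p) (hochb p w) = (0 :: 'a::{comm_ring,comm_monoid_mult} chain)"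
  using hoch_b_hoch_b[of w] by (simp add: hoch_b_eq[abs_def])

text \<open>  The operators \<open>b\<close> and \<open>delta\<close> commute; the sign in \<open>hoch_d\<close> depends on the length of the
  word, which \<open>b\<close> lowers by one, so the mixed terms cancel.\<close>

lemma hoch_d_word_squared: "total_d p (hoch_d (ring_dquot p) w) = (0 :: 'a::{comm_ring,comm_monoid_mult} chain)"
proof -
  have w: "of_length (length w) (word w :: 'a chain)" by simp
  have dw: "total_d p (delta p w) = (pm_extend (delta p) (hochb p w) :: 'a chain)"
    using extend_hoch_d[OF of_length_delta[OF w]] by (simp add: hoch_b_delta delta_delta)
  show ?thesis
  proof (cases "2 \<le> length w")
    case True
    then obtain n where n: "length w = Suc (Suc n)" by (metis Suc_le_D numeral_2_eq_2 Suc_le_mono le_zero_eq)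
    then have "of_length (Suc n) (hochb p w :: 'a chain)"
      using of_length_hoch_b[of "Suc n" "word w :: 'a chain" p] by simp
    then have "total_d p (hochb p w) = (signed n (pm_extend (delta p) (hochb p w)) :: 'a chain)"
      by (simp add: extend_hoch_d hoch_b_squared)
    then show ?thesis by (simp add: hoch_d_def n dw)
  next
    case False
    then have "hochb p w = (0 :: 'a chain)" by (intro hoch_b_short) simp
    then show ?thesis by (simp add: hoch_d_def dw)
  qed
qed

lemma hoch_d_connes_B_word:
  "total_d p (connes_B (ring_dquot p) w) + total_B p (hoch_d (ring_dquot p) w) = (0 :: 'a::{comm_ring,comm_monoid_mult} chain)"
proof (cases "w = []")
  case False
  then obtain n where n: "length w = Suc n" by (cases w) auto
  have "of_length (Suc (length w)) (connes_B (ring_dquot p) w :: 'a chain)"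
    using of_length_connes_B[of "length w" "word w :: 'a chain" p] by simp
  then show ?thesis
    using hoch_b_connes_B[of p w, where 'a = 'a]
    by (simp add: extend_hoch_d hoch_d_def connes_B_delta n algebra_simps)
qed (simp add: hoch_d_def hoch_b_def connes_B_def Let_def cyc_N_def)

lemma hoch_d_squared: "total_d p (total_d p c) = (0 :: 'a::{comm_ring,comm_monoid_mult} chain)"
  by (simp add: pm_extend_comp hoch_d_word_squared pm_extend_eq_zero)

lemma connes_B_squared: "total_B p (total_B p c) = (0 :: 'a::{comm_ring,comm_monoid_mult} chain)"
  using connes_B_connes_B[of p, where 'a = 'a] by (simp add: pm_extend_comp[of _ _ c] pm_extend_eq_zero)

lemma connes_B_hoch_d: "total_B p (total_d p c) =
    (- total_d p (total_B p c) :: 'a::{comm_ring,comm_monoid_mult} chain)"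
proof (rule linear_eqI[of pm_scale "\<lambda>c. total_B p (total_d p c)" "\<lambda>c. - total_d p (total_B p c)"])
  fix w
  show "total_B p (total_d p (word w)) =
    (- total_d p (total_B p (word w)) :: 'a chain)"
    using hoch_d_connes_B_word[of w, where 'a = 'a] by (simp add: eq_neg_iff_add_eq_0 add.commute)
qed (intro pm_linearI)+

end

section \<open>A homotopy on the Hochschild complex\<close>

text \<open>  The sum over \<open>j\<close> is the universal derivation of \<open>x\<^sup>y\<close>, with its three factors placed in
  consecutive slots; it contracts the bar resolution of a tensor algebra onto the one of length
  one, up to words with a unit in the second slot. The first summand contracts these words.\<close>

fun htpy :: "nat list \<Rightarrow> 'a::{comm_ring,comm_monoid_mult} chain" where
  "htpy (x # y # v) = word ((x + y) # 0 # 0 # v) - (\<Sum>j<y. word ((x + j) # 1 # (y - 1 - j) # v))"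
| "htpy _ = 0"

lemma sum_lessThan_add:
  fixes f :: "nat \<Rightarrow> 'b::comm_monoid_add"
  shows "(\<Sum>j<y + z. f j) = (\<Sum>j<y. f j) + (\<Sum>j<z. f (y + j))"
  by (induction z) (simp_all add: ac_simps)

text \<open>  The first two faces of the words in \<open>htpy\<close> telescope.\<close>

lemma split_word_sum:
  "(\<Sum>j<y. word ((x + Suc j) # (y - 1 - j) # v)) - (\<Sum>j<y. word ((x + j) # Suc (y - 1 - j) # v)) =
     (word ((x + y) # 0 # v) - word (x # y # v) :: 'a::{comm_ring,comm_monoid_mult} chain)"
proof -
  have "(\<Sum>j<y. word ((x + Suc j) # (y - 1 - j) # v)) - (\<Sum>j<y. word ((x + j) # Suc (y - 1 - j) # v)) =
     (\<Sum>j<y. word ((x + Suc j) # (y - Suc j) # v) - (word ((x + j) # (y - j) # v) :: 'a chain))"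
    unfolding sum_subtractf[symmetric] by (intro sum.cong refl) (auto simp: Suc_diff_Suc)
  also have "\<dots> = word ((x + y) # 0 # v) - word (x # y # v)"
    using sum_lessThan_telescope[of "\<lambda>j. word ((x + j) # (y - j) # v) :: 'a chain" y] by simp
  finally show ?thesis .
qed

text \<open>  The third face of each summand of \<open>htpy\<close> is compensated by the first terms of the homotopy
  applied to \<open>x # (y + z) # u\<close>; the remaining terms of that sum cancel against the homotopy of
  \<open>(x + y) # z # u\<close>, and all later faces commute with \<open>htpy\<close> up to sign.\<close>

lemma bar_htpy:
  "pm_extend bar (htpy (x # y # z # u)) + pm_extend htpy (bar (x # y # z # u)) =
     (word (x # y # z # u) :: 'a::{comm_ring,comm_monoid_mult} chain)"
proof -
  define c where "c = (bar (z # u) :: 'a chain)"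
  have 1: "pm_extend bar (htpy (x # y # z # u)) =
      word ((x + y) # 0 # z # u) - pcons (x + y) (pcons 0 (pcons 0 c))
      - ((\<Sum>j<y. word ((x + Suc j) # (y - 1 - j) # z # u)) - (\<Sum>j<y. word ((x + j) # Suc (y - 1 - j) # z # u)))
      - (\<Sum>j<y. word ((x + j) # 1 # (y - 1 - j + z) # u))
      + (\<Sum>j<y. pcons (x + j) (pcons 1 (pcons (y - 1 - j) c)))"
    by (simp add: c_def sum_subtractf sum.distrib)
  have 2: "pm_extend htpy (pcons x (pcons y c)) =
      pcons (x + y) (pcons 0 (pcons 0 c)) - (\<Sum>j<y. pcons (x + j) (pcons 1 (pcons (y - 1 - j) c)))"
    by (rule linear_eqI[of pm_scale "\<lambda>c. pm_extend htpy (pcons x (pcons y c))"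
          "\<lambda>c. pcons (x + y) (pcons 0 (pcons 0 c)) - (\<Sum>j<y. pcons (x + j) (pcons 1 (pcons (y - 1 - j) c)))"])
      (intro pm_linearI pm_linear_sum | simp)+
  have "(\<Sum>j<y + z. word ((x + j) # 1 # (y + z - 1 - j) # u)) =
      (\<Sum>j<y. word ((x + j) # 1 # (y - 1 - j + z) # u)) + (\<Sum>j<z. word ((x + y + j) # 1 # (z - 1 - j) # u) :: 'a chain)"
    unfolding sum_lessThan_add by (intro arg_cong2[where f = "(+)"] sum.cong refl) (auto simp: add.assoc)
  then have 3: "pm_extend htpy (bar (x # y # z # u)) =
      (\<Sum>j<y. word ((x + j) # 1 # (y - 1 - j + z) # u)) + pm_extend htpy (pcons x (pcons y c))"
    by (simp add: c_def add.assoc)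
  show ?thesis unfolding 1 3 2 split_word_sum by simp
qed

text \<open>  For words of length at least three the last face leaves the second slot alone and adds the
  last letter to the first one, and the homotopy commutes with that.\<close>

lemma last_face_htpy:
  "pm_extend last_face (htpy (x # y # v @ [z])) + pm_extend htpy (last_face (x # y # v @ [z])) =
     (0 :: 'a::{comm_ring,comm_monoid_mult} chain)"
proof -
  let ?s = "length v + z * (x + (y + sum_list v))"
  have "last_face (x # y # v @ [z]) = (signed ?s (word ((z + x) # y # v)) :: 'a chain)"
    using last_face_snoc[of x "y # v" z] by simp
  moreover have "last_face ((x + y) # 0 # 0 # v @ [z]) = (- signed ?s (word ((z + (x + y)) # 0 # 0 # v)) :: 'a chain)"
    using last_face_snoc[of "x + y" "0 # 0 # v" z] by (simp add: add.assoc)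
  moreover have "last_face ((x + j) # 1 # (y - 1 - j) # v @ [z]) = (- signed ?s (word ((z + (x + j)) # 1 # (y - 1 - j) # v)) :: 'a chain)"
    if "j < y" for j
  proof -
    have "x + j + Suc (y - 1 - j + sum_list v) = x + (y + sum_list v)" using that by simp
    then show ?thesis
      using last_face_snoc[of "x + j" "1 # (y - 1 - j) # v" z, where 'a = 'a] by simp
  qed
  ultimately show ?thesis
    by (simp add: sum_negf signed_sum add.assoc)
qed

text \<open>  On a word of length two the last letter is the one that is split, so that the last face does
  not cancel: it collects copies of \<open>[x + y - 1, 1]\<close>, the class of \<open>x\<^sup>x\<^sup>+\<^sup>y\<^sup>-\<^sup>1 dx\<close>.\<close>

lemma hoch_b_htpy_pair:
  "pm_extend (\<lambda>w. bar w + last_face w) (htpy [x, y]) =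
    (word [x, y] - pm_scale (\<Sum>j<y. signed ((y - 1 - j) * (x + Suc j)) 1) (word [x + y - 1, 1]) :: 'a::{comm_ring,comm_monoid_mult} chain)"
proof -
  have 1: "last_face [x + y, 0, 0] = (word [x + y, 0] :: 'a chain)"
    using last_face_snoc[of "x + y" "[0]" 0] by simp
  have 2: "last_face [x + j, 1, y - 1 - j] = (signed ((y - 1 - j) * (x + Suc j)) (word [x + y - 1, 1]) :: 'a chain)"
    if "j < y" for j
  proof -
    have "y - 1 - j + (x + j) = x + y - 1" using that by simp
    then show ?thesis using last_face_snoc[of "x + j" "[1]" "y - 1 - j", where 'a = 'a] by simp
  qed
  have "pm_extend (\<lambda>w. bar w + last_face w) (htpy [x, y]) = word [x + y, 0]
      - ((\<Sum>j<y. word ((x + Suc j) # (y - 1 - j) # [])) - (\<Sum>j<y. word ((x + j) # Suc (y - 1 - j) # [])))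
      - (\<Sum>j<y. signed ((y - 1 - j) * (x + Suc j)) (word [x + y - 1, 1]) :: 'a chain)"
    using 1 2 by (simp add: sum_subtractf sum.distrib)
  also have "\<dots> = word [x, y] - pm_scale (\<Sum>j<y. signed ((y - 1 - j) * (x + Suc j)) 1) (word [x + y - 1, 1])"
    unfolding split_word_sum by (simp add: pm_scale_left_sum single_signed del: pm_scale_single)
      (simp add: single_signed)
  finally show ?thesis .
qed

text \<open>  The homotopy is compatible with \<open>delta\<close> except for the letter \<open>1\<close> that it creates: there
  \<open>delta x = p\<close> produces words with a unit in the second slot.\<close>

lemma delta_htpy:
  fixes p :: nat
  defines "P \<equiv> nat_mult p (1 :: 'a::{comm_ring,comm_monoid_mult})"
  shows "pm_extend (delta p) (htpy (x # y # v)) =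
    pm_extend htpy (delta p (x # y # v))
    - (\<Sum>j<y. signed (x + j) (single ((x + j) # 0 # (y - 1 - j) # v) P))"
proof -
  let ?D = "delta p :: nat list \<Rightarrow> 'a chain"
  define c where "c = ?D v"
  define t where "t j k = single (j # 1 # k # v) P" for j k
  have htpy_pcons: "pm_extend htpy (pcons x (pcons y c)) =
      pcons (x + y) (pcons 0 (pcons 0 c)) - (\<Sum>j<y. pcons (x + j) (pcons 1 (pcons (y - 1 - j) c)))"
    by (rule linear_eqI[of pm_scale "\<lambda>c. pm_extend htpy (pcons x (pcons y c))"
          "\<lambda>c. pcons (x + y) (pcons 0 (pcons 0 c)) - (\<Sum>j<y. pcons (x + j) (pcons 1 (pcons (y - 1 - j) c)))"])
      (intro pm_linearI pm_linear_sum | simp)+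
  have sgn: "signed (x + j + Suc (y - 1 - j)) d = signed (x + y) d" if "j < y" for j and d :: "'a chain"
    using that by simp
  have D0: "?D ((x + y) # 0 # 0 # v) = (if odd (x + y) then single ((x + y - 1) # 0 # 0 # v) P else 0)
      + signed (x + y) (pcons (x + y) (pcons 0 (pcons 0 c)))"
    by (simp add: c_def P_def)
  have Dj: "?D ((x + j) # 1 # (y - 1 - j) # v) =
      (if odd (x + j) then t (x + j - 1) (y - 1 - j) else 0)
      + signed (x + j) (single ((x + j) # 0 # (y - 1 - j) # v) P)
      - signed (x + j) (if odd (y - 1 - j) then t (x + j) (y - 2 - j) else 0)
      + signed (x + y) (pcons (x + j) (pcons 1 (pcons (y - 1 - j) c)))" if "j < y" for j
    using sgn[OF that] by (simp add: c_def P_def t_def numeral_2_eq_2)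
  have Dw: "?D (x # y # v) = (if odd x then single ((x - 1) # y # v) P else 0)
     + signed x (if odd y then single (x # (y - 1) # v) P else 0)
     + signed (x + y) (pcons x (pcons y c))"
    by (simp add: c_def P_def)
  \<comment> \<open>the derivation of \<open>x\<^sup>y\<close> commutes with \<open>delta\<close>: both sides are compared letter by letter, by parity\<close>
  have key: "(\<Sum>j<y. (if odd (x + j) then t (x + j - 1) (y - 1 - j) else 0)
      - signed (x + j) (if odd (y - 1 - j) then t (x + j) (y - 2 - j) else 0)) =
    (if odd x then \<Sum>j<y. t (x - 1 + j) (y - 1 - j) else 0)
     + signed x (if odd y then \<Sum>j<y - 1. t (x + j) (y - 2 - j) else 0)"
  proof (cases y)
    case (Suc m)
    have e: "Suc m - 2 - j = m - 1 - j" for j by simp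
    have e': "m - 1 - j = m - Suc j" "x + Suc j - 1 = x + j" for j by simp_all
    have "(\<Sum>j<y. (if odd (x + j) then t (x + j - 1) (y - 1 - j) else 0)
      - signed (x + j) (if odd (y - 1 - j) then t (x + j) (y - 2 - j) else 0)) =
      (\<Sum>j<Suc m. (if odd (x + j) then t (x + j - 1) (m - j) else 0))
      - (\<Sum>j<Suc m. signed (x + j) (if odd (m - j) then t (x + j) (m - 1 - j) else 0))"
      using e by (simp only: Suc sum_subtractf diff_Suc_1)
    also have "\<dots> = (if odd x then t (x - 1) m else 0) +
        (\<Sum>j<m. (if odd (x + Suc j) then t (x + j) (m - Suc j) else 0))
      - (\<Sum>j<m. signed (x + j) (if odd (m - j) then t (x + j) (m - Suc j) else 0))"
      using e' by (subst sum.lessThan_Suc_shift) (simp cong: if_cong)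
    also have "\<dots> = (if odd x then t (x - 1) m else 0) +
        (\<Sum>j<m. (if odd (x + Suc j) then t (x + j) (m - Suc j) else 0)
          - signed (x + j) (if odd (m - j) then t (x + j) (m - Suc j) else 0))"
      by (simp add: sum_subtractf)
    also have "(\<Sum>j<m. (if odd (x + Suc j) then t (x + j) (m - Suc j) else 0)
          - signed (x + j) (if odd (m - j) then t (x + j) (m - Suc j) else 0)) =
       (\<Sum>j<m. (if odd x then t (x + j) (m - Suc j) else 0) + signed x (if odd y then t (x + j) (m - Suc j) else 0))"
      by (intro sum.cong refl) (auto simp: signed_def Suc)
    also have "(if odd x then t (x - 1) m else 0) + \<dots> =
       (if odd x then t (x - 1) m + (\<Sum>j<m. t (x + j) (m - Suc j)) else 0)
        + signed x (if odd y then \<Sum>j<m. t (x + j) (m - Suc j) else 0)"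
      by (simp add: sum.distrib signed_sum)
    also have "(if odd x then t (x - 1) m + (\<Sum>j<m. t (x + j) (m - Suc j)) else 0) =
        (if odd x then \<Sum>j<y. t (x - 1 + j) (y - 1 - j) else 0)"
      unfolding Suc by (subst sum.lessThan_Suc_shift) (auto elim: oddE)
    finally show ?thesis by (simp add: Suc)
  qed simp
  have "pm_extend ?D (htpy (x # y # v)) = ?D ((x + y) # 0 # 0 # v) - (\<Sum>j<y. ?D ((x + j) # 1 # (y - 1 - j) # v))"
    by simp
  also have "(\<Sum>j<y. ?D ((x + j) # 1 # (y - 1 - j) # v)) =
     (\<Sum>j<y. ((if odd (x + j) then t (x + j - 1) (y - 1 - j) else 0)
      - signed (x + j) (if odd (y - 1 - j) then t (x + j) (y - 2 - j) else 0))
      + signed (x + j) (single ((x + j) # 0 # (y - 1 - j) # v) P)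
      + signed (x + y) (pcons (x + j) (pcons 1 (pcons (y - 1 - j) c))))"
    by (intro sum.cong refl, subst Dj) (auto simp: algebra_simps)
  also have "\<dots> = (if odd x then \<Sum>j<y. t (x - 1 + j) (y - 1 - j) else 0)
     + signed x (if odd y then \<Sum>j<y - 1. t (x + j) (y - 2 - j) else 0)
     + (\<Sum>j<y. signed (x + j) (single ((x + j) # 0 # (y - 1 - j) # v) P))
     + signed (x + y) (\<Sum>j<y. pcons (x + j) (pcons 1 (pcons (y - 1 - j) c)))"
    by (simp only: sum.distrib key signed_sum)
  finally have L: "pm_extend ?D (htpy (x # y # v)) = ?D ((x + y) # 0 # 0 # v) - \<dots>" .
  have H1: "pm_extend htpy (single ((x - 1) # y # v) P) =
      single ((x - 1 + y) # 0 # 0 # v) P - (\<Sum>j<y. t (x - 1 + j) (y - 1 - j))"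
    by (simp add: t_def pm_scale_diff pm_scale_sum)
  have H2: "pm_extend htpy (single (x # (y - 1) # v) P) =
      single ((x + (y - 1)) # 0 # 0 # v) P - (\<Sum>j<y - 1. t (x + j) (y - 2 - j))"
    by (simp add: t_def pm_scale_diff pm_scale_sum numeral_2_eq_2)
  have R: "pm_extend htpy (?D (x # y # v)) = (if odd x then single ((x - 1 + y) # 0 # 0 # v) P - (\<Sum>j<y. t (x - 1 + j) (y - 1 - j)) else 0)
     + signed x (if odd y then single ((x + (y - 1)) # 0 # 0 # v) P - (\<Sum>j<y - 1. t (x + j) (y - 2 - j)) else 0)
     + signed (x + y) (pcons (x + y) (pcons 0 (pcons 0 c)) - (\<Sum>j<y. pcons (x + j) (pcons 1 (pcons (y - 1 - j) c))))"
    unfolding Dw by (simp only: pm_extend_add pm_extend_signed htpy_pcons H1 H2 pm_extend_zero if_distrib[of "pm_extend htpy"])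
  have "(if odd (x + y) then single ((x + y - 1) # 0 # 0 # v) P else 0) =
     (if odd x then single ((x - 1 + y) # 0 # 0 # v) P else 0)
      + signed x (if odd y then single ((x + (y - 1)) # 0 # 0 # v) P else 0)"
    by (auto simp: signed_def elim!: oddE)
  then show ?thesis unfolding L R D0 by (simp add: algebra_simps)
qed

section \<open>Linear functionals on chains\<close>

lemma nat_mult_simps [simp]: "nat_mult 0 r = 0" "nat_mult (Suc n) r = r + nat_mult n r"
  by (simp_all add: nat_mult_def add.commute)

lemma nat_mult_add: "nat_mult (m + n) r = nat_mult m r + nat_mult n r"
  by (induction m) (simp_all add: add.assoc)

lemma nat_mult_eq: "nat_mult n r = nat_mult n 1 * (r :: 'a::{comm_ring,comm_monoid_mult})"
  by (induction n) (simp_all add: algebra_simps)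

text \<open>  Encoding a functional as a map to chains on a one-element set makes the rules for
  \<open>pm_extend\<close> available for it.\<close>

definition pm_functional :: "('w \<Rightarrow> 'a) \<Rightarrow> ('w \<Rightarrow>\<^sub>0 'a::{comm_ring,comm_monoid_mult}) \<Rightarrow> 'a" where
  "pm_functional f c = lookup (pm_extend (\<lambda>w. single () (f w)) c) ()"

lemma linear_pm_functional: "linear_on_pm (*) (pm_functional f)"
  by (simp add: linear_on_pm_def pm_functional_def lookup_add)

lemma pm_functional_single [simp]: "pm_functional f (single w r) = r * f w"
  by (simp add: pm_functional_def)

lemmas pm_functional_simps [simp] = linear_on_pm_simps[OF linear_pm_functional]

lemma pm_functional_eq_zero:
  "(\<And>w. w \<in> keys c \<Longrightarrow> f w = 0) \<Longrightarrow> pm_functional f c = 0"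
  unfolding pm_functional_def by (subst pm_extend_eq_zero) auto

section \<open>Degrees\<close>

definition degree_words :: "int \<Rightarrow> nat list set" where
  "degree_words m = {w. w \<noteq> [] \<and> int (length w - 1 + sum_list w) = m}"

context
  fixes p :: nat
begin

lemma hoch_chains_iff: "c \<in> hchains p m \<longleftrightarrow> keys c \<subseteq> degree_words m"
  by (auto simp: hoch_chains_def degree_words_def)

lemma hoch_chains_closed:
  "0 \<in> hchains p m"
  "c \<in> hchains p m \<Longrightarrow> d \<in> hchains p m \<Longrightarrow> c + d \<in> hchains p m"
  "c \<in> hchains p m \<Longrightarrow> d \<in> hchains p m \<Longrightarrow> c - d \<in> hchains p m"
  "c \<in> hchains p m \<Longrightarrow> - c \<in> hchains p m"
  "c \<in> hchains p m \<Longrightarrow> signed n c \<in> hchains p m"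
  "c \<in> hchains p m \<Longrightarrow> pm_scale r c \<in> hchains p m"
  "w \<in> degree_words m \<Longrightarrow> single w r \<in> hchains p m"
  unfolding hoch_chains_iff
proof -
  show "keys c \<subseteq> degree_words m \<Longrightarrow> keys (pm_scale r c) \<subseteq> degree_words m"
    by (rule order_trans[of _ "keys c"]) (auto simp: in_keys_iff)
qed (simp_all add: keys_add_subset keys_diff_subset)

lemma hoch_chains_extend:
  "c \<in> hchains p m \<Longrightarrow>
   (\<And>w. w \<in> degree_words m \<Longrightarrow> (g w :: 'a::{comm_ring,comm_monoid_mult} chain) \<in> hchains p n) \<Longrightarrow>
     pm_extend g c \<in> hchains p n"
  unfolding hoch_chains_iff by (rule keys_extend_subset) blast

lemma hoch_chains_negative: "c \<in> hchains p m \<Longrightarrow> m < 0 \<Longrightarrow> c = 0"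
  unfolding hoch_chains_iff degree_words_def by (rule poly_mapping_eqI) (force simp: in_keys_iff)

lemma hoch_d_degree: "c \<in> hchains p m \<Longrightarrow>
    (total_d p c :: 'a::{comm_ring,comm_monoid_mult} chain) \<in> hchains p (m - 1)"
proof (erule hoch_chains_extend)
  fix w assume w: "w \<in> degree_words m"
  have "(bar w :: 'a chain) \<in> hchains p (m - 1)"
    unfolding hoch_chains_iff
  proof
    fix u assume u: "u \<in> keys (bar w :: 'a chain)"
    then have 1: "Suc (length u) = length w" "sum_list u = sum_list w" using keys_bar[of w] by auto
    have "u \<noteq> []"
    proof
      assume "u = []"
      then obtain a where "w = [a]" using 1 by (metis length_0_conv length_Suc_conv list.size(3))
      then show False using u by simp
    qed
    then have "length u \<ge> 1" by (cases u) auto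
    then show "u \<in> degree_words (m - 1)" using w 1 \<open>u \<noteq> []\<close> by (auto simp: degree_words_def)
  qed
  moreover have "(last_face w :: 'a chain) \<in> hchains p (m - 1)"
  proof (cases "length w \<le> 1")
    case False
    then obtain a v z where "w = a # v @ [z]"
      by (cases w; cases "tl w" rule: rev_cases) auto
    then show ?thesis using w
      by (auto simp: last_face_snoc degree_words_def intro!: hoch_chains_closed)
  qed (auto simp: last_face_def intro: hoch_chains_closed)
  moreover have "(delta p w :: 'a chain) \<in> hchains p (m - 1)"
    using w keys_delta[of p w, where 'a = 'a] unfolding hoch_chains_iff degree_words_def by fastforce
  ultimately show "(hoch_d (ring_dquot p) w :: 'a chain) \<in> hchains p (m - 1)"
    unfolding hoch_d_def hoch_b_eq by (intro hoch_chains_closed)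
qed

lemma connes_B_degree: "c \<in> hchains p m \<Longrightarrow>
    (total_B p c :: 'a::{comm_ring,comm_monoid_mult} chain) \<in> hchains p (m + 1)"
proof (erule hoch_chains_extend)
  fix w assume w: "w \<in> degree_words m"
  have T: "rot p c \<in> hchains p n"
    if "c \<in> hchains p n" for n and c :: "'a chain"
    using that
  proof (rule hoch_chains_extend)
    fix w assume w: "w \<in> degree_words n"
    then obtain v x where "w = v @ [x]" unfolding degree_words_def by (cases w rule: rev_cases) auto
    then show "(cyc_t (ring_dquot p) w :: 'a chain) \<in> hchains p n"
      using w by (auto simp: cyc_t_snoc degree_words_def intro!: hoch_chains_closed)
  qed
  have Tk: "(rot p ^^ k) (word w :: 'a chain) \<in> hchains p m" for k
    using w by (induction k) (auto intro: hoch_chains_closed T)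
  have "(\<Sum>i<k. (rot p ^^ i) (word w :: 'a chain)) \<in> hchains p m" for k
    by (induction k) (auto intro: hoch_chains_closed Tk)
  then have "pcons 0 (cyc_N (ring_dquot p) w :: 'a chain) \<in> hchains p (m + 1)"
    unfolding cyc_N_def
    by (rule hoch_chains_extend) (auto intro!: hoch_chains_closed(7) simp: degree_words_def neq_Nil_conv)
  then show "(connes_B (ring_dquot p) w :: 'a chain) \<in> hchains p (m + 1)"
    unfolding connes_B_def Let_def cyc_s_eq[abs_def] by (intro hoch_chains_closed T)
qed

lemma htpy_degree: "c \<in> hchains p m \<Longrightarrow>
    (pm_extend htpy c :: 'a::{comm_ring,comm_monoid_mult} chain) \<in> hchains p (m + 1)"
proof (erule hoch_chains_extend)
  fix w assume w: "w \<in> degree_words m"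
  show "(htpy w :: 'a chain) \<in> hchains p (m + 1)"
  proof (cases w rule: htpy.cases)
    case (1 x y v)
    have "(\<Sum>j<k. word ((x + j) # 1 # (y - 1 - j) # v) :: 'a chain) \<in> hchains p (m + 1)" if "k \<le> y" for k
      using that
    proof (induction k)
      case (Suc k)
      then have "(x + k) # 1 # (y - 1 - k) # v \<in> degree_words (m + 1)"
        using w by (auto simp: degree_words_def 1)
      then show ?case using Suc by (auto intro: hoch_chains_closed)
    qed (auto intro: hoch_chains_closed)
    moreover have "(x + y) # 0 # 0 # v \<in> degree_words (m + 1)"
      using w by (auto simp: degree_words_def 1)
    ultimately show ?thesis unfolding 1 htpy.simps by (auto intro!: hoch_chains_closed)
  qed (auto intro: hoch_chains_closed)
qed

section \<open>Reduction to normal form\<close>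

text \<open>  The operator \<open>1 - (d h + h d)\<close> for \<open>h = htpy\<close>. On cycles it does not change the homology class,
  and applied twice it lands in the span of the words \<open>[m]\<close> and of the chains \<open>cyc_gen\<close>.\<close>

definition reduce :: "'a::{comm_ring,comm_monoid_mult} chain \<Rightarrow> 'a chain" where
  "reduce c = c - total_d p (pm_extend htpy c) - pm_extend htpy (total_d p c)"

lemma pm_linear_reduce: "pm_linear reduce"
  unfolding reduce_def by (intro pm_linearI)

lemmas reduce_simps = linear_on_pm_simps[OF pm_linear_reduce]

lemma reduce_degree: "c \<in> hchains p m \<Longrightarrow> reduce c \<in> hchains p m"
  unfolding reduce_def
  using hoch_d_degree[OF htpy_degree, of c m] htpy_degree[OF hoch_d_degree, of c m]
  by (auto intro!: hoch_chains_closed)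

text \<open>  The class of \<open>x\<^sup>a dx\<close>. The degenerate word repairs the failure of \<open>[a, 1]\<close> to be a cycle on
  unnormalized chains for even \<open>a\<close>.\<close>

definition cyc_gen :: "nat \<Rightarrow> 'a::{comm_ring,comm_monoid_mult} chain" where
  "cyc_gen a = word [a, 1] + signed a (single [a, 0, 0] (nat_mult p 1))"

lemma of_length_htpy: "of_length (Suc (length w)) (htpy w)"
  by (cases w rule: htpy.cases) (auto intro!: of_length_closed)

lemma reduce_pair:
  "reduce (word (x # y # v)) =
     (word (x # y # v) - (pm_extend (\<lambda>w. bar w + last_face w) (htpy (x # y # v))
        + pm_extend htpy (bar (x # y # v) + last_face (x # y # v))))
     + signed (length v) (\<Sum>j<y. signed (x + j) (single ((x + j) # 0 # (y - 1 - j) # v)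
         (nat_mult p (1 :: 'a::{comm_ring,comm_monoid_mult}))))"
proof -
  let ?w = "x # y # v"
  let ?D = "delta p :: nat list \<Rightarrow> 'a chain"
  have b: "hochb p = (\<lambda>w. bar w + last_face w :: 'a chain)"
    by (rule ext) (rule hoch_b_eq)
  have "total_d p (htpy ?w :: 'a chain) =
      pm_extend (\<lambda>w. bar w + last_face w) (htpy ?w) + signed (length ?w) (pm_extend ?D (htpy ?w))"
    using extend_hoch_d[OF of_length_htpy[of ?w], of p, where 'a = 'a] unfolding b by simp
  moreover have "pm_extend htpy (hoch_d (ring_dquot p) ?w) =
     (pm_extend htpy (bar ?w + last_face ?w) - signed (length ?w) (pm_extend htpy (?D ?w)) :: 'a chain)"
    unfolding hoch_d_def b by simp
  ultimately show ?thesis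
    unfolding reduce_def pm_extend_single pm_scale_one delta_htpy by (simp add: algebra_simps)
qed

lemma extend_bar_last: "pm_extend (\<lambda>w. bar w + last_face w) c = (pm_extend bar c + pm_extend last_face c :: 'a::{comm_ring,comm_monoid_mult} chain)"
  by (rule linear_eqI[of pm_scale "pm_extend (\<lambda>w. bar w + last_face w)" "\<lambda>c. pm_extend bar c + pm_extend last_face c"])
    (intro pm_linearI | simp)+

text \<open>  As \<open>htpy\<close> is an exact contraction for \<open>b\<close> on these words, only its commutator with \<open>delta\<close>
  survives. The surviving words have a zero in the second slot, and there the sum over \<open>j\<close> is
  empty, so a second application gives zero.\<close>

lemma reduce_long:
  assumes "v \<noteq> []"
  shows "reduce (word (x # y # v)) = signed (length v) (\<Sum>j<y. signed (x + j) (single ((x + j) # 0 # (y - 1 - j) # v)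
         (nat_mult p (1 :: 'a::{comm_ring,comm_monoid_mult}))))"
proof -
  obtain v' z where "v = v' @ [z]" using assms by (cases v rule: rev_cases) auto
  then have 1: "pm_extend last_face (htpy (x # y # v)) + pm_extend htpy (last_face (x # y # v)) = (0 :: 'a chain)"
    using last_face_htpy by simp
  obtain z' u where "v = z' # u" using assms by (cases v) auto
  then have 2: "pm_extend bar (htpy (x # y # v)) + pm_extend htpy (bar (x # y # v)) = (word (x # y # v) :: 'a chain)"
    using bar_htpy by simp
  have "pm_extend (\<lambda>w. bar w + last_face w) (htpy (x # y # v)) + pm_extend htpy (bar (x # y # v) + last_face (x # y # v))
      = (word (x # y # v) :: 'a chain)"
  proof -
    have "pm_extend (\<lambda>w. bar w + last_face w) (htpy (x # y # v)) + pm_extend htpy (bar (x # y # v) + last_face (x # y # v)) =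
       (pm_extend bar (htpy (x # y # v)) + pm_extend htpy (bar (x # y # v)))
       + (pm_extend last_face (htpy (x # y # v)) + pm_extend htpy (last_face (x # y # v)) :: 'a chain)"
      unfolding extend_bar_last pm_extend_add by (simp only: ac_simps)
    then show ?thesis unfolding 1 2 by simp
  qed
  then show ?thesis unfolding reduce_pair by simp
qed

lemma reduce_degenerate: "v \<noteq> [] \<Longrightarrow> reduce (single (x # 0 # v) r) = (0 :: 'a::{comm_ring,comm_monoid_mult} chain)"
  using reduce_simps(5)[of r "word (x # 0 # v)"] by (simp add: reduce_long)

lemma reduce_reduce_long: "v \<noteq> [] \<Longrightarrow> reduce (reduce (word (x # y # v))) = (0 :: 'a::{comm_ring,comm_monoid_mult} chain)"
  by (simp add: reduce_long reduce_simps reduce_degenerate)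

lemma reduce_short: "reduce (word [x, y]) =
   pm_scale (\<Sum>j<y. signed ((y - 1 - j) * (x + Suc j)) 1) (word [x + y - 1, 1]) +
   (\<Sum>j<y. signed (x + j) (single [x + j, 0, y - 1 - j] (nat_mult p (1 :: 'a::{comm_ring,comm_monoid_mult}))))"
proof -
  have "pm_extend htpy (bar [x, y] + last_face [x, y]) = (0 :: 'a chain)"
    using last_face_snoc[of x "[]" y, where 'a = 'a] by simp
  then show ?thesis unfolding reduce_pair hoch_b_htpy_pair by simp
qed

lemma reduce_word_one: "reduce (word [a, 1]) = (cyc_gen a :: 'a::{comm_ring,comm_monoid_mult} chain)"
  unfolding reduce_short cyc_gen_def by simp

lemma reduce_reduce_short: "reduce (reduce (word [x, y])) =
   (pm_scale (\<Sum>j<y. signed ((y - 1 - j) * (x + Suc j)) 1) (cyc_gen (x + y - 1)) :: 'a::{comm_ring,comm_monoid_mult} chain)"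
  unfolding reduce_short[of x y] by (simp add: reduce_simps reduce_degenerate reduce_word_one[simplified] del: pm_scale_single)

lemma reduce_unit: "reduce (word [a]) = (word [a] :: 'a::{comm_ring,comm_monoid_mult} chain)"
  by (simp add: reduce_def hoch_d_def hoch_b_def)

lemma normal_form:
  assumes "c \<in> hchains p (int m)"
  shows "\<exists>\<alpha> \<beta>. reduce (reduce c) = single [m] \<alpha> + pm_scale \<beta> (cyc_gen (m - 2)) \<and>
     (m < 2 \<longrightarrow> \<beta> = (0 :: 'a::{comm_ring,comm_monoid_mult}))"
proof -
  define S :: "'a chain set" where "S = {c. \<exists>\<alpha> \<beta>. reduce (reduce c) = single [m] \<alpha> + pm_scale \<beta> (cyc_gen (m - 2)) \<and>
     (m < 2 \<longrightarrow> \<beta> = 0)}"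
  have zero: "0 \<in> S" unfolding S_def by (auto simp: reduce_simps intro!: exI[of _ 0])
  have add: "c + d \<in> S" if "c \<in> S" "d \<in> S" for c d
  proof -
    from that obtain \<alpha> \<beta> \<alpha>' \<beta>' where
      "reduce (reduce c) = single [m] \<alpha> + pm_scale \<beta> (cyc_gen (m - 2))" "m < 2 \<longrightarrow> \<beta> = 0"
      "reduce (reduce d) = single [m] \<alpha>' + pm_scale \<beta>' (cyc_gen (m - 2))" "m < 2 \<longrightarrow> \<beta>' = 0"
      unfolding S_def by blast
    then have "reduce (reduce (c + d)) = single [m] (\<alpha> + \<alpha>') + pm_scale (\<beta> + \<beta>') (cyc_gen (m - 2))
        \<and> (m < 2 \<longrightarrow> \<beta> + \<beta>' = 0)"
      by (simp add: reduce_simps single_add pm_scale_add_left algebra_simps)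
    then show ?thesis unfolding S_def by blast
  qed
  have scale: "pm_scale r c \<in> S" if "c \<in> S" for r c
  proof -
    from that obtain \<alpha> \<beta> where
      "reduce (reduce c) = single [m] \<alpha> + pm_scale \<beta> (cyc_gen (m - 2))" "m < 2 \<longrightarrow> \<beta> = 0"
      unfolding S_def by blast
    then have "reduce (reduce (pm_scale r c)) = single [m] (r * \<alpha>) + pm_scale (r * \<beta>) (cyc_gen (m - 2))
        \<and> (m < 2 \<longrightarrow> r * \<beta> = 0)"
      by (simp add: reduce_simps pm_scale_add)
    then show ?thesis unfolding S_def by blast
  qed
  have word: "word w \<in> S" if "w \<in> degree_words (int m)" for w
  proof (cases w rule: htpy.cases)
    case (1 x y v)
    show ?thesis
    proof (cases "v = []")
      case True
      have m: "m = x + y + 1" using that by (simp add: degree_words_def 1 True)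
      show ?thesis
      proof (cases "y = 0")
        case True
        then show ?thesis unfolding S_def 1 using \<open>v = []\<close> by (auto simp: reduce_reduce_short intro!: exI[of _ 0])
      next
        case False
        then have "x + y - 1 = m - 2" "\<not> m < 2" using m by auto
        then have "reduce (reduce (word w)) = single [m] 0 +
            (pm_scale (\<Sum>j<y. signed ((y - 1 - j) * (x + Suc j)) 1) (cyc_gen (m - 2)) :: 'a chain)"
          unfolding 1 \<open>v = []\<close> using reduce_reduce_short[of x y, where 'a = 'a] by simp
        with \<open>\<not> m < 2\<close> show ?thesis unfolding S_def by blast
      qed
    next
      case False
      then show ?thesis unfolding S_def 1 by (auto simp: reduce_reduce_long intro!: exI[of _ 0])
    qed
  next
    case ("2_2" a)
    have "m = a" using that by (simp add: degree_words_def "2_2")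
    then have "reduce (reduce (word w)) = single [m] 1 + (pm_scale 0 (cyc_gen (m - 2)) :: 'a chain)"
      by (simp add: reduce_unit "2_2")
    then show ?thesis unfolding S_def by blast
  qed (use that in \<open>simp add: degree_words_def\<close>)
  have "(\<Sum>w\<in>K. pm_scale (lookup c w) (word w)) \<in> S" if "finite K" "K \<subseteq> keys c" for K
    using that by (induction K) (use assms word in \<open>auto simp: hoch_chains_iff simp del: pm_scale_single intro!: zero add scale\<close>)
  then have "(\<Sum>w\<in>keys c. single w (lookup c w)) \<in> S" by simp
  then have "c \<in> S" using pm_eq_sum_single[of c] by simp
  then show ?thesis by (simp add: S_def)
qed

lemma reduce_homologous:
  assumes "total_d p c = (0 :: 'a::{comm_ring,comm_monoid_mult} chain)"
  shows "c = total_d p (pm_extend htpy c + pm_extend htpy (reduce c)) + reduce (reduce c)"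
    "total_d p (reduce (reduce c)) = 0"
proof -
  have red: "reduce c = c - total_d p (pm_extend htpy c)"
    if "total_d p c = 0" for c :: "'a chain"
    using that by (simp add: reduce_def)
  have cyc: "total_d p (reduce c) = 0"
    if "total_d p c = 0" for c :: "'a chain"
    using that by (simp add: red[OF that] hoch_d_squared)
  show "total_d p (reduce (reduce c)) = 0" by (intro cyc assms)
  show "c = total_d p (pm_extend htpy c + pm_extend htpy (reduce c)) + reduce (reduce c)"
  proof -
    have "c = total_d p (pm_extend htpy c) + reduce c"
      by (simp add: red[OF assms])
    moreover have "reduce c = total_d p (pm_extend htpy (reduce c)) + reduce (reduce c)"
      by (simp add: red[OF cyc[OF assms]])
    ultimately show ?thesis unfolding pm_extend_add by (metis add.assoc)
  qed
qed

lemma hoch_d_unit: "hoch_d (ring_dquot p) [m] = (if odd m then single [m - 1] (nat_mult p 1) else 0 :: 'a::{comm_ring,comm_monoid_mult} chain)"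
  by (simp add: hoch_d_def hoch_b_def)

lemma hoch_d_pair: "hoch_d (ring_dquot p) [a, b] = (word [a + b] - signed (a * b) (word [a + b])
    - delta p [a, b] :: 'a::{comm_ring,comm_monoid_mult} chain)"
  using last_face_snoc[of a "[]" b, where 'a = 'a] by (simp add: hoch_d_def hoch_b_eq ac_simps)

text \<open>  For odd \<open>a\<close> the leading term is \<open>2 x\<^sup>a\<^sup>+\<^sup>1\<close>. This is how even powers of \<open>x\<close> are eliminated, and it
  is the source of the factor \<open>p\<^sup>2 / 2\<close> in the small complex.\<close>

lemma hoch_d_cyc_gen: "total_d p (cyc_gen a) =
   (if even a then 0 else word [Suc a] + word [Suc a] - pm_scale (nat_mult p 1) (cyc_gen (a - 1)) :: 'a::{comm_ring,comm_monoid_mult} chain)"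
proof -
  have "last_face [a, 0, 0] = (word [a, 0] :: 'a chain)" 
    using last_face_snoc[of a "[0]" 0, where 'a = 'a] by simp
  then have 3: "hoch_d (ring_dquot p) [a, 0, 0] = (word [a, 0]
      + (if odd a then single [a - 1, 0, 0] (nat_mult p 1) else 0) :: 'a chain)"
    by (simp add: hoch_d_def hoch_b_eq)
  show ?thesis
    unfolding cyc_gen_def pm_extend_add pm_extend_signed pm_extend_single 3 hoch_d_pair
    by (auto simp: signed_def pm_scale_add pm_scale_diff pm_scale_minus algebra_simps)
qed

lemma cyc_gen_degree: "cyc_gen a \<in> hchains p (int (a + 2))"
  unfolding cyc_gen_def by (intro hoch_chains_closed) (auto simp: degree_words_def)

end

section \<open>The small complex\<close>

text \<open>  All that is needed of the base ring up to the comparison with the small complex.\<close>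

locale dquot =
  fixes p :: nat and half :: "'a::{comm_ring,comm_monoid_mult}"
  assumes half: "half + half = 1"
    and torsion_free: "nat_mult p 1 * (r :: 'a) = 0 \<Longrightarrow> r = 0"
begin

abbreviation "P \<equiv> nat_mult p (1 :: 'a)"
abbreviation "d \<equiv> total_d p :: 'a chain \<Rightarrow> 'a chain"
abbreviation "B \<equiv> total_B p :: 'a chain \<Rightarrow> 'a chain"
abbreviation "Ch \<equiv> hchains p :: int \<Rightarrow> 'a chain set"
abbreviation "gen \<equiv> cyc_gen p :: nat \<Rightarrow> 'a chain"

text \<open>  The projection onto the small complex, whose module in each degree is identified with the base
  ring. The word \<open>[a, b]\<close> stands for \<open>x\<^sup>a d(x\<^sup>b)\<close>, which is cyclically equivalent to a multiple of
  \<open>x\<^sup>a\<^sup>+\<^sup>b\<^sup>-\<^sup>1 dx\<close>. For even \<open>a + b\<close> the latter is cancelled against \<open>x\<^sup>a\<^sup>+\<^sup>b\<close>, and since its boundary is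
  \<open>2 x\<^sup>n - p x\<^sup>n\<^sup>-\<^sup>2 dx\<close> with \<open>n = a + b\<close>, the even power \<open>x\<^sup>n\<close> is identified with half of
  \<open>p x\<^sup>n\<^sup>-\<^sup>2 dx\<close>.\<close>

fun proj_word :: "nat list \<Rightarrow> 'a" where
  "proj_word [a] = (if a = 0 \<or> odd a then 1 else half * P)"
| "proj_word [a, b] = (if odd (a + b) then nat_mult b 1 else 0)"
| "proj_word _ = 0"

abbreviation "proj \<equiv> pm_functional proj_word"

text \<open>  The differential and Connes' operator of the small complex on degree \<open>n\<close>.\<close>

definition dcoef :: "nat \<Rightarrow> 'a" where
  "dcoef n = (if n = 1 then P else if odd n then half * P * P else 0)"

definition bcoef :: "nat \<Rightarrow> 'a" where
  "bcoef n = (if odd n then nat_mult n 1 else 0)"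

lemma dcoef_even [simp]: "even n \<Longrightarrow> dcoef n = 0"
  by (auto simp: dcoef_def)

lemma bcoef_even [simp]: "even n \<Longrightarrow> bcoef n = 0"
  by (auto simp: bcoef_def)

lemma half_half: "half * r + half * r = (r :: 'a)"
  using half by (metis distrib_right mult_1)

lemma half_cancel: "half * r = 0 \<Longrightarrow> (r :: 'a) = 0"
  using half_half[of r] by simp

lemma half_mult_double: "half * (r + r) = (r :: 'a)"
  using half_half[of r] by (simp add: distrib_left)

lemma double_eq_zero: "r + r = 0 \<Longrightarrow> (r :: 'a) = 0"
  using half_mult_double[of r] by simp

lemma dcoef_cancel: "odd n \<Longrightarrow> dcoef n * r = 0 \<Longrightarrow> r = 0"
  by (auto simp: dcoef_def mult.assoc split: if_splits dest!: torsion_free half_cancel)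

lemma proj_long: "(\<And>w. w \<in> keys c \<Longrightarrow> 3 \<le> length w) \<Longrightarrow> proj c = 0"
proof (rule pm_functional_eq_zero)
  fix w assume "\<And>w. w \<in> keys c \<Longrightarrow> 3 \<le> length w" "w \<in> keys c"
  then have "3 \<le> length w" by blast
  then show "proj_word w = 0" by (cases w rule: proj_word.cases) auto
qed

lemma proj_hoch_d_word:
  assumes "w \<noteq> []"
  shows "proj (hoch_d (ring_dquot p) w) = dcoef (length w - 1 + sum_list w) * proj_word w"
proof -
  consider a where "w = [a]" | a b where "w = [a, b]" | a b c where "w = [a, b, c]" | "4 \<le> length w"
  proof -
    have "w \<noteq> [] \<and> (length w = 1 \<or> length w = 2 \<or> length w = 3 \<or> 4 \<le> length w)"
    proof -
      have "length w \<noteq> 0" using assms by simp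
      then show ?thesis using assms by linarith
    qed
    then show ?thesis using that by (auto simp: length_Suc_conv numeral_eq_Suc)
  qed
  then show ?thesis
  proof cases
    case (1 a)
    have "even a \<or> a = 1 \<or> (\<exists>k. a = Suc (Suc (Suc (k + k))))"
      by presburger
    then show ?thesis by (auto simp: 1 hoch_d_unit dcoef_def mult_ac)
  next
    case (2 a b)
    have 3: "proj (delta p [a, b]) = (if odd a \<and> odd b then P else 0)"
    proof -
      show ?thesis by (cases b) (auto simp: signed_def distrib_left)
    qed
    have "odd a \<Longrightarrow> odd b \<Longrightarrow> half * P + half * P - P = 0"
      using half_half[of P] by simp
    then show ?thesis unfolding 2 hoch_d_pair
      by (auto simp: 3 signed_def simp del: tensor_diff_simps)
  next
    case (3 a b c)
    have lf: "last_face [a, b, c] = (signed (Suc 0 + Suc 0 + c * (a + b)) (word [c + a, b]) :: 'a chain)"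
      using last_face_snoc[of a "[b]" c, where 'a = 'a] by simp
    have "proj (delta p [a, b, c]) = 0"
      by (rule proj_long) (use keys_delta[of p "[a, b, c]", where 'a = 'a] in force)
    moreover have "proj (bar [a, b, c] + last_face [a, b, c]) = 0"
      unfolding lf by (auto simp: signed_def nat_mult_add)
    ultimately show ?thesis by (simp add: 3 hoch_d_def hoch_b_eq)
  next
    case 4
    have "proj_word w = 0" using 4 by (cases w rule: proj_word.cases) auto
    moreover have "proj (hoch_d (ring_dquot p) w) = 0"
    proof -
      have "proj (bar w) = 0"
        by (rule proj_long) (use 4 keys_bar[of w, where 'a = 'a] in force)
      moreover have "proj (last_face w) = 0"
        using 4 by (intro proj_long) (auto simp: last_face_def split: if_splits)
      moreover have "proj (delta p w) = 0"
        by (rule proj_long) (use 4 keys_delta[of p w, where 'a = 'a] in force)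
      ultimately show ?thesis by (simp add: hoch_d_def hoch_b_eq)
    qed
    ultimately show ?thesis by simp
  qed
qed

lemma proj_connes_B_word:
  assumes "w \<noteq> []"
  shows "proj (connes_B (ring_dquot p) w) = bcoef (length w - 1 + sum_list w) * proj_word w"
proof -
  consider a where "w = [a]" | "2 \<le> length w"
  proof -
    have "length w \<noteq> 0" using assms by simp
    then have "length w = 1 \<or> 2 \<le> length w" by linarith
    then show ?thesis using that by (auto simp: length_Suc_conv)
  qed
  then show ?thesis
  proof cases
    case (1 a)
    have "cyc_t (ring_dquot p) [0, a] = (- word [a, 0] :: 'a chain)"
      using cyc_t_snoc[of p "[0]" a, where 'a = 'a] by simp
    then have "connes_B (ring_dquot p) [a] = (word [0, a] + word [a, 0] :: 'a chain)"
      by (simp add: connes_B_def Let_def cyc_N_def cyc_s_eq)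
    then show ?thesis by (simp add: 1 bcoef_def)
  next
    case 2
    have "of_length (Suc (length w)) (connes_B (ring_dquot p) w :: 'a chain)"
      using of_length_connes_B[of "length w" "word w :: 'a chain" p] by simp
    then have "proj (connes_B (ring_dquot p) w) = 0"
      using 2 by (intro proj_long) (auto simp: of_length_def)
    moreover have "bcoef (length w - 1 + sum_list w) * proj_word w = 0"
      using 2 by (cases w rule: proj_word.cases) (auto simp: bcoef_def)
    ultimately show ?thesis by simp
  qed
qed

lemma proj_d: "c \<in> Ch m \<Longrightarrow> proj (d c) = dcoef (nat m) * proj c"
proof -
  assume c: "c \<in> Ch m"
  have G: "linear_on_pm (*) (\<lambda>c. dcoef (nat m) * proj c)"
    by (simp add: linear_on_pm_def algebra_simps)
  have F: "linear_on_pm (*) (\<lambda>c. proj (d c))"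
    by (rule pm_linear_comp[OF linear_pm_functional pm_linearI(3)])
  show ?thesis
  proof (rule linear_eqI[OF F G])
    fix w assume "w \<in> keys c"
    then have "w \<in> degree_words m" using c by (auto simp: hoch_chains_iff)
    then show "proj (d (word w)) = dcoef (nat m) * proj (word w)"
      by (auto simp: degree_words_def proj_hoch_d_word nat_add_distrib)
  qed
qed

lemma proj_B: "c \<in> Ch m \<Longrightarrow> proj (B c) = bcoef (nat m) * proj c"
proof -
  assume c: "c \<in> Ch m"
  have G: "linear_on_pm (*) (\<lambda>c. bcoef (nat m) * proj c)"
    by (simp add: linear_on_pm_def algebra_simps)
  have F: "linear_on_pm (*) (\<lambda>c. proj (B c))"
    by (rule pm_linear_comp[OF linear_pm_functional pm_linearI(3)])
  show ?thesis
  proof (rule linear_eqI[OF F G])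
    fix w assume "w \<in> keys c"
    then have "w \<in> degree_words m" using c by (auto simp: hoch_chains_iff)
    then show "proj (B (word w)) = bcoef (nat m) * proj (word w)"
      by (auto simp: degree_words_def proj_connes_B_word nat_add_distrib)
  qed
qed

lemma proj_gen: "proj (gen a) = (if even a then 1 else 0)"
  by (simp add: cyc_gen_def)

lemma gen_degree: "int a + 2 = m \<Longrightarrow> gen a \<in> Ch m"
  using cyc_gen_degree[of p a, where 'a = 'a] by (simp add: add.commute)

lemma d_gen: "d (gen a) = (if even a then 0 else word [Suc a] + word [Suc a] - pm_scale P (gen (a - 1)))"
  by (rule hoch_d_cyc_gen)

lemma lookup_d_gen: "odd a \<Longrightarrow> lookup (d (gen a)) [Suc a] = 1 + 1"
  unfolding d_gen by (simp add: lookup_add lookup_minus cyc_gen_def lookup_single signed_def)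

text \<open>  By \<open>normal_form\<close> the cycle is homologous to \<open>\<alpha> [m] + \<beta> cyc_gen (m - 2)\<close>. In odd degree \<open>\<alpha>\<close> is
  detected by \<open>proj\<close> and \<open>\<beta>\<close> by the cycle condition. In even degree \<open>[m]\<close> is homologous to a
  multiple of \<open>cyc_gen (m - 2)\<close>, and \<open>proj\<close> shows that the total coefficient is a multiple of
  \<open>p\<^sup>2 / 2\<close>, hence the chain is a boundary.\<close>

lemma cycle_is_boundary_nonneg:
  assumes c: "c \<in> Ch (int m)" and dc: "d c = 0" and pc: "proj c = 0"
  shows "\<exists>e \<in> Ch (int m + 1). d e = c"
proof -
  obtain \<alpha> \<beta> where nf: "reduce p (reduce p c) = single [m] \<alpha> + pm_scale \<beta> (gen (m - 2))"
    and \<beta>: "m < 2 \<longrightarrow> \<beta> = 0"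
    using normal_form[OF c] by blast
  define e0 where "e0 = pm_extend htpy c + pm_extend htpy (reduce p c)"
  have e0: "e0 \<in> Ch (int m + 1)"
    unfolding e0_def by (intro hoch_chains_closed htpy_degree reduce_degree c)
  have c_eq: "c = d e0 + (single [m] \<alpha> + pm_scale \<beta> (gen (m - 2)))"
    using reduce_homologous(1)[OF dc] unfolding nf e0_def .
  have dX: "d (single [m] \<alpha> + pm_scale \<beta> (gen (m - 2))) = 0"
    using reduce_homologous(2)[OF dc] nf by simp
  have pe: "proj (d e) = dcoef (Suc m) * proj e" if "e \<in> Ch (int m + 1)" for e
    using proj_d[OF that] by (simp add: nat_add_distrib)
  have "odd m \<or> m = 0 \<or> (\<exists>k. even k \<and> m = Suc (Suc k))"
    by presburger
  then consider "odd m" | "m = 0" | k where "even k" "m = Suc (Suc k)" by blast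
  then show ?thesis
  proof cases
    case 1
    have "even (m - 2) \<Longrightarrow> \<beta> = 0" using 1 \<beta> by (cases "m < 2") auto
    then have "\<beta> * proj (gen (m - 2)) = 0" by (cases "even (m - 2)") (simp_all add: proj_gen)
    moreover have "proj (d e0) = 0" using pe[OF e0] 1 by simp
    moreover have "proj (single [m] \<alpha>) = \<alpha>" using 1 by simp
    ultimately have "\<alpha> = 0"
      using pc arg_cong[OF c_eq, of proj] unfolding pm_functional_simps by simp
    have "\<beta> = 0"
    proof (cases "m < 2")
      case False
      then have a: "odd (m - 2)" using 1 by auto
      have z: "d (pm_scale \<beta> (gen (m - 2))) = 0" using dX \<open>\<alpha> = 0\<close> by simp
      have "lookup (pm_scale \<beta> (d (gen (m - 2)))) [Suc (m - 2)] = 0"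
        unfolding pm_extend_scale[symmetric] z by simp
      then show ?thesis
        unfolding lookup_pm_scale lookup_d_gen[OF a] distrib_left mult_1_right by (rule double_eq_zero)
    qed (use \<beta> in simp)
    then have "d e0 = c" using \<open>\<alpha> = 0\<close> by (subst c_eq) simp
    with e0 show ?thesis by blast
  next
    case 2
    define e where "e = e0 - single [1] (proj e0)"
    have "\<alpha> = - P * proj e0"
      using arg_cong[OF c_eq, of proj] pc pe[OF e0] 2 \<beta> by (simp add: dcoef_def eq_neg_iff_add_eq_0 add.commute)
    then have "d e = c"
      unfolding e_def using c_eq 2 \<beta> by (simp add: hoch_d_unit single_uminus mult.commute)
    moreover have "e \<in> Ch (int m + 1)"
      unfolding e_def by (intro hoch_chains_closed e0) (simp add: 2 degree_words_def)
    ultimately show ?thesis by blast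
  next
    case (3 k)
    define e1 where "e1 = e0 + pm_scale (half * \<alpha>) (gen (Suc k))"
    define \<gamma> where "\<gamma> = \<beta> + half * \<alpha> * P"
    have e1: "e1 \<in> Ch (int m + 1)"
      unfolding e1_def by (intro hoch_chains_closed e0 gen_degree) (simp add: 3)
    have "half * \<alpha> * (1 + 1) = \<alpha>" by (simp add: distrib_left half_half)
    then have "c = d e1 + pm_scale \<gamma> (gen k)"
      unfolding e1_def \<gamma>_def using c_eq 3
      by (simp add: d_gen pm_scale_add pm_scale_diff pm_scale_add_left single_add[symmetric] add.assoc)
    note c_eq' = this
    have "\<gamma> = - (half * P * P) * proj e1"
      using arg_cong[OF c_eq', of proj] pc pe[OF e1] 3
      by (simp add: dcoef_def proj_gen eq_neg_iff_add_eq_0 add.commute)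
    note \<gamma>_eq = this
    \<comment> \<open>a lift of the generator in the odd degree \<open>m + 1\<close>, compatible with the differentials\<close>
    define j where "j = word [Suc m] - pm_scale (half * P) (gen (Suc k))"
    have j: "j \<in> Ch (int m + 1)"
      unfolding j_def by (intro hoch_chains_closed gen_degree) (simp_all add: degree_words_def 3)
    have "half * P * (1 + 1) = P" by (simp add: distrib_left half_half)
    then have dj: "d j = pm_scale (half * P * P) (gen k)"
      unfolding j_def using 3
      by (simp add: hoch_d_unit d_gen pm_scale_add pm_scale_diff single_add[symmetric])
    have "d (e1 - pm_scale (proj e1) j) = c"
      using c_eq' \<gamma>_eq dj by (simp add: pm_scale_minus_left mult_ac)
    moreover have "e1 - pm_scale (proj e1) j \<in> Ch (int m + 1)"
      by (intro hoch_chains_closed e1 j)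
    ultimately show ?thesis by blast
  qed
qed

text \<open>  The bounding chain can be corrected to lie in the kernel of \<open>proj\<close>: in odd degree this is
  automatic, as the small differential is injective there; in even degree a multiple of the
  cycle \<open>cyc_gen\<close> is subtracted.\<close>

lemma cycle_is_boundary:
  assumes c: "c \<in> Ch m" and dc: "d c = 0" and pc: "proj c = 0"
  shows "\<exists>e \<in> Ch (m + 1). d e = c \<and> proj e = 0"
proof (cases "m < 0")
  case True
  then have "c = 0" using hoch_chains_negative[OF c] by simp
  moreover have "0 \<in> Ch (m + 1)" by (rule hoch_chains_closed)
  ultimately show ?thesis by (intro bexI[of _ 0]) simp_all
next
  case False
  define n where "n = nat m"
  have n: "m = int n" using False by (simp add: n_def)
  obtain e where e: "e \<in> Ch (m + 1)" "d e = c"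
    using cycle_is_boundary_nonneg[OF c[unfolded n] dc pc] unfolding n by blast
  show ?thesis
  proof (cases "even n")
    case True
    have "nat (m + 1) = Suc n" by (simp add: n)
    then have "dcoef (Suc n) * proj e = 0"
      using proj_d[OF e(1)] e(2) pc by simp
    then have "proj e = 0" by (rule dcoef_cancel[rotated]) (simp add: True)
    with e show ?thesis by blast
  next
    case False
    then obtain k where k: "n = Suc k" "even k" by (cases n) auto
    have "e - pm_scale (proj e) (gen k) \<in> Ch (m + 1)"
      by (intro hoch_chains_closed e gen_degree) (simp add: n k)
    moreover have "d (e - pm_scale (proj e) (gen k)) = c" using e(2) k(2) by (simp only: pm_extend_diff pm_extend_scale d_gen if_True pm_scale_zero diff_zero)
    moreover have "proj (e - pm_scale (proj e) (gen k)) = 0" using k by (simp add: proj_gen)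
    ultimately show ?thesis by blast
  qed
qed

end

section \<open>Negative cyclic homology of the small complex\<close>

context dquot
begin

abbreviation "NC \<equiv> neg_cyclic_chains (ring_dquot p) :: int \<Rightarrow> (nat \<Rightarrow> 'a chain) set"
abbreviation "D \<equiv> neg_cyclic_d (ring_dquot p) :: (nat \<Rightarrow> 'a chain) \<Rightarrow> (nat \<Rightarrow> 'a chain)"

text \<open>  The differential of the negative cyclic complex of the small complex, out of degree \<open>i\<close>.\<close>

definition small_d :: "int \<Rightarrow> (nat \<Rightarrow> 'a) \<Rightarrow> nat \<Rightarrow> 'a" where
  "small_d i r k = dcoef (nat (i + 2 * int k)) * r k
     + (if k = 0 then 0 else bcoef (nat (i + 2 * int (k - 1))) * r (k - 1))"

lemma NC_iff: "c \<in> NC i \<longleftrightarrow> (\<forall>k. c k \<in> Ch (i + 2 * int k))"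
  by (simp add: neg_cyclic_chains_def)

lemma D_0 [simp]: "D c 0 = d (c 0)"
  by (simp add: neg_cyclic_d_def)

lemma D_Suc [simp]: "D c (Suc k) = d (c (Suc k)) + B (c k)"
  by (simp add: neg_cyclic_d_def)

lemma D_diff: "D (c - c') = D c - D c'"
proof
  fix k show "D (c - c') k = (D c - D c') k" by (cases k) (simp_all add: algebra_simps)
qed

lemma D_add: "D (c + c') = D c + D c'"
proof
  fix k show "D (c + c') k = (D c + D c') k" by (cases k) (simp_all add: algebra_simps)
qed

lemma D_zero: "D 0 = 0"
proof
  fix k show "D 0 k = 0 k" by (cases k) simp_all
qed

lemma D_scale: "D (\<lambda>k. pm_scale r (c k)) = (\<lambda>k. pm_scale r (D c k))"
proof
  fix k show "D (\<lambda>k. pm_scale r (c k)) k = pm_scale r (D c k)" by (cases k) (simp_all add: pm_scale_add)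
qed

lemma D_closed: "c \<in> NC i \<Longrightarrow> D c \<in> NC (i - 1)"
  unfolding NC_iff
proof
  fix k assume c: "\<forall>k. c k \<in> Ch (i + 2 * int k)"
  show "D c k \<in> Ch (i - 1 + 2 * int k)"
  proof (cases k)
    case 0
    then show ?thesis using hoch_d_degree[of "c 0" p i] c[rule_format, of 0] by simp
  next
    case (Suc j)
    have "d (c k) \<in> Ch (i + 2 * int k - 1)" by (rule hoch_d_degree) (rule c[rule_format])
    moreover have "B (c j) \<in> Ch (i + 2 * int j + 1)" by (rule connes_B_degree) (rule c[rule_format])
    moreover have "i + 2 * int k - 1 = i - 1 + 2 * int k" "i + 2 * int j + 1 = i - 1 + 2 * int k"
      using Suc by simp_all
    ultimately show ?thesis unfolding Suc D_Suc by (intro hoch_chains_closed) simp_all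
  qed
qed

lemma D_squared: "D (D c) = 0"
proof
  fix k show "D (D c) k = 0 k"
  proof (cases k)
    case (Suc j)
    then show ?thesis by (cases j) (simp_all add: hoch_d_squared connes_B_squared connes_B_hoch_d)
  qed (simp add: hoch_d_squared)
qed

lemma proj_D: "c \<in> NC i \<Longrightarrow> proj (D c k) = small_d i (\<lambda>k. proj (c k)) k"
proof (cases k)
  case (Suc j)
  assume "c \<in> NC i"
  then have "c k \<in> Ch (i + 2 * int k)" "c j \<in> Ch (i + 2 * int j)" by (auto simp: NC_iff)
  then show ?thesis using Suc by (simp add: small_d_def proj_d proj_B)
next
  case 0
  assume "c \<in> NC i"
  then have "c 0 \<in> Ch (i + 2 * int 0)" by (simp only: NC_iff)
  then show ?thesis using 0 proj_d[of "c 0" i] by (simp add: small_d_def)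
qed

lemma NC_closed:
  "c \<in> NC i \<Longrightarrow> c' \<in> NC i \<Longrightarrow> c - c' \<in> NC i" "c \<in> NC i \<Longrightarrow> c' \<in> NC i \<Longrightarrow> c + c' \<in> NC i"
  "0 \<in> NC i" "c \<in> NC i \<Longrightarrow> (\<lambda>k. pm_scale r (c k)) \<in> NC i"
  by (auto simp: NC_iff intro!: hoch_chains_closed)

text \<open>  The bounding chain is found component by component: \<open>c (k + 1) - B (e k)\<close> is again a cycle in
  the kernel of \<open>proj\<close>, because \<open>B\<close> anticommutes with \<open>d\<close> and squares to zero.\<close>

lemma neg_cycle_is_boundary:
  assumes c: "c \<in> NC i" and Dc: "D c = 0" and pc: "\<And>k. proj (c k) = 0"
  shows "\<exists>e \<in> NC (i + 1). D e = c \<and> (\<forall>k. proj (e k) = 0)"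
proof -
  define G where "G m x = (SOME e. e \<in> Ch (m + 1) \<and> d e = x \<and> proj e = 0)" for m x
  have G: "G m x \<in> Ch (m + 1) \<and> d (G m x) = x \<and> proj (G m x) = 0"
    if "x \<in> Ch m" "d x = 0" "proj x = 0" for m x
    unfolding G_def by (rule someI_ex) (use cycle_is_boundary[OF that] in blast)
  define e where "e = rec_nat (G i (c 0)) (\<lambda>k y. G (i + 2 * int (Suc k)) (c (Suc k) - B y))"
  have e0: "e 0 = G i (c 0)" and eS: "e (Suc k) = G (i + 2 * int (Suc k)) (c (Suc k) - B (e k))" for k
    by (simp_all add: e_def)
  have ck: "c k \<in> Ch (i + 2 * int k)" for k using c by (simp add: NC_iff)
  have dc0: "d (c 0) = 0" using fun_cong[OF Dc, of 0] by simp
  have dcS: "d (c (Suc k)) + B (c k) = 0" for k using fun_cong[OF Dc, of "Suc k"] by simp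
  have inv: "e k \<in> Ch (i + 2 * int k + 1) \<and> proj (e k) = 0 \<and>
      d (e k) = (case k of 0 \<Rightarrow> c 0 | Suc j \<Rightarrow> c k - B (e j))" for k
  proof (induction k)
    case 0
    show ?case using G[of "c 0" i] ck[of 0] dc0 pc[of 0] by (simp add: e0)
  next
    case (Suc k)
    have Bd: "B (d (e k)) = B (c k)"
    proof (cases k)
      case (Suc j)
      then show ?thesis using Suc.IH by (simp add: connes_B_squared)
    qed (use Suc.IH in simp)
    have "B (e k) \<in> Ch (i + 2 * int k + 1 + 1)" using Suc.IH by (intro connes_B_degree) simp
    then have "c (Suc k) - B (e k) \<in> Ch (i + 2 * int (Suc k))"
      using ck[of "Suc k"] by (intro hoch_chains_closed) (simp_all add: algebra_simps)
    moreover have "d (c (Suc k) - B (e k)) = 0"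
    proof -
      have "d (c (Suc k)) = - B (c k)" using dcS[of k] by (simp add: eq_neg_iff_add_eq_0)
      moreover have "B (c k) = - d (B (e k))" using Bd connes_B_hoch_d[of p "e k"] by simp
      ultimately show ?thesis by simp
    qed
    moreover have "proj (c (Suc k) - B (e k)) = 0"
      using proj_B[of "e k" "i + 2 * int k + 1"] Suc.IH pc[of "Suc k"] by simp
    ultimately show ?case using G[of "c (Suc k) - B (e k)" "i + 2 * int (Suc k)"] by (simp add: eS)
  qed
  have "e \<in> NC (i + 1)" using inv by (simp add: NC_iff algebra_simps)
  moreover have "D e = c"
  proof
    fix k show "D e k = c k" using inv[of k] by (cases k) simp_all
  qed
  ultimately show ?thesis using inv by blast
qed

lemma proj_lift: "(m < 0 \<Longrightarrow> s = 0) \<Longrightarrow> \<exists>c \<in> Ch m. proj c = s"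
proof -
  assume s: "m < 0 \<Longrightarrow> s = 0"
  consider "m < 0" | "m = 0 \<or> odd m" "0 \<le> m" | "even m" "2 \<le> m"
    by (cases "even m"; cases "m < 0"; cases "m = 0") (auto elim!: evenE)
  then show ?thesis
  proof cases
    case 1
    then show ?thesis using s hoch_chains_closed(1)[of p m, where 'a = 'a] by (intro bexI[of _ 0]) simp_all
  next
    case 2
    then have "even (nat m) \<Longrightarrow> m = 0" by (auto simp: even_nat_iff)
    then have "proj (single [nat m] s) = s" by auto
    moreover have "single [nat m] s \<in> Ch m"
      using 2 by (intro hoch_chains_closed) (simp add: degree_words_def)
    ultimately show ?thesis by blast
  next
    case 3
    have "pm_scale s (gen (nat m - 2)) \<in> Ch m"
      using 3 by (intro hoch_chains_closed gen_degree) auto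
    moreover have "even (nat m - 2)" using 3 by (auto simp: even_nat_iff)
    then have "proj (pm_scale s (gen (nat m - 2))) = s" by (simp add: proj_gen)
    ultimately show ?thesis by blast
  qed
qed

lemma proj_lift_chains:
  assumes "\<And>k. i + 2 * int k < 0 \<Longrightarrow> s k = 0"
  shows "\<exists>c \<in> NC i. \<forall>k. proj (c k) = s k"
proof -
  have "\<forall>k. \<exists>c. c \<in> Ch (i + 2 * int k) \<and> proj c = s k"
    using proj_lift[OF assms] by blast
  then obtain c where "\<forall>k. c k \<in> Ch (i + 2 * int k) \<and> proj (c k) = s k" by metis
  then show ?thesis by (intro bexI[of _ c]) (auto simp: NC_iff)
qed

definition cycles :: "int \<Rightarrow> (nat \<Rightarrow> 'a chain) set" where
  "cycles i = {c \<in> NC i. D c = 0}"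

definition boundaries :: "int \<Rightarrow> (nat \<Rightarrow> 'a chain) set" where
  "boundaries i = D ` NC (i + 1)"

lemma HC_minus_eq: "HC_minus (ring_dquot p) i = quotient_module (\<lambda>r c k. pm_scale r (c k)) (cycles i) (boundaries i)"
  by (simp add: HC_minus_def cycles_def boundaries_def)

lemma boundaries_subset: "boundaries i \<subseteq> cycles i"
  using D_closed[of _ "i + 1"] by (auto simp: boundaries_def cycles_def D_squared)

lemma cycle_in_boundaries: "c \<in> cycles i \<Longrightarrow> (\<And>k. proj (c k) = 0) \<Longrightarrow> c \<in> boundaries i"
  using neg_cycle_is_boundary[of c i] by (auto simp: cycles_def boundaries_def)

text \<open>  The \<open>k\<close>-th component determines \<open>r k\<close> from \<open>r (k - 1)\<close>, as the differential of the small
  complex is injective in positive odd degrees.\<close>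

lemma small_d_odd_injective:
  assumes "odd i" "\<And>k. i + 2 * int k < 0 \<Longrightarrow> r k = 0" "\<And>k. small_d i r k = 0"
  shows "r k = 0"
proof (induction k)
  case 0
  show ?case
  proof (cases "i < 0")
    case False
    then show ?thesis using assms(3)[of 0] dcoef_cancel[of "nat i" "r 0"] assms(1)
      by (simp add: small_d_def even_nat_iff)
  qed (use assms(2)[of 0] in simp)
next
  case (Suc k)
  show ?case
  proof (cases "i + 2 * int (Suc k) < 0")
    case False
    then show ?thesis using assms(3)[of "Suc k"] dcoef_cancel[of "nat (i + 2 * int (Suc k))" "r (Suc k)"] assms(1) Suc
      by (simp add: small_d_def even_nat_iff)
  qed (use assms(2) in blast)
qed

lemma NC_negative: "c \<in> NC i \<Longrightarrow> i + 2 * int k < 0 \<Longrightarrow> c k = 0"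
  using hoch_chains_negative by (auto simp: NC_iff)

lemma odd_cycles: "odd i \<Longrightarrow> cycles i = boundaries i"
proof
  assume "odd i"
  show "cycles i \<subseteq> boundaries i"
  proof
    fix c assume c: "c \<in> cycles i"
    have "proj (c k) = 0" for k
    proof (rule small_d_odd_injective[OF \<open>odd i\<close>])
      show "i + 2 * int k < 0 \<Longrightarrow> proj (c k) = 0" for k
        using NC_negative[of c i k] c by (simp add: cycles_def)
      show "small_d i (\<lambda>k. proj (c k)) k = 0" for k
        using proj_D[of c i k] c by (simp add: cycles_def)
    qed
    then show "c \<in> boundaries i" by (rule cycle_in_boundaries[OF c])
  qed
qed (rule boundaries_subset)

text \<open>  A bounding chain in the small complex lifts to a chain whose boundary differs from \<open>c\<close> by a
  cycle in the kernel of \<open>proj\<close>, and such a cycle bounds.\<close>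

lemma boundaries_iff:
  assumes c: "c \<in> cycles i"
  shows "c \<in> boundaries i \<longleftrightarrow>
    (\<exists>r. (\<forall>k. i + 1 + 2 * int k < 0 \<longrightarrow> r k = 0) \<and> (\<forall>k. proj (c k) = small_d (i + 1) r k))"
proof
  assume "c \<in> boundaries i"
  then obtain e where e: "e \<in> NC (i + 1)" "c = D e" by (auto simp: boundaries_def)
  then show "\<exists>r. (\<forall>k. i + 1 + 2 * int k < 0 \<longrightarrow> r k = 0) \<and> (\<forall>k. proj (c k) = small_d (i + 1) r k)"
    using proj_D[OF e(1)] NC_negative[OF e(1)] by (intro exI[of _ "\<lambda>k. proj (e k)"]) simp
next
  assume "\<exists>r. (\<forall>k. i + 1 + 2 * int k < 0 \<longrightarrow> r k = 0) \<and> (\<forall>k. proj (c k) = small_d (i + 1) r k)"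
  then obtain r where r: "\<And>k. i + 1 + 2 * int k < 0 \<Longrightarrow> r k = 0" "\<And>k. proj (c k) = small_d (i + 1) r k" by blast
  obtain e where e: "e \<in> NC (i + 1)" "\<forall>k. proj (e k) = r k" using proj_lift_chains[of "i + 1" r] r(1) by blast
  have De: "D e \<in> boundaries i" using e by (simp add: boundaries_def)
  then have "D e \<in> cycles i" using boundaries_subset by blast
  then have "c - D e \<in> cycles i" using c by (auto simp: cycles_def NC_closed D_diff)
  moreover have "proj ((c - D e) k) = 0" for k using proj_D[OF e(1), of k] e(2) r(2)[of k] by simp
  ultimately have "c - D e \<in> boundaries i" by (rule cycle_in_boundaries)
  then obtain f where "f \<in> NC (i + 1)" "c - D e = D f" by (auto simp: boundaries_def)
  then have "f + e \<in> NC (i + 1)" "c = D (f + e)" using e(1) by (auto simp: NC_closed D_add algebra_simps)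
  then show "c \<in> boundaries i" by (auto simp: boundaries_def)
qed

text \<open>  An arbitrary lift has its boundary in the kernel of \<open>proj\<close>, since the small complex has no
  differential out of even degrees; acyclicity of the kernel allows to correct the lift.\<close>

lemma even_cycles_surj:
  assumes "even i" "\<And>k. i + 2 * int k < 0 \<Longrightarrow> s k = 0"
  shows "\<exists>c \<in> cycles i. \<forall>k. proj (c k) = s k"
proof -
  obtain c where c: "c \<in> NC i" "\<forall>k. proj (c k) = s k" using proj_lift_chains[of i s] assms(2) by blast
  have ev: "even (nat (i + 2 * int k))" for k
    using assms(1) by (cases "i + 2 * int k < 0") (simp_all add: even_nat_iff)
  have "proj (D c k) = 0" for k
    unfolding proj_D[OF c(1), of k] small_d_def dcoef_even[OF ev] bcoef_even[OF ev] by simp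
  then obtain e where e: "e \<in> NC i" "D e = D c" "\<forall>k. proj (e k) = 0"
    using neg_cycle_is_boundary[OF D_closed[OF c(1)] D_squared] by auto
  have "c - e \<in> cycles i" using c(1) e by (simp add: cycles_def NC_closed D_diff)
  moreover have "\<forall>k. proj ((c - e) k) = s k" using c(2) e(3) by simp
  ultimately show ?thesis by blast
qed

lemma odd_HC_minus:
  assumes "odd i"
  shows "carrier (HC_minus (ring_dquot p) i :: ('a, (nat \<Rightarrow> 'a chain) set) module) = {\<zero>\<^bsub>HC_minus (ring_dquot p) i\<^esub>}"
proof -
  have "(+) u ` boundaries i = boundaries i" if u: "u \<in> boundaries i" for u
  proof -
    obtain e where e: "e \<in> NC (i + 1)" "u = D e" using u unfolding boundaries_def by blast
    show ?thesis
    proof (intro equalityI subsetI)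
      fix x assume "x \<in> boundaries i"
      then obtain f where "f \<in> NC (i + 1)" "x = D f" by (auto simp: boundaries_def)
      then show "x \<in> (+) u ` boundaries i"
        using e by (intro image_eqI[of _ _ "D (f - e)"]) (simp_all add: boundaries_def NC_closed, simp add: D_diff)
    qed (use e in \<open>auto simp: boundaries_def D_add[symmetric] NC_closed\<close>)
  qed
  moreover have "0 \<in> boundaries i"
    unfolding boundaries_def by (rule image_eqI[of _ _ 0]) (simp_all add: D_zero NC_closed)
  ultimately show ?thesis
    by (auto simp: HC_minus_eq quotient_module_def odd_cycles[OF assms])
qed

end

section \<open>Quotient modules\<close>

definition submodule_closed :: "('r \<Rightarrow> 'm \<Rightarrow> 'm) \<Rightarrow> 'm::ab_group_add set \<Rightarrow> bool" where
  "submodule_closed sc V \<longleftrightarrow> 0 \<in> V \<and> (\<forall>x\<in>V. \<forall>y\<in>V. x - y \<in> V) \<and> (\<forall>r. \<forall>x\<in>V. sc r x \<in> V)"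

lemma submodule_closedD:
  assumes "submodule_closed sc V"
  shows "0 \<in> V" "x \<in> V \<Longrightarrow> y \<in> V \<Longrightarrow> x - y \<in> V" "x \<in> V \<Longrightarrow> sc r x \<in> V"
    "x \<in> V \<Longrightarrow> - x \<in> V" "x \<in> V \<Longrightarrow> y \<in> V \<Longrightarrow> x + y \<in> V"
proof -
  show 0: "0 \<in> V" and d: "\<And>x y. x \<in> V \<Longrightarrow> y \<in> V \<Longrightarrow> x - y \<in> V" and "x \<in> V \<Longrightarrow> sc r x \<in> V"
    using assms by (auto simp: submodule_closed_def)
  show m: "x \<in> V \<Longrightarrow> - x \<in> V" for x using d[OF 0, of x] by simp
  show "x \<in> V \<Longrightarrow> y \<in> V \<Longrightarrow> x + y \<in> V" using d[OF _ m, of x y] by simp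
qed

lemma coset_eq_iff:
  assumes V: "submodule_closed sc V"
  shows "(+) u ` V = (+) u' ` V \<longleftrightarrow> u - u' \<in> V"
proof
  assume "(+) u ` V = (+) u' ` V"
  moreover have "u + 0 \<in> (+) u ` V" using submodule_closedD(1)[OF V] by (rule imageI)
  ultimately obtain v where "v \<in> V" "u + 0 = u' + v" by auto
  then show "u - u' \<in> V" by simp
next
  have sub: "(+) u ` V \<subseteq> (+) u' ` V" if "u - u' \<in> V" for u u'
  proof
    fix x assume "x \<in> (+) u ` V"
    then obtain v where "v \<in> V" "x = u + v" by blast
    then show "x \<in> (+) u' ` V"
      using submodule_closedD(5)[OF V that, of v] by (intro image_eqI[of _ _ "u - u' + v"]) auto
  qed
  assume "u - u' \<in> V"
  then show "(+) u ` V = (+) u' ` V" using sub[of u u'] sub[of u' u] submodule_closedD(4)[OF V, of "u - u'"] by auto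
qed

lemma coset_add:
  assumes V: "submodule_closed sc V"
  shows "{x + y |x y. x \<in> (+) u ` V \<and> y \<in> (+) u' ` V} = (+) (u + u') ` V"
proof (intro equalityI subsetI)
  fix z assume "z \<in> {x + y |x y. x \<in> (+) u ` V \<and> y \<in> (+) u' ` V}"
  then obtain v v' where "v \<in> V" "v' \<in> V" "z = u + v + (u' + v')" by blast
  then show "z \<in> (+) (u + u') ` V"
    using submodule_closedD(5)[OF V] by (intro image_eqI[of _ _ "v + v'"]) (auto simp: algebra_simps)
next
  fix z assume "z \<in> (+) (u + u') ` V"
  then obtain v where v: "v \<in> V" "z = u + u' + v" by blast
  then have "z = (u + v) + (u' + 0)" by (simp add: algebra_simps)
  then show "z \<in> {x + y |x y. x \<in> (+) u ` V \<and> y \<in> (+) u' ` V}"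
    using v submodule_closedD(1)[OF V] by blast
qed

lemma coset_scale:
  assumes V: "submodule_closed sc V" and sc: "\<And>r x y. sc r (x + y) = sc r x + sc r y"
  shows "{sc r x + v |x v. x \<in> (+) u ` V \<and> v \<in> V} = (+) (sc r u) ` V"
proof (intro equalityI subsetI)
  fix z assume "z \<in> {sc r x + v |x v. x \<in> (+) u ` V \<and> v \<in> V}"
  then obtain v v' where "v \<in> V" "v' \<in> V" "z = sc r (u + v) + v'" by blast
  then show "z \<in> (+) (sc r u) ` V"
    using submodule_closedD(3,5)[OF V] by (intro image_eqI[of _ _ "sc r v + v'"]) (auto simp: sc algebra_simps)
next
  fix z assume "z \<in> (+) (sc r u) ` V"
  then obtain v where v: "v \<in> V" "z = sc r (u + 0) + v" by auto
  then show "z \<in> {sc r x + v |x v. x \<in> (+) u ` V \<and> v \<in> V}" using submodule_closedD(1)[OF V] by blast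
qed

lemma quotient_module_iso:
  fixes sc :: "'r \<Rightarrow> 'm \<Rightarrow> 'm::ab_group_add" and N :: "('r, 'n) module" and F :: "'m \<Rightarrow> 'n"
  assumes VU: "V \<subseteq> U" and V: "submodule_closed sc V" and U: "submodule_closed sc U"
    and sc: "\<And>r x y. sc r (x + y) = sc r x + sc r y"
    and F: "\<And>u. u \<in> U \<Longrightarrow> F u \<in> carrier N"
    and Fa: "\<And>u u'. u \<in> U \<Longrightarrow> u' \<in> U \<Longrightarrow> F (u + u') = F u \<oplus>\<^bsub>N\<^esub> F u'"
    and Fs: "\<And>r u. u \<in> U \<Longrightarrow> F (sc r u) = r \<odot>\<^bsub>N\<^esub> F u"
    and ker: "\<And>u u'. u \<in> U \<Longrightarrow> u' \<in> U \<Longrightarrow> F u = F u' \<longleftrightarrow> u - u' \<in> V"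
    and surj: "\<And>y. y \<in> carrier N \<Longrightarrow> \<exists>u \<in> U. F u = y"
  shows "quotient_module sc U V \<cong>\<^sub>m N"
proof -
  define f where "f X = F (SOME u. u \<in> X)" for X
  have f: "f ((+) u ` V) = F u" if u: "u \<in> U" for u
  proof -
    have "(SOME x. x \<in> (+) u ` V) \<in> (+) u ` V"
      by (rule someI_ex) (use submodule_closedD(1)[OF V] in blast)
    then obtain v where v: "v \<in> V" "(SOME x. x \<in> (+) u ` V) = u + v" by blast
    have "F (u + v) = F u" using ker[of "u + v" u] submodule_closedD(5)[OF U, of u v] v VU u by auto
    then show ?thesis by (simp add: f_def v)
  qed
  have "bij_betw f (carrier (quotient_module sc U V)) (carrier N)"
    unfolding bij_betw_def
  proof
    show "inj_on f (carrier (quotient_module sc U V))"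
      by (auto simp: inj_on_def quotient_module_def f ker coset_eq_iff[OF V])
    show "f ` carrier (quotient_module sc U V) = carrier N"
      using F surj by (auto simp: quotient_module_def f image_image)
  qed
  then show ?thesis
    unfolding module_iso_def
    by (intro exI[of _ f])
      (auto simp: quotient_module_def coset_add[OF V] coset_scale[OF V sc] f submodule_closedD[OF U] Fa Fs)
qed

section \<open>Localized integers acting on the base ring\<close>

text \<open>  The elements of \<open>Zp\<close> act through \<open>h\<close>. Computing with rational numbers and applying \<open>h\<close> at the
  end avoids numerals and inverses in the base ring, which may be the zero ring.\<close>

locale localized =
  fixes p :: nat and h :: "rat \<Rightarrow> 'a::{comm_ring,comm_monoid_mult}"
  assumes prime: "prime p"
    and h_one: "h 1 = 1"
    and h_hom: "\<And>x y. x \<in> Z_localized p \<Longrightarrow> y \<in> Z_localized p \<Longrightarrow> h (x + y) = h x + h y \<and> h (x * y) = h x * h y"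
    and inj: "inj (nat_mult p :: 'a \<Rightarrow> 'a)"
begin

abbreviation "Zp \<equiv> Z_localized p"

lemma Zp_of_int: "of_int n \<in> Zp"
proof -
  have "\<not> int p dvd 1" using prime by (auto dest: prime_gt_1_nat)
  moreover have "(of_int n :: rat) = of_int n / of_int 1" by simp
  ultimately show ?thesis unfolding Z_localized_def by blast
qed

lemma Zp_of_nat: "of_nat n \<in> Zp"
  using Zp_of_int[of "int n"] by simp

lemma Zp_one: "1 \<in> Zp" and Zp_zero: "0 \<in> Zp"
  using Zp_of_int[of 1] Zp_of_int[of 0] by simp_all

lemma Zp_frac: "\<not> p dvd n \<Longrightarrow> of_int a / of_nat n \<in> Zp"
proof -
  assume "\<not> p dvd n"
  then have "\<not> int p dvd int n" by simp
  moreover have "of_int a / of_nat n = of_int a / (of_int (int n) :: rat)" by simp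
  ultimately show ?thesis unfolding Z_localized_def by blast
qed

lemma Zp_mult: "x \<in> Zp \<Longrightarrow> y \<in> Zp \<Longrightarrow> x * y \<in> Zp"
proof -
  assume "x \<in> Zp" "y \<in> Zp"
  then obtain a b a' b' where ab: "x = of_int a / of_int b" "\<not> int p dvd b" "y = of_int a' / of_int b'" "\<not> int p dvd b'"
    by (auto simp: Z_localized_def)
  then have "x * y = of_int (a * a') / of_int (b * b')" by simp
  moreover have "\<not> int p dvd b * b'" using ab prime by (simp add: prime_dvd_mult_iff)
  ultimately show ?thesis unfolding Z_localized_def by blast
qed

lemma Zp_minus: "x \<in> Zp \<Longrightarrow> - x \<in> Zp"
  using Zp_mult[OF Zp_of_int[of "-1"]] by simp

lemma Zp_prod: "(\<And>i. i \<in> I \<Longrightarrow> f i \<in> Zp) \<Longrightarrow> prod f I \<in> Zp"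
  by (induction I rule: infinite_finite_induct) (auto intro: Zp_one Zp_mult)

lemma Zp_power: "x \<in> Zp \<Longrightarrow> x ^ n \<in> Zp"
  by (induction n) (auto intro: Zp_one Zp_mult)

lemma h_add: "x \<in> Zp \<Longrightarrow> y \<in> Zp \<Longrightarrow> h (x + y) = h x + h y"
  and h_mult: "x \<in> Zp \<Longrightarrow> y \<in> Zp \<Longrightarrow> h (x * y) = h x * h y"
  using h_hom by blast+

lemma h_zero: "h 0 = 0"
  using h_add[OF Zp_zero Zp_zero] by simp

lemma h_minus: "x \<in> Zp \<Longrightarrow> h (- x) = - h x"
  using h_add[of x "- x"] by (simp add: Zp_minus h_zero eq_neg_iff_add_eq_0 add.commute)

lemma h_of_nat: "h (of_nat n) = nat_mult n 1"
  by (induction n) (simp_all add: h_zero h_add Zp_one Zp_of_nat h_one)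

lemma nat_mult_h: "nat_mult n r = h (of_nat n) * r"
  using nat_mult_eq[of n r] by (simp add: h_of_nat)

lemma prime_cancel: "h (of_nat p) * r = 0 \<Longrightarrow> r = 0"
  using injD[OF inj, of r 0] by (simp add: nat_mult_h)

lemma prime_power_cancel: "h (of_nat p ^ n) * r = 0 \<Longrightarrow> r = 0"
proof (induction n)
  case (Suc n)
  then have "h (of_nat p) * (h (of_nat p ^ n) * r) = 0"
    by (simp add: h_mult Zp_power Zp_of_nat mult.assoc)
  then show ?case using prime_cancel Suc.IH by blast
qed (simp add: h_one)

text \<open>The numerator of \<open>x\<close> is a power of \<open>p\<close> times an integer that is a unit in \<open>Zp\<close>.\<close>

lemma divides_prime_power:
  assumes "x \<in> Zp" "x \<noteq> 0"
  shows "\<exists>n. \<exists>z \<in> Zp. of_nat p ^ n = x * z"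
proof -
  obtain a b where ab: "x = of_int a / of_int b" "\<not> int p dvd b" using assms(1) by (auto simp: Z_localized_def)
  then have "a \<noteq> 0" "b \<noteq> 0" using assms(2) by auto
  have pu: "\<not> is_unit (int p)" using prime by (auto dest: prime_gt_1_nat)
  define n where "n = multiplicity (int p) a"
  obtain u where u: "a = int p ^ n * u" "\<not> int p dvd u"
    using multiplicity_decompose'[OF \<open>a \<noteq> 0\<close> pu] unfolding n_def by blast
  then have "u \<noteq> 0" by auto
  have "of_int b / of_int u \<in> Zp" using u(2) unfolding Z_localized_def by blast
  moreover have "of_nat p ^ n = x * (of_int b / of_int u)"
    using ab u \<open>u \<noteq> 0\<close> \<open>b \<noteq> 0\<close> by (simp add: field_simps)
  ultimately show ?thesis by blast
qed

lemma h_cancel_zero: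
  assumes "x \<in> Zp" "x \<noteq> 0" "h x * r = 0"
  shows "r = 0"
proof -
  obtain n z where z: "z \<in> Zp" "of_nat p ^ n = x * z" using divides_prime_power[OF assms(1,2)] by blast
  have "h (of_nat p ^ n) * r = h z * (h x * r)"
    unfolding z(2) using assms(1) z(1) by (simp add: h_mult mult_ac)
  then show ?thesis using assms(3) prime_power_cancel by simp
qed

lemma h_cancel: "x \<in> Zp \<Longrightarrow> x \<noteq> 0 \<Longrightarrow> h x * r = h x * s \<Longrightarrow> r = s"
  using h_cancel_zero[of x "r - s"] by (simp add: right_diff_distrib)

definition multiples :: "rat \<Rightarrow> 'a set" where
  "multiples x = {h x * r |r. True}"

lemma multiplesI: "r = h x * s \<Longrightarrow> r \<in> multiples x"
  by (auto simp: multiples_def)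

lemma multiples_zero: "0 \<in> multiples x"
  by (rule multiplesI[of _ _ 0]) simp

lemma multiples_add: "r \<in> multiples x \<Longrightarrow> s \<in> multiples x \<Longrightarrow> r + s \<in> multiples x"
  unfolding multiples_def by (auto simp: distrib_left[symmetric])

lemma multiples_minus: "r \<in> multiples x \<Longrightarrow> - r \<in> multiples x"
proof -
  assume "r \<in> multiples x"
  then obtain s where "r = h x * s" by (auto simp: multiples_def)
  then show ?thesis by (intro multiplesI[of _ _ "- s"]) simp
qed

lemma multiples_diff: "r \<in> multiples x \<Longrightarrow> s \<in> multiples x \<Longrightarrow> r - s \<in> multiples x"
  using multiples_add[of r x "- s"] multiples_minus by simp

lemma multiples_sum: "(\<And>i. i \<in> I \<Longrightarrow> f i \<in> multiples x) \<Longrightarrow> sum f I \<in> multiples x"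
  by (induction I rule: infinite_finite_induct) (auto intro: multiples_zero multiples_add)

lemma multiples_h: "x \<in> Zp \<Longrightarrow> z \<in> Zp \<Longrightarrow> h (x * z) * r \<in> multiples x"
  by (rule multiplesI[of _ _ "h z * r"]) (simp add: h_mult mult.assoc)

lemma multiples_mono: "x \<in> Zp \<Longrightarrow> z \<in> Zp \<Longrightarrow> multiples (x * z) \<subseteq> multiples x"
  using multiples_h by (auto simp: multiples_def)

lemma multiples_of_nat: "multiples (of_nat n) = range (nat_mult n)"
  by (auto simp: multiples_def nat_mult_h)

end

section \<open>Cokernels of bidiagonal maps\<close>

text \<open>  The bidiagonal map \<open>bid\<close> below has diagonal \<open>q\<close> and off-diagonal \<open>a\<close>. The number \<open>v K\<close> is the
  length of the window on which \<open>\<alpha> l / \<alpha> K\<close> is used to define a functional modulo \<open>a K\<close>, and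
  \<open>p\<close> to the power \<open>f k\<close> is a multiple of the product of the first \<open>k\<close> diagonal entries. The
  relations of the cokernel involve \<open>a 1, a 2, \<dots>\<close>; the entry \<open>a 0\<close> is the modulus of the functional
  with index \<open>0\<close>.\<close>

locale bidiagonal = localized p h for p :: nat and h :: "rat \<Rightarrow> 'a::{comm_ring,comm_monoid_mult}" +
  fixes q a :: "nat \<Rightarrow> rat" and v f :: "nat \<Rightarrow> nat" and \<alpha> :: "nat \<Rightarrow> rat"
  defines "\<alpha> \<equiv> (\<lambda>k. \<Prod>j<k. - q j / a (Suc j))"
  assumes q: "q k \<in> Zp" "q k \<noteq> 0"
    and a: "a k \<in> Zp" "a k \<noteq> 0"
    and alpha_Zp: "\<alpha> k \<in> Zp"
    and alpha_small: "\<exists>N. \<forall>k\<ge>N. \<exists>z \<in> Zp. \<alpha> k = of_nat p ^ n * z"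
    and beta_Zp: "K \<le> l \<Longrightarrow> l \<le> K + v K \<Longrightarrow> \<alpha> l / \<alpha> K \<in> Zp"
    and beta_end: "q (K + v K) * \<alpha> (K + v K) / (\<alpha> K * a K) \<in> Zp"
    and v_less: "K < l \<Longrightarrow> l \<le> K + v K \<Longrightarrow> v l < v K"
    and f: "f 0 = 0" "strict_mono f"
    and q_prod: "of_nat p ^ f k / (\<Prod>j<k. q j) \<in> Zp"
begin

lemma alpha_0: "\<alpha> 0 = 1"
  by (simp add: \<alpha>_def)

lemma alpha_Suc: "\<alpha> (Suc k) * a (Suc k) = - q k * \<alpha> k"
  using a(2)[of "Suc k"] by (simp add: \<alpha>_def)

lemma alpha_nz: "\<alpha> k \<noteq> 0"
  using q(2) a(2) by (simp add: \<alpha>_def)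

definition bid :: "(nat \<Rightarrow> 'a) \<Rightarrow> nat \<Rightarrow> 'a" where
  "bid r k = h (q k) * r k + (if k = 0 then 0 else h (a k) * r (k - 1))"

text \<open>  Partial sums of the functional to the completion.\<close>

definition partial :: "(nat \<Rightarrow> 'a) \<Rightarrow> nat \<Rightarrow> 'a" where
  "partial c n = (\<Sum>l\<le>n. h (\<alpha> l) * c l)"

text \<open>  The functional to the residue ring modulo \<open>a K\<close>, supported on the window of \<open>K\<close>.\<close>

definition tors :: "nat \<Rightarrow> (nat \<Rightarrow> 'a) \<Rightarrow> 'a" where
  "tors K c = (\<Sum>j\<le>v K. h (\<alpha> (K + j) / \<alpha> K) * c (K + j))"

text \<open>  From this index on the partial sums are constant modulo \<open>p\<^sup>n\<close>. As it is at
  least \<open>n\<close>, the \<open>p\<close>-adic series constructed in \<open>partial_surj\<close> is correct modulo \<open>p\<^sup>n\<close> there.\<close>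

definition level :: "nat \<Rightarrow> nat" where
  "level n = max n (SOME N. \<forall>k\<ge>N. \<exists>z \<in> Zp. \<alpha> k = of_nat p ^ n * z)"

lemma level: "level n \<le> k \<Longrightarrow> \<exists>z \<in> Zp. \<alpha> k = of_nat p ^ n * z"
  using someI_ex[OF alpha_small[of n]] by (auto simp: level_def)

lemma level_ge: "n \<le> level n"
  by (simp add: level_def)

lemma Zp_qa: "q k * \<alpha> k \<in> Zp" "q k * \<alpha> k \<noteq> 0"
  using q alpha_Zp alpha_nz by (auto intro: Zp_mult)

lemma Zp_pn: "of_nat p ^ n \<in> Zp"
  by (intro Zp_power Zp_of_nat)

lemma partial_bid: "partial (bid r) n = h (q n * \<alpha> n) * r n"
proof (induction n)
  case 0
  show ?case using q by (simp add: partial_def bid_def alpha_0 h_one)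
next
  case (Suc n)
  have "partial (bid r) (Suc n) = h (q n * \<alpha> n) * r n + h (\<alpha> (Suc n)) * (h (q (Suc n)) * r (Suc n) + h (a (Suc n)) * r n)"
    using Suc by (simp add: partial_def bid_def)
  also have "h (\<alpha> (Suc n)) * (h (q (Suc n)) * r (Suc n) + h (a (Suc n)) * r n) =
      h (q (Suc n) * \<alpha> (Suc n)) * r (Suc n) + h (\<alpha> (Suc n) * a (Suc n)) * r n"
    using q a alpha_Zp by (simp add: h_mult algebra_simps)
  also have "h (\<alpha> (Suc n) * a (Suc n)) = - h (q n * \<alpha> n)"
    unfolding alpha_Suc using h_minus[OF Zp_qa(1)[of n]] by simp
  finally show ?case by simp
qed

lemma partial_stable: "level n \<le> N \<Longrightarrow> partial c N - partial c (level n) \<in> multiples (of_nat p ^ n)"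
proof (induction N rule: dec_induct)
  case (step N)
  then obtain z where z: "z \<in> Zp" "\<alpha> (Suc N) = of_nat p ^ n * z" using level[of n "Suc N"] by auto
  have "partial c (Suc N) - partial c (level n) = (partial c N - partial c (level n)) + h (\<alpha> (Suc N)) * c (Suc N)"
    by (simp add: partial_def)
  moreover have "h (\<alpha> (Suc N)) * c (Suc N) \<in> multiples (of_nat p ^ n)"
    unfolding z(2) by (rule multiples_h[OF Zp_pn z(1)])
  ultimately show ?case using step.IH by (simp only: multiples_add)
qed (simp add: multiples_zero)

lemma partial_bid_level: "partial (bid r) (level n) \<in> multiples (of_nat p ^ n)"
proof -
  obtain z where z: "z \<in> Zp" "\<alpha> (level n) = of_nat p ^ n * z" using level[of n "level n"] by auto
  have "q (level n) * \<alpha> (level n) = of_nat p ^ n * (q (level n) * z)" using z by simp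
  then show ?thesis unfolding partial_bid by (simp only: multiples_h[OF Zp_pn Zp_mult[OF q(1) z(1)]])
qed

text \<open>  The sum over the window telescopes; the lower end contributes a multiple of \<open>a K\<close>, the upper
  end is one by \<open>beta_end\<close>.\<close>

lemma tors_bid:
  assumes "1 \<le> K"
  shows "tors K (bid r) \<in> multiples (a K)"
proof -
  define b where "b j = \<alpha> (K + j) / \<alpha> K" for j
  have b: "b j \<in> Zp" if "j \<le> v K" for j using beta_Zp[of K "K + j"] that by (simp add: b_def)
  have b0: "b 0 = 1" using alpha_nz by (simp add: b_def)
  have bS: "b (Suc j) * a (K + Suc j) = - (q (K + j) * b j)" for j
    using alpha_Suc[of "K + j"] by (simp add: b_def field_simps)
  have "(\<Sum>j\<le>n. h (b j) * bid r (K + j)) = h (q (K + n) * b n) * r (K + n) + h (a K) * r (K - 1)" if "n \<le> v K" for n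
    using that
  proof (induction n)
    case 0
    show ?case using assms by (simp add: b0 h_one bid_def)
  next
    case (Suc n)
    have "h (b (Suc n)) * bid r (K + Suc n) = h (q (K + Suc n) * b (Suc n)) * r (K + Suc n) + h (b (Suc n) * a (K + Suc n)) * r (K + n)"
      using b[of "Suc n"] Suc.prems q(1)[of "K + Suc n"] a(1)[of "K + Suc n"] by (simp add: bid_def h_mult algebra_simps)
    moreover have "h (b (Suc n) * a (K + Suc n)) = - h (q (K + n) * b n)"
      unfolding bS using Suc.prems b[of n] q(1)[of "K + n"] by (intro h_minus Zp_mult) auto
    ultimately show ?case using Suc by simp
  qed
  then have 1: "tors K (bid r) = h (q (K + v K) * b (v K)) * r (K + v K) + h (a K) * r (K - 1)"
    unfolding tors_def b_def by blast
  define z where "z = q (K + v K) * \<alpha> (K + v K) / (\<alpha> K * a K)"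
  have "z \<in> Zp" unfolding z_def by (rule beta_end)
  moreover have "q (K + v K) * b (v K) = a K * z" using a(2)[of K] alpha_nz[of K] by (simp add: b_def z_def)
  ultimately have "h (q (K + v K) * b (v K)) * r (K + v K) \<in> multiples (a K)"
    by (simp only: multiples_h[OF a(1)])
  moreover have "h (a K) * r (K - 1) \<in> multiples (a K)" by (rule multiplesI) (rule refl)
  ultimately show ?thesis unfolding 1 by (rule multiples_add)
qed

text \<open>  The partial sums at both ends of the window of \<open>K\<close> differ by \<open>\<alpha> K\<close> times \<open>tors K\<close>. So if
  \<open>tors K c\<close> is divisible by \<open>a K\<close>, then they agree modulo \<open>\<alpha> K * a K\<close>, that is, modulo
  \<open>q (K - 1) * \<alpha> (K - 1)\<close>.\<close>

lemma partial_tors: "partial c (Suc k + v (Suc k)) = partial c k + h (\<alpha> (Suc k)) * tors (Suc k) c"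
proof -
  let ?K = "Suc k"
  have "partial c (?K + n) = partial c k + (\<Sum>j\<le>n. h (\<alpha> (?K + j)) * c (?K + j))" for n
    by (induction n) (simp_all add: partial_def)
  moreover have "(\<Sum>j\<le>v ?K. h (\<alpha> (?K + j)) * c (?K + j)) = h (\<alpha> ?K) * tors ?K c"
    unfolding tors_def sum_distrib_left
  proof (intro sum.cong refl)
    fix j assume "j \<in> {..v ?K}"
    then have "\<alpha> (?K + j) / \<alpha> ?K \<in> Zp" by (intro beta_Zp) auto
    then have "h (\<alpha> ?K * (\<alpha> (?K + j) / \<alpha> ?K)) = h (\<alpha> ?K) * h (\<alpha> (?K + j) / \<alpha> ?K)"
      using alpha_Zp by (rule h_mult[rotated])
    then show "h (\<alpha> (?K + j)) * c (?K + j) = h (\<alpha> ?K) * (h (\<alpha> (?K + j) / \<alpha> ?K) * c (?K + j))"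
      using alpha_nz[of ?K] by (simp add: mult.assoc)
  qed
  ultimately show ?thesis by simp
qed

text \<open>  Jumping from one window to the next keeps the partial sum fixed modulo \<open>q k * \<alpha> k\<close>. After
  enough jumps it is divisible by any given power of \<open>p\<close>, as it tends to zero.\<close>

lemma partial_divisible:
  assumes lim: "\<And>n. partial c (level n) \<in> multiples (of_nat p ^ n)"
    and tors: "\<And>K. 1 \<le> K \<Longrightarrow> tors K c \<in> multiples (a K)"
  shows "partial c k \<in> multiples (q k * \<alpha> k)"
proof -
  define g where "g k = Suc k + v (Suc k)" for k
  have step: "partial c (g k) - partial c k \<in> multiples (q k * \<alpha> k)" for k
  proof -
    obtain s where s: "tors (Suc k) c = h (a (Suc k)) * s" using tors[of "Suc k"] by (auto simp: multiples_def)
    have "partial c (g k) - partial c k = h (\<alpha> (Suc k)) * (h (a (Suc k)) * s)"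
      unfolding g_def partial_tors s by simp
    also have "\<dots> = h (\<alpha> (Suc k) * a (Suc k)) * s" using a alpha_Zp by (simp add: h_mult mult.assoc)
    also have "\<dots> = h (q k * \<alpha> k) * (- s)" unfolding alpha_Suc using h_minus[OF Zp_qa(1)[of k]] by simp
    finally show ?thesis by (rule multiplesI)
  qed
  have stepq: "\<exists>z \<in> Zp. q (g k) * \<alpha> (g k) = q k * \<alpha> k * z" for k
  proof -
    define z where "z = q (g k) * \<alpha> (g k) / (\<alpha> (Suc k) * a (Suc k))"
    have "z \<in> Zp" using beta_end[of "Suc k"] by (simp add: z_def g_def)
    moreover have "q (g k) * \<alpha> (g k) = q k * \<alpha> k * (- z)"
    proof -
      have "q (g k) * \<alpha> (g k) = (\<alpha> (Suc k) * a (Suc k)) * z" using a(2) alpha_nz by (simp add: z_def)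
      then show ?thesis unfolding alpha_Suc by simp
    qed
    ultimately show ?thesis using Zp_minus by blast
  qed
  have iter: "k + j \<le> (g ^^ j) k \<and> partial c ((g ^^ j) k) - partial c k \<in> multiples (q k * \<alpha> k) \<and>
      (\<exists>z \<in> Zp. q ((g ^^ j) k) * \<alpha> ((g ^^ j) k) = q k * \<alpha> k * z)" for j
  proof (induction j)
    case 0
    show ?case using Zp_one by (auto simp: multiples_zero intro!: bexI[of _ 1])
  next
    case (Suc j)
    let ?l = "(g ^^ j) k"
    obtain z where z: "z \<in> Zp" "q ?l * \<alpha> ?l = q k * \<alpha> k * z" using Suc by blast
    obtain z' where z': "z' \<in> Zp" "q (g ?l) * \<alpha> (g ?l) = q ?l * \<alpha> ?l * z'" using stepq by blast
    have "partial c (g ?l) - partial c ?l \<in> multiples (q k * \<alpha> k)"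
      using step[of ?l] multiples_mono[OF Zp_qa(1)[of k] z(1)] z(2) by auto
    then have "partial c (g ?l) - partial c ?l + (partial c ?l - partial c k) \<in> multiples (q k * \<alpha> k)"
      using Suc by (intro multiples_add) auto
    moreover have "q (g ?l) * \<alpha> (g ?l) = q k * \<alpha> k * (z * z')" using z z' by simp
    moreover have "z * z' \<in> Zp" using z z' by (intro Zp_mult)
    moreover have "k + Suc j \<le> g ?l"
    proof -
      have "k + j \<le> ?l" using Suc by blast
      moreover have "Suc ?l \<le> g ?l" unfolding g_def by simp
      ultimately show ?thesis by linarith
    qed
    ultimately show ?case by auto
  qed
  obtain n z where z: "z \<in> Zp" "of_nat p ^ n = q k * \<alpha> k * z"
    using divides_prime_power[OF Zp_qa[of k]] by blast
  let ?N = "(g ^^ level n) k"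
  have "level n \<le> ?N" using iter[of "level n"] by simp
  then have "partial c ?N - partial c (level n) + partial c (level n) \<in> multiples (of_nat p ^ n)"
    using lim by (intro multiples_add partial_stable)
  then have "partial c ?N \<in> multiples (q k * \<alpha> k)"
    using multiples_mono[OF Zp_qa(1)[of k] z(1)] z(2) by auto
  moreover have "partial c ?N - partial c k \<in> multiples (q k * \<alpha> k)" using iter by blast
  ultimately show ?thesis using multiples_diff[of "partial c ?N" _ "partial c ?N - partial c k"] by simp
qed

text \<open>  The \<open>k\<close>-th coordinate of a preimage is the quotient of \<open>partial c k\<close> by \<open>q k * \<alpha> k\<close>, as
  \<open>partial_bid\<close> forces.\<close>

lemma kernel:
  assumes lim: "\<And>n. partial c (level n) \<in> multiples (of_nat p ^ n)"
    and tors: "\<And>K. 1 \<le> K \<Longrightarrow> tors K c \<in> multiples (a K)"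
  shows "\<exists>r. \<forall>k. c k = bid r k"
proof -
  have "\<forall>k. \<exists>s. partial c k = h (q k * \<alpha> k) * s"
    using partial_divisible[OF assms] by (auto simp: multiples_def)
  then obtain e where e: "\<And>k. partial c k = h (q k * \<alpha> k) * e k" by metis
  have "h (\<alpha> k) * c k = h (\<alpha> k) * bid e k" for k
  proof -
    have "partial (bid e) k = partial c k" for k unfolding partial_bid e ..
    then have "partial (bid e) k - (if k = 0 then 0 else partial (bid e) (k - 1)) =
        partial c k - (if k = 0 then 0 else partial c (k - 1))" by simp
    then show ?thesis by (cases k) (simp_all add: partial_def)
  qed
  then have "c k = bid e k" for k using h_cancel[OF alpha_Zp alpha_nz] by blast
  then show ?thesis by blast
qed

text \<open>  The window of \<open>K\<close> contains beyond \<open>K\<close> only indices with smaller \<open>v\<close>, so the triangular system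
  can be solved by recursion on \<open>v\<close>, although it extends infinitely far upwards.\<close>

lemma tors_surj: "\<exists>c. \<forall>K. tors K c = s K"
proof -
  define F where "F c K = s K - (\<Sum>j<v K. h (\<alpha> (K + Suc j) / \<alpha> K) * c (K + Suc j))" for c :: "nat \<Rightarrow> 'a" and K
  define c where "c = wfrec (measure v) F"
  have c: "c K = F c K" for K
  proof -
    have "c K = F (cut c (measure v) K) K" unfolding c_def by (rule wfrec) simp
    also have "\<dots> = F c K" unfolding F_def
      by (intro arg_cong2[where f = "(-)"] sum.cong refl arg_cong2[where f = "(*)"] cut_apply)
        (auto intro!: v_less)
    finally show ?thesis .
  qed
  have "tors K c = s K" for K
  proof -
    have "tors K c = c K + (\<Sum>j<v K. h (\<alpha> (K + Suc j) / \<alpha> K) * c (K + Suc j))"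
      unfolding tors_def using alpha_nz[of K]
      by (simp add: lessThan_Suc_atMost[symmetric] sum.lessThan_Suc_shift h_one del: sum.lessThan_Suc)
    also have "\<dots> = s K" using c[of K] unfolding F_def by (rule eq_diff_eq[THEN iffD1])
    finally show ?thesis .
  qed
  then show ?thesis by blast
qed

text \<open>  A compatible family \<open>r\<close> is a \<open>p\<close>-adic series. Its terms are moved from \<open>y\<^sub>0\<close> to the generators
  \<open>y\<^sub>l\<close> by means of the relations: \<open>A l * y\<^sub>l\<close> is equivalent to \<open>E l * y\<^sub>0\<close>, where \<open>A\<close> and \<open>E\<close> are
  products of entries of the bidiagonal map. In this way only multiples of \<open>y\<^sub>0\<close> are represented,
  on which the functionals \<open>tors K\<close> vanish for \<open>K \<ge> 1\<close>.\<close>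

lemma partial_surj:
  assumes r: "\<And>n. r (Suc n) - r n \<in> multiples (of_nat p ^ n)"
  shows "\<exists>c. (\<forall>n. partial c (level n) - r n \<in> multiples (of_nat p ^ n)) \<and> (\<forall>K\<ge>1. tors K c \<in> multiples (a K))"
proof -
  have r_diff: "m \<le> n \<Longrightarrow> r n - r m \<in> multiples (of_nat p ^ m)" for m n
  proof (induction n rule: dec_induct)
    case (step n)
    have "of_nat p ^ n = of_nat p ^ m * (of_nat p ^ (n - m) :: rat)"
      using step by (simp add: power_add[symmetric])
    then have "r (Suc n) - r n \<in> multiples (of_nat p ^ m)"
      using r[of n] multiples_mono[OF Zp_pn Zp_pn] by auto
    then have "r (Suc n) - r n + (r n - r m) \<in> multiples (of_nat p ^ m)" using step.IH by (rule multiples_add)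
    then show ?case by simp
  qed (simp add: multiples_zero)
  define E where "E l = (\<Prod>j<l. - q j)" for l
  define A where "A l = (\<Prod>j<l. a (Suc j))" for l
  have E: "E l \<in> Zp" "E l \<noteq> 0" for l unfolding E_def using q by (auto intro!: Zp_prod Zp_minus)
  have A: "A l \<in> Zp" "A l \<noteq> 0" for l unfolding A_def using a by (auto intro!: Zp_prod)
  have \<alpha>: "\<alpha> l * A l = E l" for l
    unfolding \<alpha>_def A_def E_def prod.distrib[symmetric] using a(2) by (intro prod.cong) auto
  have Ef: "\<exists>z \<in> Zp. of_nat p ^ f l = E l * z" for l
  proof -
    have "E l = (-1) ^ l * (\<Prod>j<l. q j)"
      unfolding E_def using prod.distrib[of "\<lambda>_. -1" q "{..<l}"] by simp
    then have "of_nat p ^ f l = E l * ((-1) ^ l * (of_nat p ^ f l / (\<Prod>j<l. q j)))"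
      using q(2) by (simp add: power_mult_distrib[symmetric])
    moreover have "(-1) ^ l * (of_nat p ^ f l / (\<Prod>j<l. q j)) \<in> Zp"
      using q_prod by (intro Zp_mult Zp_power Zp_minus Zp_one)
    ultimately show ?thesis by blast
  qed
  have "\<exists>t. r (f (Suc l)) - (if l = 0 then 0 else r (f l)) = h (E l) * t" for l
  proof (cases "l = 0")
    case True
    then show ?thesis by (simp add: E_def h_one)
  next
    case False
    obtain z where z: "z \<in> Zp" "of_nat p ^ f l = E l * z" using Ef by blast
    have "r (f (Suc l)) - r (f l) \<in> multiples (E l)"
      using r_diff[of "f l" "f (Suc l)"] strict_monoD[OF f(2), of l "Suc l"] multiples_mono[OF E(1) z(1)] z(2) by fastforce
    then show ?thesis using False by (auto simp: multiples_def)
  qed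
  then obtain t where t: "\<And>l. r (f (Suc l)) - (if l = 0 then 0 else r (f l)) = h (E l) * t l" by metis
  define c where "c l = h (A l) * t l" for l
  have ac: "h (\<alpha> l) * c l = h (E l) * t l" for l
    unfolding c_def \<alpha>[of l, symmetric] using alpha_Zp A by (simp add: h_mult mult.assoc)
  have part: "partial c n = r (f (Suc n))" for n
  proof (induction n)
    case 0
    show ?case using t[of 0] ac[of 0] by (simp add: partial_def)
  next
    case (Suc n)
    then show ?case using t[of "Suc n"] ac[of "Suc n"] by (simp add: partial_def algebra_simps)
  qed
  have "partial c (level n) - r n \<in> multiples (of_nat p ^ n)" for n
  proof -
    have "level n < f (Suc (level n))" using strict_mono_imp_increasing[OF f(2), of "Suc (level n)"] by simp
    then show ?thesis unfolding part using level_ge[of n] by (intro r_diff) simp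
  qed
  moreover have "tors K c \<in> multiples (a K)" if K: "1 \<le> K" for K
    unfolding tors_def
  proof (rule multiples_sum)
    fix j assume "j \<in> {..v K}"
    then have b: "\<alpha> (K + j) / \<alpha> K \<in> Zp" by (intro beta_Zp) auto
    obtain k where k: "K = Suc k" using K by (cases K) auto
    define y where "y = A k * (\<Prod>i<j. - q (K + i))"
    have y: "y \<in> Zp" unfolding y_def using A q by (intro Zp_mult Zp_prod Zp_minus)
    have "E (K + j) = E K * (\<Prod>i<j. - q (K + i))"
      unfolding E_def by (induction j) (simp_all add: mult.assoc)
    then have "\<alpha> (K + j) * A (K + j) = \<alpha> K * A K * (\<Prod>i<j. - q (K + i))" by (simp only: \<alpha>)
    then have "\<alpha> (K + j) / \<alpha> K * A (K + j) = A K * (\<Prod>i<j. - q (K + i))"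
      using alpha_nz[of K] by (simp add: field_simps)
    also have "A K = a K * A k" by (simp add: A_def k)
    finally have eq: "\<alpha> (K + j) / \<alpha> K * A (K + j) = a K * y" by (simp add: y_def)
    have "h (\<alpha> (K + j) / \<alpha> K) * c (K + j) = h (\<alpha> (K + j) / \<alpha> K * A (K + j)) * t (K + j)"
      unfolding c_def using h_mult[OF b A(1)] by (simp add: mult.assoc)
    then show "h (\<alpha> (K + j) / \<alpha> K) * c (K + j) \<in> multiples (a K)"
      unfolding eq using multiples_h[OF a(1) y] by simp
  qed
  ultimately show ?thesis by blast
qed

end

section \<open>The cokernel as a product\<close>

abbreviation residue :: "nat \<Rightarrow> 'a \<Rightarrow> 'a::{comm_ring,comm_monoid_mult} set" where
  "residue n r \<equiv> (+) r ` range (nat_mult n)"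

lemma submodule_closed_multiples: "submodule_closed (*) (range (nat_mult n :: 'a \<Rightarrow> 'a::{comm_ring,comm_monoid_mult}))"
proof -
  have 1: "nat_mult n r - nat_mult n s = nat_mult n (r - s)" for r s :: 'a
    by (induction n) (simp_all add: algebra_simps)
  have 2: "t * nat_mult n r = nat_mult n (t * r)" for r t :: 'a
    by (induction n) (simp_all add: algebra_simps)
  have 3: "0 = nat_mult n (0 :: 'a)" by (induction n) simp_all
  show ?thesis unfolding submodule_closed_def using 1 2 3 by auto
qed

lemma ring_mod_simps:
  fixes r s t :: "'a::{comm_ring,comm_monoid_mult}"
  shows "carrier (ring_mod n :: ('a, 'a set) module) = range (residue n)"
  "residue n r \<oplus>\<^bsub>ring_mod n\<^esub> residue n s = residue n (r + s)"
  "t \<odot>\<^bsub>ring_mod n\<^esub> residue n r = residue n (t * r)"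
  "residue n r = residue n s \<longleftrightarrow> r - s \<in> range (nat_mult n)"
proof -
  note V = submodule_closed_multiples[of n, where 'a = 'a]
  show "carrier (ring_mod n :: ('a, 'a set) module) = range (residue n)"
    by (simp add: ring_mod_def quotient_module_def)
  show "residue n r \<oplus>\<^bsub>ring_mod n\<^esub> residue n s = residue n (r + s)"
    unfolding ring_mod_def quotient_module_def by simp (rule coset_add[OF V])
  show "t \<odot>\<^bsub>ring_mod n\<^esub> residue n r = residue n (t * r)"
    unfolding ring_mod_def quotient_module_def by simp (rule coset_scale[OF V distrib_left])
  show "residue n r = residue n s \<longleftrightarrow> r - s \<in> range (nat_mult n)"
    by (rule coset_eq_iff[OF V])
qed

lemma residue_in_range: "residue n r \<in> range (residue n)"
  by (rule rangeI)

lemma prod_module_simps: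
  "carrier (M \<times>\<^sub>m N) = carrier M \<times> carrier N"
  "x \<oplus>\<^bsub>M \<times>\<^sub>m N\<^esub> y = (fst x \<oplus>\<^bsub>M\<^esub> fst y, snd x \<oplus>\<^bsub>N\<^esub> snd y)"
  "r \<odot>\<^bsub>M \<times>\<^sub>m N\<^esub> x = (r \<odot>\<^bsub>M\<^esub> fst x, r \<odot>\<^bsub>N\<^esub> snd x)"
  by (simp_all add: prod_module_def)

lemma Prod_module_simps:
  "carrier (Prod_module Ms) = {x. \<forall>k. x k \<in> carrier (Ms k)}"
  "y \<oplus>\<^bsub>Prod_module Ms\<^esub> z = (\<lambda>k. y k \<oplus>\<^bsub>Ms k\<^esub> z k)"
  "r \<odot>\<^bsub>Prod_module Ms\<^esub> y = (\<lambda>k. r \<odot>\<^bsub>Ms k\<^esub> y k)"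
  by (simp_all add: Prod_module_def)

lemma completion_simps:
  "carrier (completion p) = {x. (\<forall>k. x k \<in> carrier (ring_mod (p ^ k))) \<and> (\<forall>k. x (Suc k) \<subseteq> x k)}"
  "y \<oplus>\<^bsub>completion p\<^esub> z = (\<lambda>k. y k \<oplus>\<^bsub>ring_mod (p ^ k)\<^esub> z k)"
  "r \<odot>\<^bsub>completion p\<^esub> y = (\<lambda>k. r \<odot>\<^bsub>ring_mod (p ^ k)\<^esub> y k)"
  by (simp_all add: completion_def Prod_module_def)

context bidiagonal
begin

lemma partial_linear:
  "partial (\<lambda>k. c k + c' k) n = partial c n + partial c' n"
  "partial (\<lambda>k. c k - c' k) n = partial c n - partial c' n"
  "partial (\<lambda>k. r * c k) n = r * partial c n"
  by (simp_all add: partial_def sum.distrib sum_subtractf sum_distrib_left algebra_simps)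

lemma tors_linear:
  "tors K (\<lambda>k. c k + c' k) = tors K c + tors K c'"
  "tors K (\<lambda>k. c k - c' k) = tors K c - tors K c'"
  "tors K (\<lambda>k. r * c k) = r * tors K c"
  by (simp_all add: tors_def sum.distrib sum_subtractf sum_distrib_left algebra_simps)

lemma multiples_power: "multiples (of_nat p ^ k) = range (nat_mult (p ^ k))"
  using multiples_of_nat[of "p ^ k"] by simp

lemma residue_mono: "r - s \<in> multiples (of_nat p ^ k) \<Longrightarrow> residue (p ^ Suc k) r \<subseteq> residue (p ^ k) s"
proof
  fix x assume r: "r - s \<in> multiples (of_nat p ^ k)" and "x \<in> residue (p ^ Suc k) r"
  then obtain y where y: "y \<in> multiples (of_nat p ^ Suc k)" "x = r + y"
    unfolding multiples_power by blast
  have "y \<in> multiples (of_nat p ^ k)"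
    using y(1) multiples_mono[OF Zp_pn[of k] Zp_of_nat[of p]] by (auto simp: mult.commute)
  then have "(r - s) + y \<in> multiples (of_nat p ^ k)" using r by (intro multiples_add)
  then have m: "r - s + y \<in> range (nat_mult (p ^ k))" unfolding multiples_power .
  show "x \<in> residue (p ^ k) s"
    unfolding y(2) by (rule image_eqI[OF _ m]) simp
qed

text \<open>  For \<open>s = 1\<close> the factors are \<open>R / a\<^sub>1, R / a\<^sub>2, \<dots>\<close>. For \<open>s = 0\<close> there is in addition the factor
  \<open>R / a\<^sub>0\<close>, which is zero by the assumption \<open>unit\<close>.\<close>

lemma cokernel_iso:
  fixes A :: "nat \<Rightarrow> nat" and s :: nat
  assumes aA: "\<And>k. a k = of_nat (A k)" and s: "s = 0 \<or> s = 1"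
    and unit: "s = 0 \<Longrightarrow> multiples (a 0) = UNIV"
  defines "N \<equiv> completion p \<times>\<^sub>m Prod_module (\<lambda>k. ring_mod (A (k + s)) :: ('a, 'a set) module)"
  obtains F where
    "\<And>c. F c \<in> carrier N"
    "\<And>c c'. F (\<lambda>k. c k + c' k) = F c \<oplus>\<^bsub>N\<^esub> F c'"
    "\<And>r c. F (\<lambda>k. r * c k) = r \<odot>\<^bsub>N\<^esub> F c"
    "\<And>c c'. F c = F c' \<longleftrightarrow> (\<exists>r. \<forall>k. c k - c' k = bid r k)"
    "\<And>y. y \<in> carrier N \<Longrightarrow> \<exists>c. F c = y"
proof -
  define F where "F c = (\<lambda>k. residue (p ^ k) (partial c (level k)), \<lambda>k. residue (A (k + s)) (tors (k + s) c))" for c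
  have mA: "range (nat_mult (A k)) = multiples (a k)" for k using multiples_of_nat[of "A k"] aA by simp
  have compat: "partial c (level (Suc k)) - partial c (level k) \<in> multiples (of_nat p ^ k)" for c k
  proof -
    define M where "M = max (level k) (level (Suc k))"
    have "partial c M - partial c (level k) \<in> multiples (of_nat p ^ k)"
      by (rule partial_stable) (simp add: M_def)
    moreover have "partial c M - partial c (level (Suc k)) \<in> multiples (of_nat p ^ Suc k)"
      by (rule partial_stable) (simp add: M_def)
    then have "partial c M - partial c (level (Suc k)) \<in> multiples (of_nat p ^ k)"
      using multiples_mono[OF Zp_pn[of k] Zp_of_nat[of p]] by (auto simp: mult.commute)
    ultimately have "(partial c M - partial c (level k)) - (partial c M - partial c (level (Suc k))) \<in> multiples (of_nat p ^ k)"
      by (rule multiples_diff)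
    then show ?thesis by simp
  qed
  show ?thesis
  proof
    show "F c \<in> carrier N" for c
      using residue_mono[OF compat[of c]]
      by (simp add: F_def N_def prod_module_simps completion_simps Prod_module_simps ring_mod_simps(1) residue_in_range)
    show "F (\<lambda>k. c k + c' k) = F c \<oplus>\<^bsub>N\<^esub> F c'" for c c'
      by (simp add: F_def N_def prod_module_simps completion_simps Prod_module_simps ring_mod_simps(2) partial_linear tors_linear)
    show "F (\<lambda>k. r * c k) = r \<odot>\<^bsub>N\<^esub> F c" for r c
      by (simp add: F_def N_def prod_module_simps completion_simps Prod_module_simps ring_mod_simps(3) partial_linear tors_linear)
    show "F c = F c' \<longleftrightarrow> (\<exists>r. \<forall>k. c k - c' k = bid r k)" for c c'
    proof -
      let ?e = "\<lambda>k. c k - c' k"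
      have "F c = F c' \<longleftrightarrow> (\<forall>k. partial ?e (level k) \<in> multiples (of_nat p ^ k)) \<and> (\<forall>k. tors (k + s) ?e \<in> multiples (a (k + s)))"
        by (simp add: F_def fun_eq_iff ring_mod_simps(4) mA[symmetric] multiples_power partial_linear tors_linear)
      also have "(\<forall>k. tors (k + s) ?e \<in> multiples (a (k + s))) \<longleftrightarrow> (\<forall>K\<ge>1. tors K ?e \<in> multiples (a K))"
      proof (intro iffI allI impI)
        fix K :: nat assume "\<forall>k. tors (k + s) ?e \<in> multiples (a (k + s))" "1 \<le> K"
        then show "tors K ?e \<in> multiples (a K)" using s by (auto dest!: spec[of _ "K - s"])
      next
        fix k assume K: "\<forall>K\<ge>1. tors K ?e \<in> multiples (a K)"
        show "tors (k + s) ?e \<in> multiples (a (k + s))"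
          using K unit s by (cases "k + s = 0") auto
      qed
      also have "(\<forall>k. partial ?e (level k) \<in> multiples (of_nat p ^ k)) \<and> (\<forall>K\<ge>1. tors K ?e \<in> multiples (a K)) \<longleftrightarrow>
          (\<exists>r. \<forall>k. ?e k = bid r k)"
      proof
        assume "(\<forall>k. partial ?e (level k) \<in> multiples (of_nat p ^ k)) \<and> (\<forall>K\<ge>1. tors K ?e \<in> multiples (a K))"
        then show "\<exists>r. \<forall>k. ?e k = bid r k" using kernel[of ?e] by blast
      next
        assume "\<exists>r. \<forall>k. ?e k = bid r k"
        then obtain r where "?e = bid r" by blast
        then show "(\<forall>k. partial ?e (level k) \<in> multiples (of_nat p ^ k)) \<and> (\<forall>K\<ge>1. tors K ?e \<in> multiples (a K))"
          using partial_bid_level tors_bid by simp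
      qed
      finally show ?thesis .
    qed
    show "\<exists>c. F c = y" if y: "y \<in> carrier N" for y
    proof -
      obtain x z where xz: "y = (x, z)" by (cases y)
      have xr: "\<forall>k. x k \<in> range (residue (p ^ k))" and xs: "\<And>k. x (Suc k) \<subseteq> x k"
        and zr: "\<forall>k. z k \<in> range (residue (A (k + s)))"
        using y by (auto simp: xz N_def prod_module_simps completion_simps Prod_module_simps ring_mod_simps(1))
      have x: "\<forall>k. \<exists>r. x k = residue (p ^ k) r" using xr by (meson rangeE)
      have z: "\<forall>k. \<exists>r. z k = residue (A (k + s)) r" using zr by (meson rangeE)
      obtain r where r: "\<And>k. x k = residue (p ^ k) (r k)" using x by metis
      obtain t where t: "\<And>k. z k = residue (A (k + s)) (t k)" using z by metis
      obtain c1 where c1: "\<And>K. tors K c1 = t (K - s)" using tors_surj[of "\<lambda>K. t (K - s)"] by blast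
      have rr: "r (Suc k) - r k \<in> multiples (of_nat p ^ k)" for k
      proof -
        have "r (Suc k) + 0 \<in> x (Suc k)" unfolding r
          using submodule_closedD(1)[OF submodule_closed_multiples] by (rule imageI)
        then have "r (Suc k) \<in> residue (p ^ k) (r k)" using xs[of k] r[of k] by auto
        then show ?thesis unfolding multiples_power by auto
      qed
      define r' where "r' k = r k - partial c1 (level k)" for k
      have "r' (Suc k) - r' k \<in> multiples (of_nat p ^ k)" for k
        using multiples_diff[OF rr[of k] compat[of c1 k]] by (simp add: r'_def algebra_simps)
      then obtain c2 where c2: "\<And>k. partial c2 (level k) - r' k \<in> multiples (of_nat p ^ k)"
          "\<And>K. 1 \<le> K \<Longrightarrow> tors K c2 \<in> multiples (a K)"
        using partial_surj[of r'] by blast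
      have "residue (p ^ k) (partial (\<lambda>k. c1 k + c2 k) (level k)) = x k" for k
        unfolding r ring_mod_simps(4)
        using c2(1)[of k] by (simp add: multiples_power partial_linear r'_def algebra_simps)
      moreover have "residue (A (k + s)) (tors (k + s) (\<lambda>k. c1 k + c2 k)) = z k" for k
      proof -
        have "tors (k + s) c2 \<in> multiples (a (k + s))" using c2(2) unit s by (cases "k + s = 0") auto
        then show ?thesis unfolding t ring_mod_simps(4) unfolding mA by (simp add: tors_linear c1)
      qed
      ultimately have "F (\<lambda>k. c1 k + c2 k) = y" by (simp add: F_def xz)
      then show ?thesis by blast
    qed
  qed
qed

end

section \<open>Valuations in arithmetic progressions\<close>

lemma multiplicity_ge_dvd: "m \<le> multiplicity p n \<Longrightarrow> p ^ m dvd (n :: nat)"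
  by (rule multiplicity_dvd')

lemma prime_power_gt: "1 < p \<Longrightarrow> n < (p :: nat) ^ n"
  by (rule less_exp[THEN less_le_trans]) (auto intro: power_mono)

text \<open>  Legendre's formula would give \<open>n / (p - 1)\<close>. Only the multiples of \<open>p\<close> contribute, and dividing
  them by \<open>p\<close> gives an induction.\<close>

lemma sum_multiplicity_le:
  assumes "prime p" "odd (p :: nat)"
  shows "2 * (\<Sum>t=1..n. multiplicity p t) \<le> n"
proof (induction n rule: less_induct)
  case (less n)
  have p3: "3 \<le> p" using assms by (metis odd_numeral prime_ge_2_nat le_antisym not_less_eq_eq numeral_2_eq_2 numeral_3_eq_3 even_numeral)
  let ?m = "n div p"
  have "(\<Sum>t=1..n. multiplicity p t) = (\<Sum>t\<in>(\<lambda>u. p * u) ` {1..?m}. multiplicity p t)"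
  proof (rule sum.mono_neutral_right)
    show "(\<lambda>u. p * u) ` {1..?m} \<subseteq> {1..n}"
      using p3 by (auto simp: less_eq_div_iff_mult_less_eq mult.commute Suc_le_eq)
    show "\<forall>t\<in>{1..n} - (\<lambda>u. p * u) ` {1..?m}. multiplicity p t = 0"
    proof
      fix t assume t: "t \<in> {1..n} - (\<lambda>u. p * u) ` {1..?m}"
      have "\<not> p dvd t"
      proof
        assume "p dvd t"
        then obtain u where u: "t = p * u" by blast
        then have "u \<in> {1..?m}" using t p3 by (auto simp: less_eq_div_iff_mult_less_eq mult.commute Suc_le_eq)
        then show False using t u by blast
      qed
      then show "multiplicity p t = 0" by (rule not_dvd_imp_multiplicity_0)
    qed
  qed simp
  also have "\<dots> = (\<Sum>u=1..?m. multiplicity p (p * u))"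
    using p3 by (subst sum.reindex) (auto simp: inj_on_def)
  also have "\<dots> = (\<Sum>u=1..?m. Suc (multiplicity p u))"
    using p3 assms(1) by (intro sum.cong refl multiplicity_times_same) (auto)
  also have "\<dots> = ?m + (\<Sum>u=1..?m. multiplicity p u)" by (simp add: sum_Suc)
  finally have "2 * (\<Sum>t=1..n. multiplicity p t) = 2 * ?m + 2 * (\<Sum>u=1..?m. multiplicity p u)" by simp
  moreover have "2 * (\<Sum>u=1..?m. multiplicity p u) \<le> ?m"
  proof (cases "n = 0")
    case False
    then show ?thesis using p3 by (intro less.IH) auto
  qed simp
  moreover have "3 * ?m \<le> p * ?m" using p3 by simp
  moreover have "p * ?m \<le> n" by simp
  ultimately show ?case by linarith
qed

lemma multiplicity_progression_le:
  fixes A :: "nat \<Rightarrow> nat"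
  assumes p: "prime p" "odd p" and A: "A (K + j) = A K + 2 * j" "0 < A K" and j: "0 < j"
    and le: "e \<le> multiplicity p (A K)" "e \<le> multiplicity p (A (K + j))"
  shows "e \<le> multiplicity p j"
proof -
  have "p ^ e dvd A K + 2 * j" "p ^ e dvd A K" using le A by (metis multiplicity_ge_dvd)+
  then have "p ^ e dvd 2 * j" by (simp add: dvd_add_right_iff)
  moreover have "coprime (p ^ e) 2" using p by (simp add: coprime_commute prime_odd_nat primes_coprime)
  ultimately have "p ^ e dvd j" by (simp add: coprime_dvd_mult_right_iff)
  then show ?thesis using p j by (intro multiplicity_geI) auto
qed

text \<open>  Take \<open>J\<close> with \<open>A J\<close> of maximal valuation. If \<open>p\<^sup>e\<close> divides \<open>A j\<close>, then with \<open>e\<close> the valuation of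
  \<open>A j\<close> it divides \<open>A J\<close> too, hence \<open>2 (J - j)\<close>. So for \<open>j \<noteq> J\<close> the valuations are bounded by those of
  \<open>\<bar>J - j\<bar>\<close>.\<close>

lemma sum_multiplicity_progression:
  fixes A :: "nat \<Rightarrow> nat"
  assumes p: "prime p" "odd p" and A: "\<And>K j. 1 \<le> K \<Longrightarrow> A (K + j) = A K + 2 * j" "\<And>K. 1 \<le> K \<Longrightarrow> 0 < A K"
    and k: "1 \<le> k"
  obtains J where "1 \<le> J" "J \<le> k" "2 * (\<Sum>j=1..k. multiplicity p (A j)) + 1 \<le> k + 2 * multiplicity p (A J)"
proof -
  have "\<exists>J\<in>{1..k}. \<forall>j\<in>{1..k}. multiplicity p (A j) \<le> multiplicity p (A J)"
  proof -
    have ne: "finite ((\<lambda>j. multiplicity p (A j)) ` {1..k})" "(\<lambda>j. multiplicity p (A j)) ` {1..k} \<noteq> {}"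
      using k by auto
    have "Max ((\<lambda>j. multiplicity p (A j)) ` {1..k}) \<in> (\<lambda>j. multiplicity p (A j)) ` {1..k}"
      using Max_in[OF ne] .
    then obtain J where "J \<in> {1..k}" "Max ((\<lambda>j. multiplicity p (A j)) ` {1..k}) = multiplicity p (A J)" by blast
    then show ?thesis using Max_ge[OF ne(1)] by (intro bexI[of _ J]) auto
  qed
  then obtain J where J: "J \<in> {1..k}" "\<And>j. j \<in> {1..k} \<Longrightarrow> multiplicity p (A j) \<le> multiplicity p (A J)" by blast
  have low: "multiplicity p (A j) \<le> multiplicity p (J - j)" if "j \<in> {1..<J}" for j
  proof (rule multiplicity_progression_le[OF p, of A j "J - j"])
    show "A (j + (J - j)) = A j + 2 * (J - j)" by (rule A(1)) (use that in simp)
    show "0 < A j" by (rule A(2)) (use that in simp)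
    show "multiplicity p (A j) \<le> multiplicity p (A (j + (J - j)))" using J(1) J(2)[of j] that by simp
  qed (use that in auto)
  have high: "multiplicity p (A j) \<le> multiplicity p (j - J)" if "j \<in> {J<..k}" for j
  proof (rule multiplicity_progression_le[OF p, of A J "j - J"])
    show "A (J + (j - J)) = A J + 2 * (j - J)" by (rule A(1)) (use J(1) in simp)
    show "0 < A J" by (rule A(2)) (use J(1) in simp)
    show "multiplicity p (A j) \<le> multiplicity p (A (J + (j - J)))" using that by simp
    show "multiplicity p (A j) \<le> multiplicity p (A J)" using J(1) J(2)[of j] that by simp
  qed (use that in auto)
  have "(\<Sum>j=1..k. multiplicity p (A j)) = (\<Sum>j\<in>{1..<J} \<union> {J} \<union> {J<..k}. multiplicity p (A j))"
    using J(1) by (intro sum.cong) auto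
  also have "\<dots> = (\<Sum>j\<in>{1..<J}. multiplicity p (A j)) + multiplicity p (A J) + (\<Sum>j\<in>{J<..k}. multiplicity p (A j))"
    by (subst sum.union_disjoint; (subst sum.union_disjoint)?) auto
  finally have eq: "(\<Sum>j=1..k. multiplicity p (A j)) = (\<Sum>j\<in>{1..<J}. multiplicity p (A j)) + multiplicity p (A J) + (\<Sum>j\<in>{J<..k}. multiplicity p (A j))" .
  have "(\<Sum>j\<in>{1..<J}. multiplicity p (A j)) \<le> (\<Sum>j\<in>{1..<J}. multiplicity p (J - j))"
    by (rule sum_mono) (rule low)
  also have "\<dots> = (\<Sum>t=1..J - 1. multiplicity p t)"
    by (rule sum.reindex_bij_witness[of _ "\<lambda>t. J - t" "\<lambda>j. J - j"]) auto
  finally have 1: "2 * (\<Sum>j\<in>{1..<J}. multiplicity p (A j)) \<le> J - 1"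
    using sum_multiplicity_le[OF p, of "J - 1"] by linarith
  have "(\<Sum>j\<in>{J<..k}. multiplicity p (A j)) \<le> (\<Sum>j\<in>{J<..k}. multiplicity p (j - J))"
    by (rule sum_mono) (rule high)
  also have "\<dots> = (\<Sum>t=1..k - J. multiplicity p t)"
    by (rule sum.reindex_bij_witness[of _ "\<lambda>t. t + J" "\<lambda>j. j - J"]) auto
  finally have 2: "2 * (\<Sum>j\<in>{J<..k}. multiplicity p (A j)) \<le> k - J"
    using sum_multiplicity_le[OF p, of "k - J"] by linarith
  show ?thesis using that[of J] J(1) 1 2 eq by auto
qed

section \<open>The bidiagonal map of the small complex\<close>

context localized
begin

lemma prime_power_div:
  assumes "0 < X" "multiplicity p X \<le> e"
  shows "of_nat p ^ e / of_nat X \<in> Zp"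
proof -
  have pu: "\<not> is_unit p" using prime by auto
  obtain u where u: "X = p ^ multiplicity p X * u" "\<not> p dvd u"
    using multiplicity_decompose'[of X p] assms(1) pu by blast
  have "p \<noteq> 0" "u \<noteq> 0" using prime u(2) by (auto intro: Nat.gr0I)
  have "of_nat p ^ e / of_nat X = (of_nat p ^ (e - multiplicity p X) / of_nat u :: rat)"
  proof -
    have "of_nat p ^ e = (of_nat p ^ (e - multiplicity p X) * of_nat p ^ multiplicity p X :: rat)"
      using assms(2) by (simp add: power_add[symmetric])
    moreover have "(of_nat X :: rat) = of_nat p ^ multiplicity p X * of_nat u"
      using u(1) by (metis of_nat_mult of_nat_power)
    ultimately show ?thesis using \<open>p \<noteq> 0\<close> by simp
  qed
  also have "\<dots> = of_nat p ^ (e - multiplicity p X) * (of_int 1 / of_nat u)" by simp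
  also have "\<dots> \<in> Zp" using u(2) by (intro Zp_mult Zp_power Zp_of_nat Zp_frac)
  finally show ?thesis .
qed

end

text \<open>  In degree \<open>i > 0\<close> these are the odd numbers \<open>i - 1, i + 1, \<dots>\<close>. For \<open>i = 0\<close> the sequence
  \<open>1, 3, \<dots>\<close> starts at \<open>k = 1\<close>, and the value at \<open>0\<close> is chosen to be a unit.\<close>

definition index :: "nat \<Rightarrow> nat \<Rightarrow> nat" where
  "index i k = (if k = 0 then (if i = 0 then 1 else i - 1) else i + 2 * k - 1)"

definition offdiag :: "nat \<Rightarrow> nat \<Rightarrow> nat \<Rightarrow> rat" where
  "offdiag p i k = (if i = 0 \<and> k = 0 then of_nat p else of_nat p ^ 2 / 2)"

lemma index_add: "1 \<le> K \<Longrightarrow> index i (K + j) = index i K + 2 * j"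
  by (simp add: index_def)

text \<open>  The last assumption says that \<open>\<alpha> k\<close> has enough factors \<open>p\<close>. The first diagonal entry for
  \<open>i = 0\<close> is \<open>p\<close> instead of \<open>p\<^sup>2 / 2\<close>, which costs one factor.\<close>

locale progression = localized p h for p :: nat and h :: "rat \<Rightarrow> 'a::{comm_ring,comm_monoid_mult}" +
  fixes i :: nat
  assumes odd: "odd p"
    and unit: "\<not> p dvd index i 0"
    and index_pos: "0 < index i 0"
    and multiplicity_index: "1 \<le> j \<Longrightarrow> multiplicity p (index i j) + (if i = 0 then 1 else 0) \<le> j"
begin

abbreviation "v \<equiv> (\<lambda>k. multiplicity p (index i k))"
abbreviation "f \<equiv> (\<lambda>k::nat. 2 * k - (if i = 0 then 1 else 0) :: nat)"

lemma index_gt: "0 < index i k"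
  using index_pos by (cases "k = 0") (auto simp: index_def)

lemma offdiag_prod: "(\<Prod>j<k. offdiag p i j) = of_nat p ^ f k * (1 / 2) ^ (k - (if i = 0 then 1 else 0))"
proof (induction k)
  case (Suc k)
  then show ?case
    by (cases "i = 0"; cases k) (simp_all add: offdiag_def power2_eq_square)
qed simp

lemma half_Zp: "1 / 2 \<in> Zp"
proof -
  have "\<not> p dvd 2" using odd prime by (metis even_numeral primes_dvd_imp_eq two_is_prime_nat)
  then show ?thesis using Zp_frac[of 2 1] by simp
qed

lemma prod_quotient:
  assumes "finite I" "(\<Sum>j\<in>I. v j) \<le> e"
  shows "of_nat p ^ e / of_nat (\<Prod>j\<in>I. index i j) \<in> Zp"
proof (rule prime_power_div)
  show "0 < (\<Prod>j\<in>I. index i j)" using index_gt by (simp add: prod_pos)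
  have "multiplicity p (\<Prod>j\<in>I. index i j) = (\<Sum>j\<in>I. v j)"
    using assms(1) prime index_gt by (intro prime_elem_multiplicity_prod_distrib) (auto simp: image_iff)
  then show "multiplicity p (\<Prod>j\<in>I. index i j) \<le> e" using assms(2) by simp
qed

definition "\<alpha> = (\<lambda>k. \<Prod>j<k. - offdiag p i j / of_nat (index i (Suc j)))"

lemma alpha_eq: "\<alpha> k = (-1) ^ k * (1 / 2) ^ (k - (if i = 0 then 1 else 0)) * (of_nat p ^ f k / of_nat (\<Prod>j=1..k. index i j))"
proof -
  have "\<alpha> k = (\<Prod>j<k. (-1) * (offdiag p i j * (1 / of_nat (index i (Suc j)))))"
    unfolding \<alpha>_def by (intro prod.cong) auto
  also have "\<dots> = (-1) ^ k * ((\<Prod>j<k. offdiag p i j) * (\<Prod>j<k. 1 / of_nat (index i (Suc j))))"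
    by (simp only: prod.distrib prod_constant card_lessThan)
  also have "(\<Prod>j<k. 1 / of_nat (index i (Suc j)) :: rat) = 1 / of_nat (\<Prod>j=1..k. index i j)"
    by (simp add: prod_dividef prod.atLeast1_atMost_eq)
  finally show ?thesis unfolding offdiag_prod by simp
qed

text \<open>  The margin of \<open>k + 1\<close> makes \<open>\<alpha> k\<close> tend to zero.\<close>

lemma sum_v:
  assumes "1 \<le> k"
  shows "2 * (\<Sum>j=1..k. v j) + k + 1 \<le> 2 * f k"
proof -
  obtain J where J: "1 \<le> J" "J \<le> k" "2 * (\<Sum>j=1..k. v j) + 1 \<le> k + 2 * v J"
    using sum_multiplicity_progression[OF prime odd, of "index i" k] index_add index_gt assms by metis
  show ?thesis using multiplicity_index[OF J(1)] J assms by (cases "i = 0") auto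
qed

lemma alpha_div: "2 * n \<le> k \<Longrightarrow> \<exists>z \<in> Zp. \<alpha> k = of_nat p ^ n * z"
proof -
  assume n: "2 * n \<le> k"
  have le: "n + (\<Sum>j=1..k. v j) \<le> f k"
  proof (cases "k = 0")
    case False
    then show ?thesis using sum_v[of k] n by simp
  qed (use n in simp)
  have "of_nat p ^ f k = (of_nat p ^ n * of_nat p ^ (f k - n) :: rat)"
  proof -
    have "n \<le> f k" using le by linarith
    then show ?thesis by (metis power_add le_add_diff_inverse)
  qed
  then have "\<alpha> k = of_nat p ^ n * ((-1) ^ k * (1 / 2) ^ (k - (if i = 0 then 1 else 0)) * (of_nat p ^ (f k - n) / of_nat (\<Prod>j=1..k. index i j)))"
    unfolding alpha_eq by simp
  moreover have "(-1) ^ k * (1 / 2) ^ (k - (if i = 0 then 1 else 0)) * (of_nat p ^ (f k - n) / of_nat (\<Prod>j=1..k. index i j)) \<in> Zp"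
    using le by (intro Zp_mult Zp_power half_Zp Zp_minus Zp_one prod_quotient) auto
  ultimately show ?thesis by blast
qed

lemma alpha_quotient:
  assumes "1 \<le> K"
  shows "\<alpha> (K + n) / \<alpha> K = (-1) ^ n * (1 / 2) ^ n * (of_nat p ^ (2 * n) / of_nat (\<Prod>j\<in>{K<..K + n}. index i j))"
proof (induction n)
  case 0
  have "\<alpha> K \<noteq> 0" using index_gt prime by (simp add: \<alpha>_def offdiag_def)
  then show ?case by simp
next
  case (Suc n)
  have "{K<..K + Suc n} = insert (K + Suc n) {K<..K + n}" by auto
  moreover have "\<alpha> (K + Suc n) = \<alpha> (K + n) * (- (of_nat p ^ 2 / 2) / of_nat (index i (K + Suc n)))"
    using assms by (simp add: \<alpha>_def offdiag_def)
  moreover have "\<alpha> (K + n) * (- (of_nat p ^ 2 / 2) / of_nat (index i (K + Suc n))) / \<alpha> K =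
      \<alpha> (K + n) / \<alpha> K * (- (of_nat p ^ 2 / 2) / of_nat (index i (K + Suc n)))" by simp
  ultimately show ?case unfolding Suc by (simp add: power2_eq_square mult_ac)
qed

text \<open>  An index \<open>l\<close> violating this would give a multiple \<open>l - K\<close> of \<open>p\<close> to the power \<open>v K\<close> that is at
  most \<open>v K\<close>.\<close>

lemma v_less: "K < l \<Longrightarrow> l \<le> K + v K \<Longrightarrow> v l < v K"
proof (rule ccontr)
  assume l: "K < l" "l \<le> K + v K" "\<not> v l < v K"
  have "v 0 = 0" using unit by (rule not_dvd_imp_multiplicity_0)
  then have K: "1 \<le> K" using l by (cases K) auto
  have "v K \<le> multiplicity p (l - K)"
    using multiplicity_progression_le[OF prime odd, of "index i" K "l - K" "v K"] index_add[OF K, of i "l - K"] index_gt l by auto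
  then have "p ^ v K dvd l - K" by (rule multiplicity_ge_dvd)
  then have "p ^ v K \<le> l - K" using l by (intro dvd_imp_le) auto
  moreover have "v K < p ^ v K" using prime by (intro prime_power_gt prime_gt_1_nat)
  ultimately show False using l by linarith
qed

text \<open>  Within its window, \<open>K\<close> has the largest valuation, so that the other ones are bounded by the
  valuations of \<open>1, \<dots>, n\<close>.\<close>

lemma sum_v_window:
  assumes "1 \<le> K" "n \<le> v K"
  shows "(\<Sum>j\<in>{K<..K + n}. v j) \<le> n"
proof -
  have "(\<Sum>j\<in>{K<..K + n}. v j) \<le> (\<Sum>j\<in>{K<..K + n}. multiplicity p (j - K))"
  proof (rule sum_mono)
    fix j assume j: "j \<in> {K<..K + n}"
    then have "v j < v K" using assms by (intro v_less) auto
    then show "v j \<le> multiplicity p (j - K)"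
      using multiplicity_progression_le[OF prime odd, of "index i" K "j - K" "v j"] index_add[OF assms(1), of i "j - K"] index_gt j by auto
  qed
  also have "\<dots> = (\<Sum>t=1..n. multiplicity p t)"
    by (rule sum.reindex_bij_witness[of _ "\<lambda>t. t + K" "\<lambda>j. j - K"]) auto
  finally show ?thesis using sum_multiplicity_le[OF prime odd, of n] by linarith
qed

lemma v_zero: "v 0 = 0"
  using unit by (rule not_dvd_imp_multiplicity_0)

lemma offdiag_Zp: "offdiag p i k \<in> Zp"
  using Zp_mult[OF Zp_power[OF Zp_of_nat] half_Zp, of p 2] Zp_of_nat[of p] by (auto simp: offdiag_def)

lemma is_bidiagonal: "bidiagonal p h (offdiag p i) (\<lambda>k. of_nat (index i k)) v f"
proof (unfold_locales)
  fix k
  show "offdiag p i k \<in> Zp" by (rule offdiag_Zp)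
  show "offdiag p i k \<noteq> 0" using prime by (auto simp: offdiag_def)
  show "of_nat (index i k) \<in> Zp" by (rule Zp_of_nat)
  show "of_nat (index i k) \<noteq> (0 :: rat)" using index_gt by simp
next
  fix k
  show "(\<Prod>j<k. - offdiag p i j / of_nat (index i (Suc j))) \<in> Zp"
    using alpha_div[of 0 k] by (auto simp: \<alpha>_def)
next
  fix n
  show "\<exists>N. \<forall>k\<ge>N. \<exists>z\<in>Zp. (\<Prod>j<k. - offdiag p i j / of_nat (index i (Suc j))) = of_nat p ^ n * z"
    using alpha_div[of n] unfolding \<alpha>_def by blast
next
  fix K l assume l: "K \<le> l" "l \<le> K + v K"
  have "\<alpha> l / \<alpha> K \<in> Zp"
  proof (cases "K = 0")
    case True
    then show ?thesis using l v_zero Zp_one by (simp add: \<alpha>_def)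
  next
    case False
    obtain n where n: "l = K + n" "n \<le> v K" using l by (metis le_Suc_ex add_le_cancel_left)
    have "(\<Sum>j\<in>{K<..K + n}. v j) \<le> 2 * n" using sum_v_window[of K n] n False by simp
    moreover have "1 \<le> K" using False by simp
    ultimately show ?thesis unfolding n alpha_quotient[OF \<open>1 \<le> K\<close>]
      by (intro Zp_mult Zp_power half_Zp Zp_minus Zp_one prod_quotient) simp_all
  qed
  then show "(\<Prod>j<l. - offdiag p i j / of_nat (index i (Suc j))) / (\<Prod>j<K. - offdiag p i j / of_nat (index i (Suc j))) \<in> Zp"
    by (simp add: \<alpha>_def)
next
  fix K
  have "offdiag p i (K + v K) * \<alpha> (K + v K) / (\<alpha> K * of_nat (index i K)) \<in> Zp"
  proof (cases "K = 0")
    case True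
    have "of_int 1 / of_nat (index i 0) \<in> Zp" using unit by (rule Zp_frac)
    then have "offdiag p i 0 * (of_int 1 / of_nat (index i 0)) \<in> Zp" using offdiag_Zp by (intro Zp_mult)
    then show ?thesis using True v_zero by (simp add: \<alpha>_def)
  next
    case False
    let ?n = "v K"
    have ins: "insert K {K<..K + ?n} = {K..K + ?n}" by auto
    have "offdiag p i (K + ?n) * \<alpha> (K + ?n) / (\<alpha> K * of_nat (index i K)) =
       offdiag p i (K + ?n) * (\<alpha> (K + ?n) / \<alpha> K) * (1 / of_nat (index i K))" by simp
    also have "\<dots> = (-1) ^ ?n * (1 / 2) ^ Suc ?n * (of_nat p ^ (2 * ?n + 2) / of_nat (\<Prod>j\<in>insert K {K<..K + ?n}. index i j))"
      using False alpha_quotient[of K ?n] by (simp add: offdiag_def power2_eq_square mult_ac)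
    also have "\<dots> \<in> Zp"
      using sum_v_window[of K ?n] False
      by (intro Zp_mult Zp_power half_Zp Zp_minus Zp_one prod_quotient) auto
    finally show ?thesis .
  qed
  then show "offdiag p i (K + v K) * (\<Prod>j<K + v K. - offdiag p i j / of_nat (index i (Suc j))) /
       ((\<Prod>j<K. - offdiag p i j / of_nat (index i (Suc j))) * of_nat (index i K)) \<in> Zp"
    by (simp add: \<alpha>_def)
next
  fix K l assume "K < l" "l \<le> K + v K"
  then show "v l < v K" by (rule v_less)
next
  show "f 0 = 0" by simp
  show "strict_mono f" by (auto simp: strict_mono_def)
  fix k
  have "of_nat p ^ f k / (\<Prod>j<k. offdiag p i j) = 2 ^ (k - (if i = 0 then 1 else 0))"
    unfolding offdiag_prod using prime by (simp add: power_one_over)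
  moreover have "2 ^ (k - (if i = 0 then 1 else 0)) \<in> Zp" using Zp_power[OF Zp_of_nat[of 2]] by simp
  ultimately show "of_nat p ^ f k / (\<Prod>j<k. offdiag p i j) \<in> Zp" by simp
qed

end

section \<open>Negative cyclic homology in even degrees\<close>

lemma dquot_half:
  fixes h :: "rat \<Rightarrow> 'a::{comm_ring,comm_monoid_mult}"
  assumes "localized p h" "odd p"
  shows "dquot p (h (1 / 2))"
proof -
  interpret localized p h by fact
  have "\<not> p dvd 2" using assms(2) prime by (metis even_numeral primes_dvd_imp_eq two_is_prime_nat)
  then have half: "1 / 2 \<in> Zp" using Zp_frac[of 2 1] by simp
  show ?thesis
  proof
    have "h (1 / 2 + 1 / 2) = h (1 / 2) + h (1 / 2)" using half by (intro h_add)
    then show "h (1 / 2) + h (1 / 2) = 1" by (simp add: h_one)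
    show "nat_mult p 1 * r = 0 \<Longrightarrow> r = 0" for r :: 'a using prime_cancel[of r] by (simp add: h_of_nat)
  qed
qed

text \<open>  In nonpositive degrees the chains start in Hochschild degree \<open>0\<close> whatever \<open>i\<close> is. So the
  complex is that of degree \<open>0\<close> with the index shifted by \<open>k0 = - i / 2\<close>, and \<open>i0 = 0\<close>. In
  positive degrees \<open>i0 = i\<close> and there is no shift.\<close>

lemma HC_minus_even:
  fixes h :: "rat \<Rightarrow> 'a::{comm_ring,comm_monoid_mult}" and i0 :: nat and i :: int
  assumes prog: "progression p h i0" and even: "even i" and i: "i = int i0 \<or> i \<le> 0 \<and> i0 = 0"
  shows "HC_minus (ring_dquot p :: (nat, 'a) based_dga) i
     \<cong>\<^sub>m completion p \<times>\<^sub>m Prod_module (\<lambda>k. ring_mod (index i0 (k + (if i0 = 0 then 1 else 0))))"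
    (is "_ \<cong>\<^sub>m ?N")
proof -
  interpret progression p h i0 by fact
  interpret dquot p "h (1 / 2)" by (rule dquot_half) (unfold_locales, rule odd)
  interpret bd: bidiagonal p h "offdiag p i0" "\<lambda>k. of_nat (index i0 k)" v f
    "\<lambda>k. \<Prod>j<k. - offdiag p i0 j / of_nat (index i0 (Suc j))"
    by (rule is_bidiagonal)
  let ?s = "if i0 = 0 then 1 else 0 :: nat"
  have "multiples (of_nat (index i0 0)) = UNIV"
  proof (intro equalityI subsetI UNIV_I)
    fix r
    have u: "of_int 1 / of_nat (index i0 0) \<in> Zp" using unit by (rule Zp_frac)
    have "h (of_nat (index i0 0) * (of_int 1 / of_nat (index i0 0))) = h (of_nat (index i0 0)) * h (of_int 1 / of_nat (index i0 0))"
      by (intro h_mult u Zp_of_nat)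
    then have "r = h (of_nat (index i0 0)) * (h (of_int 1 / of_nat (index i0 0)) * r)"
      using index_pos by (simp add: h_one mult.assoc[symmetric])
    then show "r \<in> multiples (of_nat (index i0 0))" by (rule multiplesI)
  qed
  note u = this
  have s: "?s = 0 \<or> ?s = 1" by simp
  obtain F where F: "\<And>c. F c \<in> carrier ?N"
    "\<And>c c'. F (\<lambda>k. c k + c' k) = F c \<oplus>\<^bsub>?N\<^esub> F c'"
    "\<And>r c. F (\<lambda>k. r * c k) = r \<odot>\<^bsub>?N\<^esub> F c"
    "\<And>c c'. F c = F c' \<longleftrightarrow> (\<exists>r. \<forall>k. c k - c' k = bd.bid r k)"
    "\<And>y. y \<in> carrier ?N \<Longrightarrow> \<exists>c. F c = y"
    by (rule bd.cokernel_iso[of "index i0" ?s, OF refl s u]) blast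
  define k0 where "k0 = nat ((int i0 - i) div 2)"
  have even0: "even i0" using even i by auto
  have k0: "i + 2 * int k0 = int i0" using even i even0 unfolding k0_def by (auto elim!: evenE)
  have dc: "dcoef (nat (i + 1 + 2 * int (k0 + j))) = h (offdiag p i0 j)" for j
  proof -
    have n: "nat (i + 1 + 2 * int (k0 + j)) = i0 + 1 + 2 * j" using k0 by simp
    have "h (of_nat p ^ 2 / 2) = h (1 / 2) * nat_mult p 1 * nat_mult p 1"
      using h_mult[OF half_Zp Zp_mult[OF Zp_of_nat[of p] Zp_of_nat[of p]]] h_mult[OF Zp_of_nat[of p] Zp_of_nat[of p]]
      by (simp add: h_of_nat power2_eq_square mult.assoc)
    then show ?thesis unfolding n using even0 by (auto simp: dcoef_def offdiag_def h_of_nat)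
  qed
  have bc: "bcoef (nat (i + 1 + 2 * int (k0 + j))) = h (of_nat (index i0 (Suc j)))" for j
  proof -
    have n: "nat (i + 1 + 2 * int (k0 + j)) = i0 + 1 + 2 * j" using k0 by simp
    have m: "index i0 (Suc j) = i0 + 1 + 2 * j" by (simp add: index_def)
    show ?thesis unfolding n m bcoef_def h_of_nat using even0 by simp
  qed
  have shift: "small_d (i + 1) r (k0 + j) = bd.bid (\<lambda>j. r (k0 + j)) j" if r: "\<And>k. k < k0 \<Longrightarrow> r k = 0" for r j
  proof (cases j)
    case 0
    then show ?thesis using dc[of 0] r[of "k0 - 1"] by (simp add: small_d_def bd.bid_def)
  next
    case (Suc j')
    then show ?thesis using dc[of j] bc[of j'] by (simp add: small_d_def bd.bid_def)
  qed
  have low: "small_d (i + 1) r k = 0" if "k < k0" "\<And>k. k < k0 \<Longrightarrow> r k = 0" for r k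
    using that by (simp add: small_d_def)
  define G where "G u = F (\<lambda>k. proj (u (k0 + k)))" for u :: "nat \<Rightarrow> 'a chain"
  have neg: "k < k0 \<longleftrightarrow> i + 2 * int k < 0" for k
    using k0 i by auto
  have neg1: "k < k0 \<longleftrightarrow> i + 1 + 2 * int k < 0" for k
    unfolding neg using even by presburger
  have V: "submodule_closed (\<lambda>r c k. pm_scale r (c k)) (boundaries i)"
    unfolding submodule_closed_def boundaries_def
  proof (intro conjI ballI allI)
    show "0 \<in> D ` NC (i + 1)" by (rule image_eqI[of _ _ 0]) (simp_all add: D_zero NC_closed)
    fix x assume "x \<in> D ` NC (i + 1)"
    then obtain e where e: "e \<in> NC (i + 1)" "x = D e" by blast
    show "(\<lambda>k. pm_scale r (x k)) \<in> D ` NC (i + 1)" for r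
      by (rule image_eqI[of _ _ "\<lambda>k. pm_scale r (e k)"]) (simp_all add: e D_scale NC_closed)
    fix y assume "y \<in> D ` NC (i + 1)"
    then obtain e' where e': "e' \<in> NC (i + 1)" "y = D e'" by blast
    show "x - y \<in> D ` NC (i + 1)"
      by (rule image_eqI[of _ _ "e - e'"]) (simp_all add: e e' D_diff NC_closed)
  qed
  have U: "submodule_closed (\<lambda>r c k. pm_scale r (c k)) (cycles i)"
    unfolding submodule_closed_def cycles_def
    by (auto simp: NC_closed D_zero D_diff D_scale)
  show ?thesis
    unfolding HC_minus_eq
  proof (rule quotient_module_iso[OF boundaries_subset V U, where F = G])
    show "(\<lambda>k. pm_scale r ((x + y) k)) = (\<lambda>k. pm_scale r (x k)) + (\<lambda>k. pm_scale r (y k))" for r and x y :: "nat \<Rightarrow> 'a chain"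
      by (rule ext) (simp add: pm_scale_add)
    show "G u \<in> carrier ?N" for u unfolding G_def by (rule F)
    show "G (u + u') = G u \<oplus>\<^bsub>?N\<^esub> G u'" for u u'
      unfolding G_def F(2)[symmetric] by simp
    show "G (\<lambda>k. pm_scale r (u k)) = r \<odot>\<^bsub>?N\<^esub> G u" for r u
      unfolding G_def F(3)[symmetric] by simp
    show "\<exists>u\<in>cycles i. G u = y" if "y \<in> carrier ?N" for y
    proof -
      obtain c where c: "F c = y" using F(5) \<open>y \<in> carrier ?N\<close> by blast
      obtain u where u: "u \<in> cycles i" "\<forall>k. proj (u k) = (if k < k0 then 0 else c (k - k0))"
        using even_cycles_surj[OF even, of "\<lambda>k. if k < k0 then 0 else c (k - k0)"] neg by auto
      then have "G u = y" unfolding G_def using c by simp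
      with u(1) show ?thesis by blast
    qed
    fix u u' assume u: "u \<in> cycles i" "u' \<in> cycles i"
    have uu: "u - u' \<in> cycles i" using submodule_closedD(2)[OF U u] .
    have low0: "proj ((u - u') k) = 0" if "k < k0" for k
      using NC_negative[of "u - u'" i k] uu that neg[of k] unfolding cycles_def by simp
    have "G u = G u' \<longleftrightarrow> (\<exists>r. \<forall>k. proj ((u - u') (k0 + k)) = bd.bid r k)"
      unfolding G_def F(4) by simp
    also have "\<dots> \<longleftrightarrow> (\<exists>r. (\<forall>k. i + 1 + 2 * int k < 0 \<longrightarrow> r k = 0) \<and> (\<forall>k. proj ((u - u') k) = small_d (i + 1) r k))"
    proof
      assume "\<exists>r. \<forall>k. proj ((u - u') (k0 + k)) = bd.bid r k"
      then obtain r where r: "\<And>k. proj ((u - u') (k0 + k)) = bd.bid r k" by blast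
      define r' where "r' k = (if k < k0 then 0 else r (k - k0))" for k
      have r'0: "k < k0 \<Longrightarrow> r' k = 0" for k by (simp add: r'_def)
      have "proj ((u - u') k) = small_d (i + 1) r' k" for k
      proof (cases "k < k0")
        case True
        then show ?thesis using low0[of k] low[of k r', OF _ r'0] by simp
      next
        case False
        then obtain j where j: "k = k0 + j" by (metis le_Suc_ex not_less)
        have "small_d (i + 1) r' (k0 + j) = bd.bid (\<lambda>j. r' (k0 + j)) j"
          by (rule shift) (rule r'0)
        also have "(\<lambda>j. r' (k0 + j)) = r" by (simp add: r'_def)
        finally show ?thesis unfolding j r by (rule sym)
      qed
      then show "\<exists>r. (\<forall>k. i + 1 + 2 * int k < 0 \<longrightarrow> r k = 0) \<and> (\<forall>k. proj ((u - u') k) = small_d (i + 1) r k)"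
        using r'0 neg1 by blast
    next
      assume "\<exists>r. (\<forall>k. i + 1 + 2 * int k < 0 \<longrightarrow> r k = 0) \<and> (\<forall>k. proj ((u - u') k) = small_d (i + 1) r k)"
      then obtain r where r: "\<And>k. k < k0 \<Longrightarrow> r k = 0" "\<And>k. proj ((u - u') k) = small_d (i + 1) r k"
        using neg1 by blast
      then show "\<exists>r. \<forall>k. proj ((u - u') (k0 + k)) = bd.bid r k"
        using shift[of r, OF r(1)] by auto
    qed
    also have "\<dots> \<longleftrightarrow> u - u' \<in> boundaries i" using boundaries_iff[OF uu] by simp
    finally show "G u = G u' \<longleftrightarrow> u - u' \<in> boundaries i" .
  qed
qed

section \<open>The index set\<close>

lemma three_le_odd_prime: "prime (p :: nat) \<Longrightarrow> odd p \<Longrightarrow> 3 \<le> p"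
  using prime_ge_2_nat[of p] by (cases "p = 2") auto

lemma multiplicity_odd_index:
  assumes "prime p" "odd (p :: nat)" "1 \<le> j"
  shows "multiplicity p (2 * j - 1) + 1 \<le> j"
proof (rule ccontr)
  assume "\<not> ?thesis"
  then have "p ^ j dvd 2 * j - 1" by (intro multiplicity_ge_dvd) simp
  then have "p ^ j \<le> 2 * j - 1" using assms(3) by (intro dvd_imp_le) auto
  moreover have "(3 :: nat) ^ j \<le> p ^ j" using three_le_odd_prime[OF assms(1,2)] by (intro power_mono) auto
  moreover have "2 * j \<le> (3 :: nat) ^ j"
  proof (induction j)
    case (Suc j)
    define x where "x = (3 :: nat) ^ j"
    have "1 \<le> x" "2 * j \<le> x" using Suc by (simp_all add: x_def)
    then have "2 * Suc j \<le> 3 * x" by simp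
    then show ?case by (simp add: x_def)
  qed simp
  ultimately show False using assms(3) by linarith
qed

text \<open>  A power \<open>p\<^sup>e\<close> dividing \<open>2 (m + 2 j) = p\<^sup>b \<plusminus> 1 + 4 j\<close> divides \<open>4 j \<plusminus> 1\<close> if \<open>e \<le> b\<close>, and otherwise
  exceeds \<open>p\<^sup>b\<close> at least threefold. In both cases \<open>2 p\<^sup>e \<le> 12 j + 3\<close>, which is impossible for
  \<open>e > j\<close>.\<close>

lemma multiplicity_half_power_index:
  assumes p: "prime p" "odd (p :: nat)" and j: "1 \<le> j" and m: "2 * m + 1 = p ^ b \<or> 2 * m = p ^ b + 1"
  shows "multiplicity p (m + 2 * j) \<le> j"
proof (rule ccontr)
  assume large: "\<not> ?thesis"
  define e where "e = multiplicity p (m + 2 * j)"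
  have e: "j < e" using large by (simp add: e_def)
  have p3: "3 \<le> p" by (rule three_le_odd_prime[OF p])
  have "p ^ e dvd 2 * (m + 2 * j)" unfolding e_def by (intro dvd_mult multiplicity_ge_dvd) simp
  have "2 * p ^ e \<le> 12 * j + 3"
  proof (cases "e \<le> b")
    case True
    then have d: "p ^ e dvd p ^ b" by (rule le_imp_power_dvd)
    from m have "p ^ e \<le> 4 * j + 1"
    proof
      assume "2 * m + 1 = p ^ b"
      then have "2 * (m + 2 * j) = p ^ b + (4 * j - 1)" using j by simp
      then have "p ^ e dvd 4 * j - 1" using \<open>p ^ e dvd 2 * (m + 2 * j)\<close> d by (simp add: dvd_add_right_iff)
      then have "p ^ e \<le> 4 * j - 1" using j by (intro dvd_imp_le) auto
      then show ?thesis by simp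
    next
      assume "2 * m = p ^ b + 1"
      then have "2 * (m + 2 * j) = p ^ b + (4 * j + 1)" by simp
      then have "p ^ e dvd 4 * j + 1" using \<open>p ^ e dvd 2 * (m + 2 * j)\<close> d by (simp only: dvd_add_right_iff)
      then show ?thesis by (intro dvd_imp_le) auto
    qed
    then show ?thesis by simp
  next
    case False
    then have "p ^ Suc b \<le> p ^ e" using p3 by (intro power_increasing) auto
    moreover have "3 * p ^ b \<le> p ^ Suc b" using p3 by simp
    ultimately have "3 * p ^ b \<le> p ^ e" by (rule order_trans[rotated])
    moreover have "p ^ e \<le> 2 * (m + 2 * j)" using \<open>p ^ e dvd 2 * (m + 2 * j)\<close> j by (intro dvd_imp_le) auto
    moreover have "3 * y \<le> x \<Longrightarrow> x \<le> 2 * (m + 2 * j) \<Longrightarrow> 2 * m + 1 = y \<or> 2 * m = y + 1 \<Longrightarrow> 2 * x \<le> 12 * j + 3"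
      for x y :: nat by presburger
    ultimately show ?thesis using m by blast
  qed
  moreover have "(3 :: nat) ^ Suc j \<le> p ^ e"
  proof -
    have "(3 :: nat) ^ Suc j \<le> 3 ^ e" using e by (intro power_increasing) auto
    also have "\<dots> \<le> p ^ e" using p3 by (intro power_mono) auto
    finally show ?thesis .
  qed
  moreover have "12 * j + 3 < 2 * (3 :: nat) ^ Suc j"
    using j by (induction j rule: dec_induct) auto
  ultimately show False by linarith
qed

lemma half_power_not_dvd:
  assumes p: "prime p" "odd (p :: nat)" and b: "0 < b" and m: "2 * m + 1 = p ^ b \<or> 2 * m = p ^ b + 1"
  shows "\<not> p dvd m"
proof
  assume "p dvd m"
  then have d: "p dvd 2 * m" by simp
  have db: "p dvd p ^ b" using b by simp
  from m have "p dvd 1"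
  proof
    assume "2 * m + 1 = p ^ b"
    then have "p dvd 2 * m + 1" using db by simp
    then show ?thesis using dvd_add_right_iff[OF d, of 1] by blast
  next
    assume "2 * m = p ^ b + 1"
    then have "p dvd p ^ b + 1" using d by simp
    then show ?thesis using dvd_add_right_iff[OF db, of 1] by blast
  qed
  then show False using p by auto
qed

lemma rat_val_frac:
  assumes p: "prime p" and x: "0 < x" "0 < y"
  shows "rat_val p (of_nat x / of_nat y) = int (multiplicity p x) - int (multiplicity p y)"
proof -
  define q :: rat where "q = of_nat x / of_nat y"
  obtain a b where ab: "quotient_of q = (a, b)" by (cases "quotient_of q")
  have b: "0 < b" using quotient_of_denom_pos[OF ab] .
  have q: "q = of_int a / of_int b" using quotient_of_div[OF ab] .
  have "of_nat x * of_int b = (of_int a * of_nat y :: rat)"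
    using q b x by (simp add: q_def field_simps)
  then have eq: "int x * b = a * int y" by (metis of_int_eq_iff of_int_mult of_int_of_nat_eq)
  then have a: "a \<noteq> 0" using x b by auto
  have pe: "prime_elem (int p)" using p by simp
  have "multiplicity (int p) (int x) + multiplicity (int p) b = multiplicity (int p) a + multiplicity (int p) (int y)"
    using prime_elem_multiplicity_mult_distrib[OF pe, of "int x" b] prime_elem_multiplicity_mult_distrib[OF pe, of a "int y"] eq a b x by simp
  moreover have "multiplicity (int p) (int z) = multiplicity p z" for z
  proof -
    have "{n. int p ^ n dvd int z} = {n. p ^ n dvd z}" by (metis of_nat_dvd_iff of_nat_power)
    then show ?thesis by (simp add: multiplicity_def)
  qed
  ultimately show ?thesis unfolding rat_val_def q_def[symmetric] ab by simp
qed

lemma seq_B_even: "seq_B p (2 * t) = of_nat (p ^ (2 * t)) / of_nat (2 ^ t * fact t)"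
proof (induction t)
  case (Suc t)
  have "seq_B p (2 * Suc t) = of_nat p ^ 2 * seq_B p (2 * t) / of_nat (2 * Suc t)" by simp
  also have "\<dots> = of_nat (p ^ 2 * p ^ (2 * t)) / of_nat ((2 ^ t * fact t) * (2 * Suc t))"
    unfolding Suc by (simp only: of_nat_mult of_nat_power times_divide_eq_right divide_divide_eq_left)
  also have "p ^ 2 * p ^ (2 * t) = p ^ (2 * Suc t)" by (simp add: power2_eq_square)
  also have "(2 ^ t * fact t) * (2 * Suc t) = 2 ^ Suc t * fact (Suc t)" by (simp del: mult_Suc mult_Suc_right add: mult_ac)
  finally show ?case .
qed simp

text \<open>  The valuation is \<open>2 t\<close> minus that of \<open>t!\<close>, which is at most \<open>t / 2\<close>.\<close>

lemma rat_val_seq_B: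
  assumes p: "prime p" "odd (p :: nat)"
  shows "int t \<le> rat_val p (seq_B p (2 * t))"
proof -
  have pe: "prime_elem p" using p by simp
  have "0 < p" using p prime_gt_0_nat by blast
  have "\<not> p dvd 2 ^ t" using p by (metis prime_dvd_power_nat primes_dvd_imp_eq two_is_prime_nat even_numeral)
  then have "multiplicity p (2 ^ t) = 0" by (rule not_dvd_imp_multiplicity_0)
  moreover have "multiplicity p (fact t) = (\<Sum>u=1..t. multiplicity p u)"
    unfolding fact_prod using pe by (simp add: prime_elem_multiplicity_prod_distrib)
  ultimately have "multiplicity p (2 ^ t * fact t) \<le> t"
    using sum_multiplicity_le[OF p, of t] prime_elem_multiplicity_mult_distrib[OF pe, of "2 ^ t" "fact t"] by simp
  moreover have "multiplicity p (p ^ (2 * t)) = 2 * t" using p by (intro multiplicity_same_power) auto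
  ultimately show ?thesis
    unfolding seq_B_even using p \<open>0 < p\<close> by (subst rat_val_frac) auto
qed

lemma gap_le:
  assumes p: "prime p" "odd p" and n: "0 < n" "p dvd n"
  shows "gap p n + 2 \<le> 2 * multiplicity p n"
proof -
  let ?S = "{j. even j \<and> rat_val p (seq_B p j) < rat_val p (of_nat n)}"
  have val: "rat_val p (of_nat n) = int (multiplicity p n)"
    using rat_val_frac[of p n 1] p n by simp
  have pos: "1 \<le> multiplicity p n"
    using n p by (intro multiplicity_geI) auto
  have sub: "j + 2 \<le> 2 * multiplicity p n" if "j \<in> ?S" for j
  proof -
    have j: "even j" "rat_val p (seq_B p j) < int (multiplicity p n)" using \<open>j \<in> ?S\<close> val by simp_all
    then obtain t where t: "j = 2 * t" by (elim evenE)
    have "int t < int (multiplicity p n)" using rat_val_seq_B[OF p, of t] j(2) unfolding t by linarith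
    then show ?thesis unfolding t by simp
  qed
  have "?S \<subseteq> {..2 * multiplicity p n}" by (intro subsetI, drule sub) simp
  then have fin: "finite ?S" by (rule finite_subset) simp
  have "rat_val p (seq_B p 0) = 0" using rat_val_frac[of p 1 1] p by simp
  then have "0 \<in> ?S" using val pos by simp
  then have "?S \<noteq> {}" by blast
  with fin have "Max ?S \<in> ?S" by (rule Max_in)
  then show ?thesis unfolding gap_def by (rule sub)
qed

text \<open>  For an odd multiple \<open>n\<close> of \<open>p\<close> with \<open>n \<le> m\<close> and valuation \<open>v\<close>, the difference \<open>p\<^sup>b - 2 n\<close> is a positive
  multiple of \<open>p\<^sup>v\<close>. Hence \<open>m - n\<close> is at least \<open>(p\<^sup>v - 1) / 2\<close>, whereas the gap of \<open>n\<close> is at most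
  \<open>2 v - 2\<close>.\<close>

lemma half_power_in_Z1:
  assumes p: "prime p" "odd p" and m: "odd m" and b: "2 * m + 1 = p ^ b \<or> 2 * m = p ^ b + 1"
  shows "m \<in> Z1_set p"
proof -
  have p3: "3 \<le> p" by (rule three_le_odd_prime[OF p])
  have "n + gap p n < m" if n: "odd n" "p dvd n" "n \<le> m" for n
  proof -
    define v where "v = multiplicity p n"
    have n0: "0 < n" using n by (auto intro: Nat.gr0I)
    have v: "1 \<le> v" unfolding v_def using n n0 p by (intro multiplicity_geI) auto
    have "p ^ v dvd n" unfolding v_def by (rule multiplicity_ge_dvd) simp
    have "p ^ v \<le> n" using \<open>p ^ v dvd n\<close> n0 by (intro dvd_imp_le) auto
    have "m < p ^ b"
    proof -
      have "1 \<le> n" "p \<le> n" using n n0 by (auto intro: dvd_imp_le)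
      then show ?thesis using b p3 n(3) by linarith
    qed
    then have "p ^ v < p ^ b" using \<open>p ^ v \<le> n\<close> n(3) by linarith
    then have "v < b" using p3 by (simp add: power_strict_increasing_iff)
    define D where "D = int p ^ b - 2 * int n"
    have "int p ^ v dvd int p ^ b" using \<open>v < b\<close> by (intro le_imp_power_dvd) simp
    moreover have "int p ^ v dvd int n" using \<open>p ^ v dvd n\<close> by (metis of_nat_dvd_iff of_nat_power)
    ultimately have dvd: "int p ^ v dvd D" unfolding D_def by (intro dvd_diff dvd_mult)
    have bi: "2 * int m + 1 = int p ^ b \<or> 2 * int m = int p ^ b + 1"
      using b by (metis of_nat_1 of_nat_add of_nat_mult of_nat_numeral of_nat_power)
    then have "-1 \<le> D" using n(3) unfolding D_def by linarith
    have pv3: "(3 :: int) ^ v \<le> int p ^ v" using p3 by (intro power_mono) auto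
    have v3: "4 * int v - 2 \<le> 3 ^ v" using v by (induction v rule: dec_induct) auto
    have "odd D" unfolding D_def using p(2) by simp
    have "D \<noteq> -1"
    proof
      assume "D = -1"
      then have "int p ^ v dvd 1" using dvd by simp
      then have "int p ^ v \<le> 1" by (intro zdvd_imp_le) auto
      then show False using pv3 v3 v by linarith
    qed
    moreover have "D \<noteq> 0" using \<open>odd D\<close> by auto
    ultimately have "0 < D" using \<open>-1 \<le> D\<close> by linarith
    then have "int p ^ v \<le> D" using dvd by (intro zdvd_imp_le)
    then have "4 * int v - 2 \<le> D" using pv3 v3 by linarith
    then have "2 * int v - 2 < int m - int n" using bi unfolding D_def by linarith
    moreover have "gap p n + 2 \<le> 2 * v" unfolding v_def by (rule gap_le[OF p n0 n(2)])
    ultimately show ?thesis by linarith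
  qed
  then show ?thesis unfolding Z1_set_def using m by (fastforce simp: not_le)
qed

theorem theorem1p3:
  fixes p :: nat
  assumes "prime p" and "odd p"
    and "Z_localized_algebra p TYPE('a::{comm_ring,comm_monoid_mult})"
    and "inj (nat_mult p :: 'a \<Rightarrow> 'a)"
  shows "(\<forall>i. odd i \<longrightarrow>
       carrier (HC_minus (ring_dquot p :: (nat, 'a) based_dga) i)
         = {\<zero>\<^bsub>HC_minus (ring_dquot p :: (nat, 'a) based_dga) i\<^esub>}) \<and>
    (\<forall>i. even i \<and> i \<le> 0 \<longrightarrow>
       HC_minus (ring_dquot p :: (nat, 'a) based_dga) i
         \<cong>\<^sub>m completion p \<times>\<^sub>m Prod_module (\<lambda>k. ring_mod (1 + 2 * k))) \<and>
    (\<exists>Zbar. Zbar \<subseteq> Z_set p \<and> infinite Zbar \<and>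
       (\<forall>i \<in> Zbar.
          HC_minus (ring_dquot p :: (nat, 'a) based_dga) (int i)
            \<cong>\<^sub>m completion p \<times>\<^sub>m Prod_module (\<lambda>k. ring_mod (i - 1 + 2 * k))) \<and>
       {i. even i \<and> (\<exists>a>0. i = (p ^ a + 1) div 2 + 1 \<or> i = (p ^ a - 1) div 2 + 1)} \<subseteq> Zbar)"
proof -
  obtain h :: "rat \<Rightarrow> 'a" where h: "h 1 = 1"
      "\<And>x y. x \<in> Z_localized p \<Longrightarrow> y \<in> Z_localized p \<Longrightarrow> h (x + y) = h x + h y \<and> h (x * y) = h x * h y"
    using assms(3) unfolding Z_localized_algebra_def by blast
  interpret localized p h using assms(1,4) h by unfold_locales
  interpret dquot p "h (1 / 2)" by (rule dquot_half[OF localized_axioms assms(2)])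
  define Zbar where
    "Zbar = {i. even i \<and> (\<exists>a>0. i = (p ^ a + 1) div 2 + 1 \<or> i = (p ^ a - 1) div 2 + 1)}"
  \<comment> \<open>\<open>p\<^sup>a\<close> is odd, so the truncating division is exact; here \<open>m = i - 1\<close>\<close>
  have Zbar: "\<exists>m a. i = m + 1 \<and> odd m \<and> 0 < a \<and> (2 * m + 1 = p ^ a \<or> 2 * m = p ^ a + 1)"
    if i: "i \<in> Zbar" for i
  proof -
    obtain a where a: "even i" "0 < a" "i = (p ^ a + 1) div 2 + 1 \<or> i = (p ^ a - 1) div 2 + 1"
      using i unfolding Zbar_def by blast
    have "odd (p ^ a)" using assms(2) by simp
    then obtain t where "p ^ a = 2 * t + 1" by (elim oddE)
    then have "i = (i - 1) + 1" "2 * (i - 1) + 1 = p ^ a \<or> 2 * (i - 1) = p ^ a + 1" using a(3) by auto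
    moreover have "odd (i - 1)" using a(1) \<open>i = (i - 1) + 1\<close> by (metis even_plus_one_iff)
    ultimately show ?thesis using a(2) by blast
  qed
  \<comment> \<open>\<open>(p\<^sup>a - 1) / 2\<close> and \<open>(p\<^sup>a + 1) / 2\<close> are consecutive, so one of them plus \<open>1\<close> is even\<close>
  have "infinite Zbar"
    unfolding infinite_nat_iff_unbounded
  proof
    fix n
    have "odd (p ^ Suc (2 * n))" using assms(2) by simp
    then obtain t where t: "p ^ Suc (2 * n) = 2 * t + 1" by (elim oddE)
    have "Suc (2 * n) < p ^ Suc (2 * n)" using assms(1) by (intro prime_power_gt prime_gt_1_nat)
    then have nt: "n < t + 1" "n < t + 2" using t by simp_all
    have 1: "t + 2 = (p ^ Suc (2 * n) + 1) div 2 + 1" "t + 1 = (p ^ Suc (2 * n) - 1) div 2 + 1"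
      unfolding t by simp_all
    have "t + 2 \<in> Zbar \<or> t + 1 \<in> Zbar"
    proof (cases "even t")
      case True
      then have "even (t + 2)" by simp
      then show ?thesis unfolding Zbar_def using 1(1) zero_less_Suc by blast
    next
      case False
      then have "even (t + 1)" by simp
      then show ?thesis unfolding Zbar_def using 1(2) zero_less_Suc by blast
    qed
    then show "\<exists>m>n. m \<in> Zbar" using nt by blast
  qed
  moreover have "Zbar \<subseteq> Z_set p"
  proof
    fix i assume "i \<in> Zbar"
    then obtain m a where m: "i = m + 1" "odd m" "2 * m + 1 = p ^ a \<or> 2 * m = p ^ a + 1" using Zbar by blast
    have "m \<in> Z1_set p" by (rule half_power_in_Z1[OF assms(1,2) m(2,3)])
    then show "i \<in> Z_set p" unfolding Z_set_def m(1) by (rule imageI)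
  qed
  moreover have "HC_minus (ring_dquot p :: (nat, 'a) based_dga) (int i)
      \<cong>\<^sub>m completion p \<times>\<^sub>m Prod_module (\<lambda>k. ring_mod (i - 1 + 2 * k))" if i: "i \<in> Zbar" for i
  proof -
    obtain m a where m: "i = m + 1" "odd m" "0 < a" "2 * m + 1 = p ^ a \<or> 2 * m = p ^ a + 1" using Zbar[OF i] by blast
    have index: "index i j = m + 2 * j" for j using m(1) by (simp add: index_def)
    have "progression p h i"
    proof
      show "odd p" by fact
      show "\<not> p dvd index i 0" unfolding index using half_power_not_dvd[OF assms(1,2) m(3,4)] by simp
      show "0 < index i 0" unfolding index using m(2) by (auto intro: Nat.gr0I)
      show "multiplicity p (index i j) + (if i = 0 then 1 else 0) \<le> j" if "1 \<le> j" for j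
        unfolding index using multiplicity_half_power_index[OF assms(1,2) that m(4)] m(1) by simp
    qed
    then have "HC_minus (ring_dquot p :: (nat, 'a) based_dga) (int i)
      \<cong>\<^sub>m completion p \<times>\<^sub>m Prod_module (\<lambda>k. ring_mod (index i (k + (if i = 0 then 1 else 0))))"
      by (rule HC_minus_even) (use m in auto)
    moreover have "index i (k + (if i = 0 then 1 else 0)) = i - 1 + 2 * k" for k
      unfolding index using m(1) by simp
    ultimately show ?thesis by simp
  qed
  moreover have "HC_minus (ring_dquot p :: (nat, 'a) based_dga) i
      \<cong>\<^sub>m completion p \<times>\<^sub>m Prod_module (\<lambda>k. ring_mod (1 + 2 * k))" if i: "even i" "i \<le> 0" for i
  proof -
    have "progression p h 0"
    proof
      show "odd p" by fact
      show "\<not> p dvd index 0 0" using assms(1) by (auto simp: index_def)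
      show "0 < index 0 0" by (simp add: index_def)
      show "multiplicity p (index 0 j) + (if (0::nat) = 0 then 1 else 0) \<le> j" if "1 \<le> j" for j
        using multiplicity_odd_index[OF assms(1,2) that] that by (simp add: index_def)
    qed
    then have "HC_minus (ring_dquot p :: (nat, 'a) based_dga) i
      \<cong>\<^sub>m completion p \<times>\<^sub>m Prod_module (\<lambda>k. ring_mod (index 0 (k + (if (0::nat) = 0 then 1 else 0))))"
      by (rule HC_minus_even) (use i in auto)
    moreover have "index 0 (k + (if (0::nat) = 0 then 1 else 0)) = 1 + 2 * k" for k
      by (simp add: index_def)
    ultimately show ?thesis by simp
  qed
  ultimately show ?thesis
    using odd_HC_minus unfolding Zbar_def[symmetric] by blast
qed

end
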